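(* Let $\mathbb{G}=(\mathscr{M},\Delta,\phi,\psi)$ be a locally compact quantum group and let $\Gamma$ be a regular family of normal states on $\mathscr{M}$. Suppose that the von Neumann algebra $VN(\mathbb{G})$ admits a normal tracial state $\tau$ and that the C*-algebra $C_r^*(\mathbb{G})$ is approximately amenable. (i) If $\mathbb{G}$ is left-covariant over $\Gamma$, then $\mathscr{M}$ admits a right invariant mean. (ii) If $\mathbb{G}$ is right-covariant over $\Gamma$, then $\mathscr{M}$ admits a left invariant mean.
   Context: Locally compact quantum group. A Hopf-von Neumann algebra $(\mathscr{M},\Delta)$ is a von Neumann algebra $\mathscr{M}$ with a normal, unital, injective $*$-homomorphism $\Delta:\mathscr{M}\to\mathscr{M}\overline{\otimes}\mathscr{M}$ (von Neumann tensor product) satisfying $(\Delta\otimes\mathrm{id})\Delta=(\mathrm{id}\otimes\Delta)\Delta$. A locally compact quantum group is a quadruple $\mathbb{G}=(\mathscr{M},\Delta,\phi,\psi)$, where $(\mathscr{M},\Delta)$ is a Hopf-von Neumann algebra and $\phi,\psi$ are normal faithful semifinite weights on $\mathscr{M}^+$ such that $\phi[(\omega\otimes\mathrm{id})\Delta(x)]=\omega(1)\phi(x)$ and $\psi[(\mathrm{id}\otimes\omega)\Delta(x)]=\omega(1)\psi(x)$ for all $\omega\in\mathscr{M}_*^+$, $x\in\mathscr{M}^+$. Product and module actions. The predual $\mathscr{M}_*$ is a Banach algebra with product $\langle f\star g,m\rangle=\langle f\otimes g,\Delta(m)\rangle$ ($f,g\in\mathscr{M}_*$, $m\in\mathscr{M}$).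 For a Banach algebra $A$ and a Banach $A$-bimodule $X$, the dual $X^*$ is a Banach $A$-bimodule via $\langle f\cdot a,x\rangle=\langle f,a\cdot x\rangle$, $\langle a\cdot f,x\rangle=\langle f,x\cdot a\rangle$. Thus $\mathscr{M}=(\mathscr{M}_* )^*$ is an $\mathscr{M}_*$-bimodule, with $F\cdot\omega=(\omega\otimes\mathrm{id})\Delta(F)$ and $\omega\cdot F=(\mathrm{id}\otimes\omega)\Delta(F)$ for $F\in\mathscr{M}$, $\omega\in\mathscr{M}_*$. Left regular representation. Let $\mathfrak{n}_\phi=\{x\in\mathscr{M}:\phi(x^*x)<\infty\}$, let $\mathscr{H}_\phi$ be the Hilbert space completion of $\mathfrak{n}_\phi$ for the inner product $\langle x|y\rangle=\phi(y^*x)$, write $\Lambda_\phi(x)$ for $x\in\mathfrak{n}_\phi$ viewed in $\mathscr{H}_\phi$, and let $\pi_\phi:\mathscr{M}\to\mathscr{B}(\mathscr{H}_\phi)$ be the (faithful, normal) GNS representation $\pi_\phi(a)\Lambda_\phi(b)=\Lambda_\phi(ab)$; $\mathscr{M}$ is identified with $\pi_\phi(\mathscr{M})$. The multiplicative unitary of $\mathbb{G}$ is the unitary $W\in\mathscr{M}\overline{\otimes}\mathscr{B}(\mathscr{H}_\phi)$ on $\mathscr{H}_\phi\otimes_2\mathscr{H}_\phi$ determined by $W^*[\Lambda_\phi(x)\otimes\Lambda_\phi(y)]=(\Lambda_\phi\otimes\Lambda_\phi)[\Delta(y)(x\otimes1)]$ for $x,y\in\mathfrak{n}_\phi$. The left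 regular representation is the injective algebra homomorphism $\lambda:\mathscr{M}_*\to\mathscr{B}(\mathscr{H}_\phi)$, $\lambda(\omega)=(\omega\otimes\mathrm{id})(W)$. $C_r^*(\mathbb{G})$ and $VN(\mathbb{G})$ denote respectively the C*-algebra and the von Neumann algebra generated by $\lambda(\mathscr{M}_* )$. Regular family. A family $\Gamma\subset\mathscr{M}_*$ of normal states on $\mathscr{M}$ is regular if $\operatorname{span}(\Gamma)$ is norm dense in $\mathscr{M}_*$ and $\lambda(\Gamma)$ contains only unitary elements of $C_r^*(\mathbb{G})$. Covariance. For $\Gamma$ regular, $\mathbb{G}$ is left-covariant over $\Gamma$ if for each $\omega\in\Gamma$ the map $L_\omega(F)=\omega\cdot F$ is a normal $*$-automorphism of $\mathscr{M}$ and $\pi_\phi(\omega\cdot F)=\lambda(\omega)\pi_\phi(F)\lambda(\omega)^*$ for all $F\in\mathscr{M}$. $\mathbb{G}$ is right-covariant over $\Gamma$ if for each $\omega\in\Gamma$ the map $R_\omega(F)=F\cdot\omega$ is a normal $*$-automorphism of $\mathscr{M}$ and $\pi_\phi(F\cdot\omega)=\lambda(\omega)^*\pi_\phi(F)\lambda(\omega)$ for all $F\in\mathscr{M}$. Invariant means. A state $\mu\in\mathscr{M}^*$ is a left invariant mean (LIM) if $\mu((\omega\otimes\mathrm{id})\Delta(F))=\omega(1)\mu(F)$ for all $F\in\mathscr{M}$, $\omega\in\mathscr{M}_*$, and a right invariant mean (RIM) if $\mu((\mathrm{id}\otimes\omega)\Delta(F))=\omega(1)\mu(F)$ for all $F\in\mathscr{M}$,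 $\omega\in\mathscr{M}_*$. Approximate amenability. A Banach algebra $A$ is approximately amenable if for each Banach $A$-bimodule $X$ and each continuous derivation $D:A\to X$ (a linear map with $D(ab)=D(a)\cdot b+a\cdot D(b)$) there is a net $(x_i)\subset X$, possibly unbounded, with $D(a)=\lim_i(a\cdot x_i-x_i\cdot a)$ in norm for every $a\in A$. *)

theory Defs
  imports "HOL-Analysis.Analysis"
begin

section \<open>Complex Hilbert spaces\<close>

text \<open>The inner product is linear in its first argument.\<close>

class chilbert = banach + real_inner +
  fixes scaleC :: "complex \<Rightarrow> 'a \<Rightarrow> 'a" (infixr "*\<^sub>C" 75)
    and cinner :: "'a \<Rightarrow> 'a \<Rightarrow> complex"
  assumes scaleC_add_right: "c *\<^sub>C (x + y) = c *\<^sub>C x + c *\<^sub>C y"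
    and scaleC_add_left: "(c + d) *\<^sub>C x = c *\<^sub>C x + d *\<^sub>C x"
    and scaleC_scaleC: "c *\<^sub>C d *\<^sub>C x = (c * d) *\<^sub>C x"
    and scaleC_of_real: "complex_of_real r *\<^sub>C x = r *\<^sub>R x"
    and cinner_commute: "cinner x y = cnj (cinner y x)"
    and cinner_add_left: "cinner (x + y) z = cinner x z + cinner y z"
    and cinner_scaleC_left: "cinner (c *\<^sub>C x) y = c * cinner x y"
    and Re_cinner: "Re (cinner x y) = inner x y"

lemma scaleC_one: "1 *\<^sub>C x = x" for x :: "'a::chilbert"
  using scaleC_of_real[of 1 x] by simp

lemma scaleC_zero: "0 *\<^sub>C x = 0" for x :: "'a::chilbert"
  using scaleC_of_real[of 0 x] by simp

lemma cinner_add_right: "cinner x (y + z) = cinner x y + cinner x z" for x :: "'a::chilbert"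
  by (metis cinner_add_left cinner_commute complex_cnj_add)

lemma cinner_scaleC_right: "cinner x (c *\<^sub>C y) = cnj c * cinner x y" for x :: "'a::chilbert"
  by (metis cinner_commute cinner_scaleC_left complex_cnj_mult)

lemma cinner_scaleR_left: "cinner (r *\<^sub>R x) y = of_real r * cinner x y" for x :: "'a::chilbert"
  by (metis cinner_scaleC_left scaleC_of_real)

lemma cinner_scaleR_right: "cinner x (r *\<^sub>R y) = of_real r * cinner x y" for x :: "'a::chilbert"
  by (metis cinner_scaleC_right scaleC_of_real complex_cnj_complex_of_real)

lemma cinner_self: "cinner x x = of_real ((norm x)\<^sup>2)" for x :: "'a::chilbert"
proof -
  have "Im (cinner x x) = 0"
    by (metis cinner_commute complex_cnj_cancel_iff complex_In_mult_cnj_zero Im_complex_of_real Reals_cnj_iff complex_is_Real_iff)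
  moreover have "Re (cinner x x) = (norm x)\<^sup>2"
    by (simp add: Re_cinner power2_norm_eq_inner)
  ultimately show ?thesis by (simp add: complex_eq_iff)
qed

lemma norm_scaleC: "norm (c *\<^sub>C x) = cmod c * norm x" for x :: "'a::chilbert"
proof -
  have "complex_of_real ((norm (c *\<^sub>C x))\<^sup>2) = complex_of_real ((cmod c * norm x)\<^sup>2)"
    unfolding cinner_self[symmetric] cinner_scaleC_left cinner_scaleC_right
    by (simp add: cinner_self power_mult_distrib mult.assoc[symmetric])
       (metis complex_norm_square mult.commute of_real_power)
  then have "(norm (c *\<^sub>C x))\<^sup>2 = (cmod c * norm x)\<^sup>2"
    using of_real_eq_iff by blast
  then show ?thesis by (simp add: power2_eq_iff_nonneg)
qed

lemma cinner_bound: "cmod (cinner x y) \<le> norm x * norm y" for x y :: "'a::chilbert"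
proof (cases "cinner x y = 0")
  case False
  define c where "c = cinner x y"
  have "(cmod c)\<^sup>2 = Re (cinner (cnj c *\<^sub>C x) y)"
    using complex_norm_square[of c] unfolding cinner_scaleC_left c_def[symmetric]
    by (metis Re_complex_of_real mult.commute)
  also have "\<dots> \<le> norm (cnj c *\<^sub>C x) * norm y"
    unfolding Re_cinner by (rule norm_cauchy_schwarz)
  finally have "cmod c * cmod c \<le> cmod c * (norm x * norm y)"
    by (simp add: norm_scaleC power2_eq_square mult.assoc)
  then show ?thesis using False by (simp add: c_def)
qed simp

lemma bounded_linear_cinner_left: "bounded_linear (\<lambda>x. cinner x y)" for y :: "'a::chilbert"
  by (rule bounded_linear_intro[where K="norm y"])
     (simp_all add: cinner_add_left cinner_scaleR_left scaleR_conv_of_real cinner_bound)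

lemma bounded_linear_cinner_right: "bounded_linear (\<lambda>y. cinner x y)" for x :: "'a::chilbert"
  by (rule bounded_linear_intro[where K="norm x"])
     (simp_all add: cinner_add_right cinner_scaleR_right scaleR_conv_of_real cinner_bound mult.commute[of "norm _" "norm x"])

lemma bounded_linear_scaleC: "bounded_linear (\<lambda>x. c *\<^sub>C x)" for c :: complex
  by (rule bounded_linear_intro[where K="cmod c"])
     (simp_all add: scaleC_add_right norm_scaleC scaleC_of_real[symmetric] scaleC_scaleC mult.commute)

lemmas linear_cinner_left = bounded_linear.linear[OF bounded_linear_cinner_left]
lemmas linear_cinner_right = bounded_linear.linear[OF bounded_linear_cinner_right]
lemmas linear_scaleC = bounded_linear.linear[OF bounded_linear_scaleC]
lemmas cinner_sum_left = linear_sum[OF linear_cinner_left]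
lemmas cinner_sum_right = linear_sum[OF linear_cinner_right]
lemmas cinner_diff_left = linear_diff[OF linear_cinner_left]
lemmas cinner_diff_right = linear_diff[OF linear_cinner_right]

definition cspan :: "'a::chilbert set \<Rightarrow> 'a set" where
  "cspan S = {\<Sum>v\<in>F. c v *\<^sub>C v |F c. finite F \<and> F \<subseteq> S}"

definition is_onb :: "'a::chilbert set \<Rightarrow> bool" where
  "is_onb B \<longleftrightarrow> (\<forall>e\<in>B. norm e = 1) \<and> (\<forall>e\<in>B. \<forall>f\<in>B. e \<noteq> f \<longrightarrow> cinner e f = 0)
     \<and> (\<forall>x. (\<forall>e\<in>B. cinner x e = 0) \<longrightarrow> x = 0)"

lemma is_onb_exists: "\<exists>B::'a::chilbert set. is_onb B"
proof -
  define A where "A = {B::'a set. (\<forall>e\<in>B. norm e = 1) \<and> (\<forall>e\<in>B. \<forall>f\<in>B. e \<noteq> f \<longrightarrow> cinner e f = 0)}"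
  have "\<exists>M\<in>A. \<forall>X\<in>A. M \<subseteq> X \<longrightarrow> X = M"
  proof (rule subset_Zorn')
    fix C assume C: "subset.chain A C"
    show "\<Union>C \<in> A"
      unfolding A_def
    proof (intro CollectI conjI ballI impI)
      fix e assume "e \<in> \<Union>C" then show "norm e = 1"
        using C unfolding subset.chain_def A_def by blast
    next
      fix e f assume e: "e \<in> \<Union>C" "f \<in> \<Union>C" "e \<noteq> f"
      then obtain E F where EF: "E \<in> C" "F \<in> C" "e \<in> E" "f \<in> F" by blast
      then have "E \<subseteq> F \<or> F \<subseteq> E" using C unfolding subset.chain_def by blast
      then obtain G where G: "G \<in> C" "e \<in> G" "f \<in> G" using EF by blast
      then have "G \<in> A" using C unfolding subset.chain_def by blast
      then show "cinner e f = 0" using G e(3) unfolding A_def by blast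
    qed
  qed
  then obtain B where B: "B \<in> A" and max: "\<And>X. X \<in> A \<Longrightarrow> B \<subseteq> X \<Longrightarrow> X = B" by blast
  have "x = 0" if x: "\<forall>e\<in>B. cinner x e = 0" for x
  proof (rule ccontr)
    assume nz: "x \<noteq> 0"
    define u where "u = (1 / norm x) *\<^sub>R x"
    have nu: "norm u = 1" using nz by (simp add: u_def)
    have u0: "cinner u e = 0" "cinner e u = 0" if "e \<in> B" for e
      using x that cinner_commute[of e u] by (auto simp: u_def cinner_scaleR_left)
    have "insert u B \<in> A" using B nu u0 by (auto simp: A_def)
    then have "u \<in> B" using max[of "insert u B"] by blast
    then have "cinner u u = 0" using u0 by blast
    then show False using nu by (simp add: cinner_self)
  qed
  then have "is_onb B" using B by (auto simp: is_onb_def A_def)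
  then show ?thesis ..
qed

definition onb :: "'a::chilbert set" where "onb = (SOME B. is_onb B)"

lemma is_onb_onb: "is_onb onb"
  unfolding onb_def by (rule someI_ex[OF is_onb_exists])

lemma onb_norm: "e \<in> onb \<Longrightarrow> norm e = 1"
  by (metis is_onb_def is_onb_onb)

lemma onb_cinner: "e \<in> onb \<Longrightarrow> f \<in> onb \<Longrightarrow> cinner e f = (if e = f then 1 else 0)"
  by (metis cinner_self is_onb_def is_onb_onb of_real_1 power_one)

lemma onb_maximal: "(\<And>e. e \<in> onb \<Longrightarrow> cinner x e = 0) \<Longrightarrow> x = 0"
  by (metis is_onb_def is_onb_onb)

lemma onb_sum_norm:
  fixes c :: "'a::chilbert \<Rightarrow> complex"
  assumes "finite F" "F \<subseteq> onb"
  shows "(norm (\<Sum>e\<in>F. c e *\<^sub>C e))\<^sup>2 = (\<Sum>e\<in>F. (cmod (c e))\<^sup>2)"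
proof -
  have "complex_of_real ((norm (\<Sum>e\<in>F. c e *\<^sub>C e))\<^sup>2)
      = (\<Sum>e\<in>F. \<Sum>f\<in>F. c e * (cnj (c f) * cinner e f))"
    unfolding cinner_self[symmetric]
    by (subst cinner_sum_left) (simp add: cinner_sum_right cinner_scaleC_left cinner_scaleC_right sum_distrib_left mult.left_commute)
  also have "\<dots> = (\<Sum>e\<in>F. \<Sum>f\<in>F. if f = e then c e * cnj (c e) else 0)"
    using assms by (intro sum.cong refl) (auto simp: onb_cinner subset_iff)
  also have "\<dots> = (\<Sum>e\<in>F. of_real ((cmod (c e))\<^sup>2))"
    using assms by (simp add: complex_norm_square del: of_real_power)
  also have "\<dots> = of_real (\<Sum>e\<in>F. (cmod (c e))\<^sup>2)" by simp
  finally show ?thesis using of_real_eq_iff by blast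
qed

lemma bessel:
  fixes x :: "'a::chilbert"
  assumes "finite F" "F \<subseteq> onb"
  shows "(\<Sum>e\<in>F. (cmod (cinner x e))\<^sup>2) \<le> (norm x)\<^sup>2"
proof -
  define y where "y = (\<Sum>e\<in>F. cinner x e *\<^sub>C e)"
  have ny: "(norm y)\<^sup>2 = (\<Sum>e\<in>F. (cmod (cinner x e))\<^sup>2)"
    unfolding y_def by (rule onb_sum_norm[OF assms])
  have "cinner x y = (\<Sum>e\<in>F. cnj (cinner x e) * cinner x e)"
    by (simp add: y_def cinner_sum_right cinner_scaleC_right)
  also have "\<dots> = (\<Sum>e\<in>F. of_real ((cmod (cinner x e))\<^sup>2))"
    by (intro sum.cong refl) (simp add: complex_norm_square del: of_real_power)
  also have "\<dots> = of_real ((norm y)\<^sup>2)" by (simp add: ny)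
  finally have "inner x y = (norm y)\<^sup>2" by (metis Re_cinner Re_complex_of_real)
  then have "0 \<le> (norm x)\<^sup>2 - (norm y)\<^sup>2"
    using zero_le_power2[of "norm (x - y)"]
    by (simp add: power2_norm_eq_inner inner_diff_left inner_diff_right inner_commute)
  then show ?thesis using ny by simp
qed

lemma summable_onb_cinner: "(\<lambda>e. (cmod (cinner x e))\<^sup>2) summable_on onb" for x :: "'a::chilbert"
  by (rule nonneg_bdd_above_summable_on)
     (auto simp: bdd_above_def intro!: exI[of _ "(norm x)\<^sup>2"] bessel)

lemma has_sum_onb: "((\<lambda>e. cinner x e *\<^sub>C e) has_sum x) onb" for x :: "'a::chilbert"
proof -
  let ?g = "\<lambda>e. (cmod (cinner x e))\<^sup>2" and ?f = "\<lambda>e. cinner x e *\<^sub>C e"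
  have "cauchy_filter (filtermap (sum ?f) (finite_subsets_at_top onb))"
    unfolding cauchy_filter_metric_filtermap
  proof (intro allI impI)
    fix d :: real assume d: "0 < d"
    have "0 < d\<^sup>2 / 4" using d by simp
    then obtain F where F: "finite F" "F \<subseteq> onb" "dist (sum ?g F) (infsum ?g onb) \<le> d\<^sup>2 / 8"
      using infsum_finite_approximation[OF summable_onb_cinner, of "d\<^sup>2/8" x] d by auto
    have small: "dist (sum ?f F') (sum ?f F) < d / 2" if F': "finite F'" "F' \<subseteq> onb" "F \<subseteq> F'" for F'
    proof -
      have "sum ?g F' \<le> infsum ?g onb"
        by (rule finite_sum_le_infsum[OF summable_onb_cinner]) (use F' in auto)
      moreover have "sum ?g (F' - F) = sum ?g F' - sum ?g F"
        using F F' by (simp add: sum_diff)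
      moreover have "infsum ?g onb - sum ?g F \<le> d\<^sup>2/8"
        using abs_ge_minus_self F(3)[unfolded dist_real_def] by (smt (verit))
      ultimately have "sum ?g (F' - F) \<le> d\<^sup>2/8" by linarith
      then have "(norm (sum ?f (F' - F)))\<^sup>2 \<le> d\<^sup>2/8"
        using F' by (subst onb_sum_norm) auto
      also have "\<dots> < (d/2)\<^sup>2" using d by (simp add: power_divide)
      finally have "norm (sum ?f (F' - F)) < d/2"
        using d by (meson half_gt_zero less_eq_real_def power_less_imp_less_base)
      then show ?thesis using F F' by (simp add: sum_diff dist_norm)
    qed
    show "\<exists>P. eventually P (finite_subsets_at_top onb) \<and>
        (\<forall>F1 F2. P F1 \<and> P F2 \<longrightarrow> dist (sum ?f F1) (sum ?f F2) < d)"
    proof (intro exI conjI allI impI)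
      show "eventually (\<lambda>F'. finite F' \<and> F' \<subseteq> onb \<and> F \<subseteq> F') (finite_subsets_at_top onb)"
        using F eventually_finite_subsets_at_top by blast
      fix F1 F2 :: "'a set"
      assume "(finite F1 \<and> F1 \<subseteq> onb \<and> F \<subseteq> F1) \<and> (finite F2 \<and> F2 \<subseteq> onb \<and> F \<subseteq> F2)"
      then have "dist (sum ?f F1) (sum ?f F) < d/2" "dist (sum ?f F2) (sum ?f F) < d/2"
        using small by auto
      then show "dist (sum ?f F1) (sum ?f F2) < d" by (rule dist_triangle_half_l)
    qed
  qed
  moreover have "complete (UNIV::'a set)"
    by (meson Cauchy_convergent UNIV_I complete_def convergent_def)
  ultimately obtain y where "(sum ?f \<longlongrightarrow> y) (finite_subsets_at_top onb)"
    using cauchy_filter_complete_converges[of "filtermap (sum ?f) (finite_subsets_at_top onb)" UNIV]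
    by (auto simp: filtermap_bot_iff filterlim_def)
  then have y: "(?f has_sum y) onb" by (simp add: has_sum_def)
  have "cinner (x - y) e = 0" if e: "e \<in> onb" for e
  proof -
    have "((\<lambda>f. cinner (?f f) e) has_sum cinner y e) onb"
      by (rule has_sum_bounded_linear[OF bounded_linear_cinner_left y])
    moreover have "((\<lambda>f. cinner (?f f) e) has_sum cinner x e) onb"
      by (rule has_sum_finite_neutralI[where B="{e}"])
         (use e in \<open>auto simp: cinner_scaleC_left onb_cinner\<close>)
    ultimately show ?thesis by (simp add: cinner_diff_left has_sum_unique)
  qed
  then have "x - y = 0" by (rule onb_maximal)
  then show ?thesis using y by simp
qed

lemma parseval: "((\<lambda>e. cinner x e * cinner e y) has_sum cinner x y) onb" for x y :: "'a::chilbert"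
  using has_sum_bounded_linear[OF bounded_linear_cinner_left has_sum_onb, of x y]
  by (simp add: cinner_scaleC_left)


section \<open>The Hilbert space tensor product\<close>

text \<open>
  The tensor product is realised as the \<open>\<ell>\<^sup>2\<close>-sum of copies of the first factor indexed by an orthonormal
  basis of the second.  The lemmas \<open>cinner_tens\<close> and \<open>tens_total\<close> below, together with bilinearity,
  characterise it up to a unique unitary compatible with \<open>\<otimes>\<^sub>h\<close>, so the choice of basis is immaterial.
\<close>

typedef (overloaded) ('a::chilbert, 'b::chilbert) htensor =
  "{f :: 'b \<Rightarrow> 'a. (\<forall>e. e \<notin> onb \<longrightarrow> f e = 0) \<and> (\<lambda>e. (norm (f e))\<^sup>2) summable_on onb}"
  by (rule exI[of _ "\<lambda>_. 0"]) simp

setup_lifting type_definition_htensor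

lemma sq_summable_add:
  fixes f g :: "'b \<Rightarrow> 'a::real_normed_vector"
  assumes "(\<lambda>e. (norm (f e))\<^sup>2) summable_on B" "(\<lambda>e. (norm (g e))\<^sup>2) summable_on B"
  shows "(\<lambda>e. (norm (f e + g e))\<^sup>2) summable_on B"
proof (rule summable_on_comparison_test)
  show "(\<lambda>e. 2 * (norm (f e))\<^sup>2 + 2 * (norm (g e))\<^sup>2) summable_on B"
    by (intro summable_on_add summable_on_cmult_right assms)
  fix e
  have "(norm (f e + g e))\<^sup>2 \<le> (norm (f e) + norm (g e))\<^sup>2"
    by (intro power_mono norm_triangle_ineq) simp
  also have "\<dots> \<le> 2 * (norm (f e))\<^sup>2 + 2 * (norm (g e))\<^sup>2"
    using sum_squares_bound[of "norm (f e)" "norm (g e)"] by (simp add: power2_sum)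
  finally show "(norm (f e + g e))\<^sup>2 \<le> 2 * (norm (f e))\<^sup>2 + 2 * (norm (g e))\<^sup>2" .
qed simp_all

lemma sq_summable_cinner:
  fixes f g :: "'b \<Rightarrow> 'a::chilbert"
  assumes "(\<lambda>e. (norm (f e))\<^sup>2) summable_on B" "(\<lambda>e. (norm (g e))\<^sup>2) summable_on B"
  shows "(\<lambda>e. cinner (f e) (g e)) summable_on B"
proof (rule abs_summable_summable, rule summable_on_comparison_test)
  show "(\<lambda>e. (norm (f e))\<^sup>2 + (norm (g e))\<^sup>2) summable_on B"
    by (intro summable_on_add assms)
  fix e
  have "cmod (cinner (f e) (g e)) \<le> norm (f e) * norm (g e)" by (rule cinner_bound)
  also have "\<dots> \<le> (norm (f e))\<^sup>2 + (norm (g e))\<^sup>2"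
    using sum_squares_bound[of "norm (f e)" "norm (g e)"]
      mult_nonneg_nonneg[OF norm_ge_zero[of "f e"] norm_ge_zero[of "g e"]] by linarith
  finally show "norm (cinner (f e) (g e)) \<le> (norm (f e))\<^sup>2 + (norm (g e))\<^sup>2" .
qed simp_all

instantiation htensor :: (chilbert, chilbert) real_inner
begin

lift_definition zero_htensor :: "('a, 'b) htensor" is "\<lambda>_. 0" by simp

lift_definition plus_htensor :: "('a, 'b) htensor \<Rightarrow> ('a, 'b) htensor \<Rightarrow> ('a, 'b) htensor"
  is "\<lambda>f g e. f e + g e" by (simp add: sq_summable_add)

lift_definition uminus_htensor :: "('a, 'b) htensor \<Rightarrow> ('a, 'b) htensor"
  is "\<lambda>f e. - f e" by simp

lift_definition minus_htensor :: "('a, 'b) htensor \<Rightarrow> ('a, 'b) htensor \<Rightarrow> ('a, 'b) htensor"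
  is "\<lambda>f g e. f e - g e"
  subgoal for f g using sq_summable_add[of f onb "\<lambda>e. - g e"] by simp
  done

lift_definition scaleR_htensor :: "real \<Rightarrow> ('a, 'b) htensor \<Rightarrow> ('a, 'b) htensor"
  is "\<lambda>r f e. r *\<^sub>R f e" by (simp add: power_mult_distrib summable_on_cmult_right)

lift_definition inner_htensor :: "('a, 'b) htensor \<Rightarrow> ('a, 'b) htensor \<Rightarrow> real"
  is "\<lambda>f g. \<Sum>\<^sub>\<infinity>e\<in>onb. inner (f e) (g e)" .

definition norm_htensor :: "('a, 'b) htensor \<Rightarrow> real" where
  "norm_htensor f = sqrt (inner f f)"

definition dist_htensor :: "('a, 'b) htensor \<Rightarrow> ('a, 'b) htensor \<Rightarrow> real" where
  "dist_htensor f g = norm (f - g)"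

definition sgn_htensor :: "('a, 'b) htensor \<Rightarrow> ('a, 'b) htensor" where
  "sgn_htensor f = inverse (norm f) *\<^sub>R f"

definition uniformity_htensor :: "(('a, 'b) htensor \<times> ('a, 'b) htensor) filter" where
  "uniformity_htensor = (INF e\<in>{0 <..}. principal {(x, y). dist x y < e})"

definition open_htensor :: "('a, 'b) htensor set \<Rightarrow> bool" where
  "open_htensor U \<longleftrightarrow> (\<forall>x\<in>U. \<forall>\<^sub>F (x', y) in uniformity. x' = x \<longrightarrow> y \<in> U)"

lemma sq_summable_inner:
  fixes f g :: "'c \<Rightarrow> 'd::chilbert"
  assumes "(\<lambda>e. (norm (f e))\<^sup>2) summable_on B" "(\<lambda>e. (norm (g e))\<^sup>2) summable_on B"
  shows "(\<lambda>e. inner (f e) (g e)) summable_on B"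
  unfolding Re_cinner[symmetric] by (rule summable_on_Re[OF sq_summable_cinner[OF assms]])

instance
proof
  fix x y z :: "('a, 'b) htensor" and r s :: real
  show "x + y + z = x + (y + z)" "x + y = y + x" "0 + x = x" "- x + x = 0" "x - y = x + - y"
    "r *\<^sub>R (x + y) = r *\<^sub>R x + r *\<^sub>R y" "(r + s) *\<^sub>R x = r *\<^sub>R x + s *\<^sub>R x"
    "r *\<^sub>R s *\<^sub>R x = (r * s) *\<^sub>R x" "1 *\<^sub>R x = x"
    by (transfer; force simp: algebra_simps)+
  show "inner x y = inner y x"
    by transfer (simp add: inner_commute)
  show "inner (x + y) z = inner x z + inner y z"
    by transfer (simp add: inner_add_left infsum_add sq_summable_inner)
  show "inner (r *\<^sub>R x) y = r * inner x y"
    by transfer (simp add: infsum_cmult_right')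
  show ge: "0 \<le> inner x x"
    by transfer (simp add: infsum_nonneg)
  show "inner x x = 0 \<longleftrightarrow> x = 0"
  proof transfer
    fix f :: "'b \<Rightarrow> 'a"
    assume f: "(\<forall>e. e \<notin> onb \<longrightarrow> f e = 0) \<and> (\<lambda>e. (norm (f e))\<^sup>2) summable_on onb"
    show "(\<Sum>\<^sub>\<infinity>e\<in>onb. inner (f e) (f e)) = 0 \<longleftrightarrow> f = (\<lambda>_. 0)"
    proof
      assume 0: "(\<Sum>\<^sub>\<infinity>e\<in>onb. inner (f e) (f e)) = 0"
      have "inner (f e) (f e) = 0" if "e \<in> onb" for e
        by (rule nonneg_infsum_le_0D[OF eq_refl[OF 0] _ _ that]) (use f in \<open>auto simp: power2_norm_eq_inner\<close>)
      then show "f = (\<lambda>_. 0)" using f by auto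
    qed simp
  qed
qed (simp_all add: norm_htensor_def dist_htensor_def sgn_htensor_def uniformity_htensor_def open_htensor_def)

end

lemma htensor_norm_sq:
  "(norm f)\<^sup>2 = (\<Sum>\<^sub>\<infinity>e\<in>onb. (norm (Rep_htensor f e))\<^sup>2)"
  by (simp add: power2_norm_eq_inner inner_htensor.rep_eq)

lemma htensor_summable: "(\<lambda>e. (norm (Rep_htensor f e))\<^sup>2) summable_on onb"
  using Rep_htensor[of f] by simp

lemma htensor_finite_sum_le:
  assumes "finite F" "F \<subseteq> onb"
  shows "(\<Sum>e\<in>F. (norm (Rep_htensor f e))\<^sup>2) \<le> (norm f)\<^sup>2"
  unfolding htensor_norm_sq by (rule finite_sum_le_infsum[OF htensor_summable assms]) simp

instance htensor :: (chilbert, chilbert) banach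
proof
  fix X :: "nat \<Rightarrow> ('a, 'b) htensor" assume X: "Cauchy X"
  let ?R = "\<lambda>n e. Rep_htensor (X n) e"
  have coord: "norm (Rep_htensor f e) \<le> norm f" for f :: "('a, 'b) htensor" and e
  proof (cases "e \<in> onb")
    case True
    then have "(norm (Rep_htensor f e))\<^sup>2 \<le> (norm f)\<^sup>2"
      using htensor_finite_sum_le[of "{e}" f] by simp
    then show ?thesis by (rule power2_le_imp_le) simp
  next
    case False then show ?thesis using Rep_htensor[of f] by simp
  qed
  have "Cauchy (\<lambda>n. ?R n e)" for e
  proof (rule metric_CauchyI)
    fix d :: real assume "0 < d"
    then obtain N where N: "\<And>m n. N \<le> m \<Longrightarrow> N \<le> n \<Longrightarrow> dist (X m) (X n) < d"
      using metric_CauchyD[OF X] by blast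
    have "dist (?R m e) (?R n e) \<le> dist (X m) (X n)" for m n
      using coord[of "X m - X n" e] by (simp add: dist_norm minus_htensor.rep_eq)
    then show "\<exists>N. \<forall>m\<ge>N. \<forall>n\<ge>N. dist (?R m e) (?R n e) < d"
      using N by (meson le_less_trans)
  qed
  then have lim: "convergent (\<lambda>n. ?R n e)" for e by (rule Cauchy_convergent)
  define g where "g e = lim (\<lambda>n. ?R n e)" for e
  have g: "(\<lambda>n. ?R n e) \<longlonglongrightarrow> g e" for e
    using lim[of e] unfolding g_def by (simp only: convergent_LIMSEQ_iff)
  have g0: "g e = 0" if "e \<notin> onb" for e
  proof -
    have "(\<lambda>n. ?R n e) = (\<lambda>n. 0)" using that Rep_htensor by (auto simp: fun_eq_iff)
    then show ?thesis unfolding g_def by simp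
  qed
  have bound: "(\<Sum>e\<in>F. (norm (?R n e - g e))\<^sup>2) \<le> d\<^sup>2"
    if "finite F" "F \<subseteq> onb" and N: "\<And>m. N \<le> m \<Longrightarrow> dist (X n) (X m) \<le> d" for F n N d
  proof (rule LIMSEQ_le_const2)
    show "(\<lambda>m. \<Sum>e\<in>F. (norm (?R n e - ?R m e))\<^sup>2) \<longlonglongrightarrow> (\<Sum>e\<in>F. (norm (?R n e - g e))\<^sup>2)"
      by (intro tendsto_intros g)
    have "(\<Sum>e\<in>F. (norm (?R n e - ?R m e))\<^sup>2) \<le> d\<^sup>2" if "N \<le> m" for m
    proof -
      have "(\<Sum>e\<in>F. (norm (?R n e - ?R m e))\<^sup>2) \<le> (norm (X n - X m))\<^sup>2"
        using htensor_finite_sum_le[OF \<open>finite F\<close> \<open>F \<subseteq> onb\<close>, of "X n - X m"] by (simp add: minus_htensor.rep_eq)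
      also have "\<dots> \<le> d\<^sup>2" using N[OF that] by (intro power_mono) (simp_all add: dist_norm)
      finally show ?thesis .
    qed
    then show "\<exists>N. \<forall>m\<ge>N. (\<Sum>e\<in>F. (norm (?R n e - ?R m e))\<^sup>2) \<le> d\<^sup>2" by blast
  qed
  have summ: "(\<lambda>e. (norm (?R n e - g e))\<^sup>2) summable_on onb"
    if "\<And>m. N \<le> m \<Longrightarrow> dist (X n) (X m) \<le> d" for n N d
    by (rule nonneg_bdd_above_summable_on) (auto simp: bdd_above_def intro!: exI[of _ "d\<^sup>2"] bound that)
  obtain N1 where N1: "\<And>m n. N1 \<le> m \<Longrightarrow> N1 \<le> n \<Longrightarrow> dist (X m) (X n) < 1"
    using metric_CauchyD[OF X, of 1] by auto
  have "(\<lambda>e. (norm (?R N1 e + - (?R N1 e - g e)))\<^sup>2) summable_on onb"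
    by (intro sq_summable_add htensor_summable)
       (use summ[of N1 N1 1] N1 in \<open>force simp: norm_minus_commute\<close>)
  then have "(\<lambda>e. (norm (g e))\<^sup>2) summable_on onb" by simp
  then obtain G where G: "Rep_htensor G = g"
    using g0 Abs_htensor_inverse[of g] by auto
  have "X \<longlonglongrightarrow> G"
  proof (rule metric_LIMSEQ_I)
    fix d :: real assume d: "0 < d"
    then obtain N where N: "\<And>m n. N \<le> m \<Longrightarrow> N \<le> n \<Longrightarrow> dist (X m) (X n) < d/2"
      using metric_CauchyD[OF X, of "d/2"] by auto
    have "dist (X n) G < d" if "N \<le> n" for n
    proof -
      have le: "dist (X n) (X m) \<le> d/2" if "N \<le> m" for m using N[OF \<open>N \<le> n\<close> that] by simp
      have "(norm (X n - G))\<^sup>2 \<le> (d/2)\<^sup>2"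
        unfolding htensor_norm_sq
        by (rule infsum_le_finite_sums[OF htensor_summable])
           (simp add: minus_htensor.rep_eq G, rule bound[OF _ _ le, simplified], auto)
      then have "norm (X n - G) \<le> d/2" using d by (meson half_gt_zero less_eq_real_def power2_le_imp_le)
      then show ?thesis using d by (simp add: dist_norm)
    qed
    then show "\<exists>N. \<forall>n\<ge>N. dist (X n) G < d" by blast
  qed
  then show "convergent X" by (rule convergentI)
qed

instantiation htensor :: (chilbert, chilbert) chilbert
begin

lift_definition scaleC_htensor :: "complex \<Rightarrow> ('a, 'b) htensor \<Rightarrow> ('a, 'b) htensor"
  is "\<lambda>c f e. c *\<^sub>C f e"
  by (simp add: norm_scaleC power_mult_distrib summable_on_cmult_right linear_0[OF linear_scaleC])

lift_definition cinner_htensor :: "('a, 'b) htensor \<Rightarrow> ('a, 'b) htensor \<Rightarrow> complex"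
  is "\<lambda>f g. \<Sum>\<^sub>\<infinity>e\<in>onb. cinner (f e) (g e)" .

instance
proof
  fix x y z :: "('a, 'b) htensor" and c d :: complex and r :: real
  show "c *\<^sub>C (x + y) = c *\<^sub>C x + c *\<^sub>C y" "(c + d) *\<^sub>C x = c *\<^sub>C x + d *\<^sub>C x"
    "c *\<^sub>C d *\<^sub>C x = (c * d) *\<^sub>C x" "complex_of_real r *\<^sub>C x = r *\<^sub>R x"
    by (transfer; simp add: scaleC_add_right scaleC_add_left scaleC_scaleC scaleC_of_real)+
  show "cinner x y = cnj (cinner y x)"
    by transfer (simp add: infsum_cnj[symmetric] cinner_commute[symmetric])
  show "cinner (x + y) z = cinner x z + cinner y z"
    by transfer (simp add: cinner_add_left infsum_add sq_summable_cinner)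
  show "cinner (c *\<^sub>C x) y = c * cinner x y"
    by transfer (simp add: cinner_scaleC_left infsum_cmult_right')
  show "Re (cinner x y) = inner x y"
    by transfer (simp add: infsum_Re[symmetric] sq_summable_cinner Re_cinner)
qed

end

lift_definition tens :: "'a::chilbert \<Rightarrow> 'b::chilbert \<Rightarrow> ('a, 'b) htensor" (infixr "\<otimes>\<^sub>h" 70)
  is "\<lambda>x y e. if e \<in> onb then cinner y e *\<^sub>C x else 0"
  subgoal for x y
    using summable_on_cmult_left[OF summable_onb_cinner[of y], of "(norm x)\<^sup>2"]
    by (simp add: norm_scaleC power_mult_distrib cong: summable_on_cong)
  done

lemma cinner_tens: "cinner (x \<otimes>\<^sub>h y) (x' \<otimes>\<^sub>h y') = cinner x x' * cinner y y'"
proof -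
  have "((\<lambda>e. cinner x x' * (cinner y e * cinner e y')) has_sum cinner x x' * cinner y y') onb"
    by (rule has_sum_cmult_right[OF parseval])
  then have "((\<lambda>e. cinner (if e \<in> onb then cinner y e *\<^sub>C x else 0) (if e \<in> onb then cinner y' e *\<^sub>C x' else 0))
       has_sum cinner x x' * cinner y y') onb"
    by (rule has_sum_cong[THEN iffD1, rotated])
       (simp add: cinner_scaleC_left cinner_scaleC_right cinner_commute[of _ y'] mult_ac)
  then show ?thesis by transfer (rule infsumI)
qed

lemma tens_add_left: "(x + x') \<otimes>\<^sub>h y = x \<otimes>\<^sub>h y + x' \<otimes>\<^sub>h y"
  by transfer (auto simp: scaleC_add_right)

lemma tens_add_right: "x \<otimes>\<^sub>h (y + y') = x \<otimes>\<^sub>h y + x \<otimes>\<^sub>h y'"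
  by transfer (auto simp: scaleC_add_left cinner_add_left)

lemma tens_scaleC_left: "(c *\<^sub>C x) \<otimes>\<^sub>h y = c *\<^sub>C (x \<otimes>\<^sub>h y)"
  by transfer (auto simp: scaleC_scaleC mult.commute linear_0[OF linear_scaleC])

lemma tens_scaleC_right: "x \<otimes>\<^sub>h (c *\<^sub>C y) = c *\<^sub>C (x \<otimes>\<^sub>h y)"
  by transfer (auto simp: scaleC_scaleC cinner_scaleC_left linear_0[OF linear_scaleC])

lemma tens_total: "closure (cspan {x \<otimes>\<^sub>h y |x y. True}) = UNIV"
proof -
  have "v \<in> closure (cspan {x \<otimes>\<^sub>h y |x y. True})" for v :: "('a, 'b) htensor"
  proof (rule closure_approachable[THEN iffD2], intro allI impI)
    fix d :: real assume d: "0 < d"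
    let ?g = "\<lambda>e. (norm (Rep_htensor v e))\<^sup>2"
    obtain F where F: "finite F" "F \<subseteq> onb" "dist (sum ?g F) (infsum ?g onb) \<le> d\<^sup>2 / 2"
      using infsum_finite_approximation[OF htensor_summable[of v], of "d\<^sup>2/2"] d by auto
    define t where "t e = Rep_htensor v e \<otimes>\<^sub>h e" for e
    define w where "w = (\<Sum>e\<in>F. t e)"
    have Rt: "Rep_htensor (t e) f = (if f = e then Rep_htensor v e else 0)" if "e \<in> onb" for e f
      using that Rep_htensor[of v] by (auto simp: t_def tens.rep_eq onb_cinner scaleC_one scaleC_zero)
    have Rsum: "Rep_htensor (sum h G) f = (\<Sum>e\<in>G. Rep_htensor (h e) f)" if "finite G"
      for h :: "'b \<Rightarrow> ('a, 'b) htensor" and G f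
      using that by induction (simp_all add: zero_htensor.rep_eq plus_htensor.rep_eq)
    have Rw: "Rep_htensor w f = (if f \<in> F then Rep_htensor v f else 0)" for f
    proof -
      have "Rep_htensor w f = (\<Sum>e\<in>F. if f = e then Rep_htensor v e else 0)"
        unfolding w_def using F by (subst Rsum) (auto intro!: sum.cong simp: Rt subset_iff)
      then show ?thesis using F by simp
    qed
    have "(norm (w - v))\<^sup>2 \<le> d\<^sup>2 / 2"
      unfolding htensor_norm_sq
    proof (rule infsum_le_finite_sums[OF htensor_summable])
      fix G :: "'b set" assume G: "finite G" "G \<subseteq> onb"
      have "(\<Sum>e\<in>G. (norm (Rep_htensor (w - v) e))\<^sup>2) = sum ?g (G - F)"
        using G by (intro sum.mono_neutral_cong_right) (auto simp: minus_htensor.rep_eq Rw)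
      also have "\<dots> = sum ?g (G \<union> F) - sum ?g F"
        using F G by (simp add: sum.union_diff2[symmetric] Un_commute sum_diff[symmetric] Un_Diff)
      also have "\<dots> \<le> infsum ?g onb - sum ?g F"
        using F G finite_sum_le_infsum[OF htensor_summable[of v], of "G \<union> F"] by auto
      also have "\<dots> \<le> d\<^sup>2 / 2" using F(3)[unfolded dist_real_def] by (smt (verit))
      finally show "(\<Sum>e\<in>G. (norm (Rep_htensor (w - v) e))\<^sup>2) \<le> d\<^sup>2 / 2" .
    qed
    also have "\<dots> < d\<^sup>2" using d by simp
    finally have "dist w v < d"
      using d by (simp add: dist_norm power_less_imp_less_base)
    moreover have "w \<in> cspan {x \<otimes>\<^sub>h y |x y. True}"
    proof -
      have inj: "inj_on t {e\<in>F. t e \<noteq> 0}"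
      proof (rule inj_onI)
        fix e f assume ef: "e \<in> {e\<in>F. t e \<noteq> 0}" "f \<in> {e\<in>F. t e \<noteq> 0}" "t e = t f"
        show "e = f"
        proof (rule ccontr)
          assume "e \<noteq> f"
          then have "Rep_htensor (t e) g = 0" for g
            using ef F(2) Rt[of e g] Rt[of f g] \<open>e \<noteq> f\<close> by (cases "g = e") (auto simp: subset_iff)
          then have "t e = 0" by (metis Rep_htensor_inject zero_htensor.rep_eq ext)
          then show False using ef by simp
        qed
      qed
      have "w = (\<Sum>e\<in>{e\<in>F. t e \<noteq> 0}. t e)"
        unfolding w_def using F by (intro sum.mono_neutral_right) auto
      also have "\<dots> = (\<Sum>v\<in>t ` {e\<in>F. t e \<noteq> 0}. 1 *\<^sub>C v)"
        by (simp add: sum.reindex[OF inj] scaleC_one)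
      finally show ?thesis
        unfolding cspan_def using F(1) by (fastforce simp: t_def intro!: exI[of _ "t ` {e\<in>F. t e \<noteq> 0}"] exI[of _ "\<lambda>_. 1"])
    qed
    ultimately show "\<exists>y\<in>cspan {x \<otimes>\<^sub>h y |x y. True}. dist y v < d" by blast
  qed
  then show ?thesis by auto
qed


section \<open>Bounded operators\<close>

type_synonym 'a oper = "'a \<Rightarrow>\<^sub>L 'a"

text \<open>The library type \<^typ>\<open>'a oper\<close> only demands real linearity.\<close>

definition bounded_ops :: "'a::chilbert oper set" where
  "bounded_ops = {T :: 'a oper. \<forall>c x. T (c *\<^sub>C x) = c *\<^sub>C T x}"

definition scale_op :: "complex \<Rightarrow> 'a::chilbert oper \<Rightarrow> 'a oper" where
  "scale_op c T = Blinfun (\<lambda>x. c *\<^sub>C T x)"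

definition adj :: "'a::chilbert oper \<Rightarrow> 'a oper" where
  "adj T = (THE S. S \<in> bounded_ops \<and> (\<forall>x y. cinner (T x) y = cinner x (S y)))"

definition unitary_op :: "'a::chilbert oper \<Rightarrow> bool" where
  "unitary_op U \<longleftrightarrow> U \<in> bounded_ops \<and> adj U o\<^sub>L U = id_blinfun \<and> U o\<^sub>L adj U = id_blinfun"

definition positive_op :: "'a::chilbert oper \<Rightarrow> bool" where
  "positive_op T \<longleftrightarrow> T \<in> bounded_ops \<and> (\<forall>x. cinner (T x) x \<in> \<real> \<and> 0 \<le> Re (cinner (T x) x))"

definition op_le :: "'a::chilbert oper \<Rightarrow> 'a oper \<Rightarrow> bool" (infix "\<preceq>" 50) where
  "S \<preceq> T \<longleftrightarrow> positive_op (T - S)"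

definition op_tens :: "'a::chilbert oper \<Rightarrow> 'b::chilbert oper \<Rightarrow> ('a, 'b) htensor oper" (infixr "\<otimes>\<^sub>o" 70)
  where "S \<otimes>\<^sub>o T = (THE R. R \<in> bounded_ops \<and> (\<forall>x y. R (x \<otimes>\<^sub>h y) = S x \<otimes>\<^sub>h T y))"


section \<open>C*-algebras and von Neumann algebras of operators\<close>

definition cstar_algebra :: "'a::chilbert oper set \<Rightarrow> bool" where
  "cstar_algebra A \<longleftrightarrow> A \<subseteq> bounded_ops \<and> 0 \<in> A \<and> (\<forall>x\<in>A. \<forall>y\<in>A. x + y \<in> A) \<and> (\<forall>c. \<forall>x\<in>A. scale_op c x \<in> A)
     \<and> (\<forall>x\<in>A. \<forall>y\<in>A. x o\<^sub>L y \<in> A) \<and> (\<forall>x\<in>A. adj x \<in> A) \<and> closed A"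

definition cstar_generated :: "'a::chilbert oper set \<Rightarrow> 'a oper set" where
  "cstar_generated S = \<Inter>{A. cstar_algebra A \<and> S \<subseteq> A}"

definition commutant :: "'a::chilbert oper set \<Rightarrow> 'a oper set" where
  "commutant S = {y \<in> bounded_ops. \<forall>x\<in>S. x o\<^sub>L y = y o\<^sub>L x}"

text \<open>A commutant is automatically a unital algebra.\<close>

definition von_neumann_algebra :: "'a::chilbert oper set \<Rightarrow> bool" where
  "von_neumann_algebra M \<longleftrightarrow> M \<subseteq> bounded_ops \<and> (\<forall>x\<in>M. adj x \<in> M) \<and> commutant (commutant M) = M"

definition vn_generated :: "'a::chilbert oper set \<Rightarrow> 'a oper set" where
  "vn_generated S = \<Inter>{M. von_neumann_algebra M \<and> S \<subseteq> M}"

definition vn_tensor :: "'a::chilbert oper set \<Rightarrow> 'b::chilbert oper set \<Rightarrow> ('a, 'b) htensor oper set"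
    (infixr "\<otimes>\<^sub>v" 70) where
  "M \<otimes>\<^sub>v N = vn_generated {x \<otimes>\<^sub>o y |x y. x \<in> M \<and> y \<in> N}"

definition pos_part :: "'a::chilbert oper set \<Rightarrow> 'a oper set" where
  "pos_part M = {x \<in> M. positive_op x}"


section \<open>Functionals and homomorphisms\<close>

text \<open>
  Functionals on an operator algebra \<open>M\<close>, and maps between operator algebras, are total functions of which only
  the values on \<open>M\<close> matter.
\<close>

definition bounded_functional :: "'a::chilbert oper set \<Rightarrow> ('a oper \<Rightarrow> complex) \<Rightarrow> bool" where
  "bounded_functional M f \<longleftrightarrow> (\<forall>x\<in>M. \<forall>y\<in>M. f (x + y) = f x + f y) \<and> (\<forall>c. \<forall>x\<in>M. f (scale_op c x) = c * f x)
     \<and> (\<exists>K. \<forall>x\<in>M. cmod (f x) \<le> K * norm x)"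

definition positive_functional :: "'a::chilbert oper set \<Rightarrow> ('a oper \<Rightarrow> complex) \<Rightarrow> bool" where
  "positive_functional M f \<longleftrightarrow> bounded_functional M f \<and> (\<forall>x\<in>pos_part M. f x \<in> \<real> \<and> 0 \<le> Re (f x))"

definition state :: "'a::chilbert oper set \<Rightarrow> ('a oper \<Rightarrow> complex) \<Rightarrow> bool" where
  "state M f \<longleftrightarrow> positive_functional M f \<and> f id_blinfun = 1"

text \<open>The predual of \<open>M\<close> is the space of its normal, i.e. ultraweakly continuous, functionals.\<close>

definition normal_functional :: "'a::chilbert oper set \<Rightarrow> ('a oper \<Rightarrow> complex) \<Rightarrow> bool" where
  "normal_functional M f \<longleftrightarrow> (\<exists>\<xi> \<eta> :: nat \<Rightarrow> 'a. summable (\<lambda>n. (norm (\<xi> n))\<^sup>2) \<and> summable (\<lambda>n. (norm (\<eta> n))\<^sup>2)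
     \<and> (\<forall>x\<in>M. f x = (\<Sum>n. cinner (x (\<xi> n)) (\<eta> n))))"

definition star_hom :: "'a::chilbert oper set \<Rightarrow> 'b::chilbert oper set \<Rightarrow> ('a oper \<Rightarrow> 'b oper) \<Rightarrow> bool" where
  "star_hom M N \<alpha> \<longleftrightarrow> \<alpha> ` M \<subseteq> N \<and> (\<forall>x\<in>M. \<forall>y\<in>M. \<alpha> (x + y) = \<alpha> x + \<alpha> y)
     \<and> (\<forall>c. \<forall>x\<in>M. \<alpha> (scale_op c x) = scale_op c (\<alpha> x))
     \<and> (\<forall>x\<in>M. \<forall>y\<in>M. \<alpha> (x o\<^sub>L y) = \<alpha> x o\<^sub>L \<alpha> y) \<and> (\<forall>x\<in>M. \<alpha> (adj x) = adj (\<alpha> x))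
     \<and> \<alpha> id_blinfun = id_blinfun"

definition normal_star_hom :: "'a::chilbert oper set \<Rightarrow> 'b::chilbert oper set \<Rightarrow> ('a oper \<Rightarrow> 'b oper) \<Rightarrow> bool" where
  "normal_star_hom M N \<alpha> \<longleftrightarrow> star_hom M N \<alpha> \<and> (\<forall>f. normal_functional N f \<longrightarrow> normal_functional M (f \<circ> \<alpha>))"

definition normal_star_aut :: "'a::chilbert oper set \<Rightarrow> ('a oper \<Rightarrow> 'a oper) \<Rightarrow> bool" where
  "normal_star_aut M \<alpha> \<longleftrightarrow> normal_star_hom M M \<alpha> \<and> bij_betw \<alpha> M M"

text \<open>The normal extension of \<open>x \<otimes> y \<mapsto> \<alpha> x \<otimes> \<beta> y\<close>; on \<open>M \<otimes>\<^sub>v N\<close> it is unique.\<close>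

definition hom_tens :: "'a::chilbert oper set \<Rightarrow> 'b::chilbert oper set \<Rightarrow> 'c::chilbert oper set \<Rightarrow> 'd::chilbert oper set \<Rightarrow>
    ('a oper \<Rightarrow> 'c oper) \<Rightarrow> ('b oper \<Rightarrow> 'd oper) \<Rightarrow> ('a, 'b) htensor oper \<Rightarrow> ('c, 'd) htensor oper" where
  "hom_tens M N P Q \<alpha> \<beta> = (SOME \<theta>. normal_star_hom (M \<otimes>\<^sub>v N) (P \<otimes>\<^sub>v Q) \<theta>
     \<and> (\<forall>x\<in>M. \<forall>y\<in>N. \<theta> (x \<otimes>\<^sub>o y) = \<alpha> x \<otimes>\<^sub>o \<beta> y))"

text \<open>
  Slice maps.  First \<open>(id \<otimes> \<omega>\<^sub>k\<^sub>,\<^sub>l)(T)\<close> and \<open>(\<omega>\<^sub>h\<^sub>,\<^sub>h\<^sub>' \<otimes> id)(T)\<close> for the vector functionals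
  \<open>\<omega>\<^sub>k\<^sub>,\<^sub>l = \<langle>\<cdot> k, l\<rangle>\<close>.  For a normal functional \<open>f\<close> on \<open>M\<close> and \<open>T \<in> M \<otimes>\<^sub>v N\<close>, the operator \<open>(f \<otimes> id)(T)\<close>
  is then determined by \<open>\<nu>((f \<otimes> id)(T)) = (f \<otimes> \<nu>)(T) = f((id \<otimes> \<nu>)(T))\<close>, read off at the vector functionals \<open>\<nu>\<close>;
  symmetrically for \<open>(id \<otimes> f)(T)\<close>.
\<close>

definition vec_slice_right :: "'b \<Rightarrow> 'b \<Rightarrow> ('a::chilbert, 'b::chilbert) htensor oper \<Rightarrow> 'a oper" where
  "vec_slice_right k l T = (THE S. S \<in> bounded_ops \<and> (\<forall>h h'. cinner (S h) h' = cinner (T (h \<otimes>\<^sub>h k)) (h' \<otimes>\<^sub>h l)))"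

definition vec_slice_left :: "'a \<Rightarrow> 'a \<Rightarrow> ('a::chilbert, 'b::chilbert) htensor oper \<Rightarrow> 'b oper" where
  "vec_slice_left h h' T = (THE S. S \<in> bounded_ops \<and> (\<forall>k l. cinner (S k) l = cinner (T (h \<otimes>\<^sub>h k)) (h' \<otimes>\<^sub>h l)))"

definition slice_left :: "('a oper \<Rightarrow> complex) \<Rightarrow> ('a::chilbert, 'b::chilbert) htensor oper \<Rightarrow> 'b oper" where
  "slice_left f T = (THE S. S \<in> bounded_ops \<and> (\<forall>k l. cinner (S k) l = f (vec_slice_right k l T)))"

definition slice_right :: "('b oper \<Rightarrow> complex) \<Rightarrow> ('a::chilbert, 'b::chilbert) htensor oper \<Rightarrow> 'a oper" where
  "slice_right f T = (THE S. S \<in> bounded_ops \<and> (\<forall>h h'. cinner (S h) h' = f (vec_slice_left h h' T)))"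


section \<open>Weights\<close>

text \<open>A weight on \<open>M\<close> is a function of which only the values on \<^term>\<open>pos_part M\<close> matter.\<close>

definition weight :: "'a::chilbert oper set \<Rightarrow> ('a oper \<Rightarrow> ennreal) \<Rightarrow> bool" where
  "weight M \<phi> \<longleftrightarrow> (\<forall>x\<in>pos_part M. \<forall>y\<in>pos_part M. \<phi> (x + y) = \<phi> x + \<phi> y)
     \<and> (\<forall>r\<ge>0. \<forall>x\<in>pos_part M. \<phi> (r *\<^sub>R x) = ennreal r * \<phi> x)"

definition normal_weight :: "'a::chilbert oper set \<Rightarrow> ('a oper \<Rightarrow> ennreal) \<Rightarrow> bool" where
  "normal_weight M \<phi> \<longleftrightarrow> (\<forall>D\<subseteq>pos_part M. \<forall>s\<in>pos_part M.
     D \<noteq> {} \<and> (\<forall>x\<in>D. \<forall>y\<in>D. \<exists>z\<in>D. x \<preceq> z \<and> y \<preceq> z)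
       \<and> (\<forall>x\<in>D. x \<preceq> s) \<and> (\<forall>t\<in>pos_part M. (\<forall>x\<in>D. x \<preceq> t) \<longrightarrow> s \<preceq> t)
     \<longrightarrow> \<phi> s = (SUP x\<in>D. \<phi> x))"

definition faithful_weight :: "'a::chilbert oper set \<Rightarrow> ('a oper \<Rightarrow> ennreal) \<Rightarrow> bool" where
  "faithful_weight M \<phi> \<longleftrightarrow> (\<forall>x\<in>pos_part M. \<phi> x = 0 \<longrightarrow> x = 0)"

text \<open>The finite cone \<open>\<pp>\<^sub>\<phi>\<close> and the left ideal \<open>\<nn>\<^sub>\<phi>\<close>.\<close>

definition weight_cone :: "'a::chilbert oper set \<Rightarrow> ('a oper \<Rightarrow> ennreal) \<Rightarrow> 'a oper set" where
  "weight_cone M \<phi> = {x \<in> pos_part M. \<phi> x < \<infinity>}"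

definition weight_ideal :: "'a::chilbert oper set \<Rightarrow> ('a oper \<Rightarrow> ennreal) \<Rightarrow> 'a oper set" where
  "weight_ideal M \<phi> = {x \<in> M. \<phi> (adj x o\<^sub>L x) < \<infinity>}"

text \<open>Semifiniteness: the linear span of the finite cone is ultraweakly dense.\<close>

definition semifinite_weight :: "'a::chilbert oper set \<Rightarrow> ('a oper \<Rightarrow> ennreal) \<Rightarrow> bool" where
  "semifinite_weight M \<phi> \<longleftrightarrow> (\<forall>x\<in>M. \<forall>\<Omega> \<epsilon>. finite \<Omega> \<and> (\<forall>f\<in>\<Omega>. normal_functional M f) \<and> 0 < \<epsilon> \<longrightarrow>
     (\<exists>a\<in>weight_cone M \<phi>. \<exists>b\<in>weight_cone M \<phi>. \<exists>c\<in>weight_cone M \<phi>. \<exists>d\<in>weight_cone M \<phi>.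
        \<forall>f\<in>\<Omega>. cmod (f (x - (a - b + scale_op \<i> (c - d)))) < \<epsilon>))"

definition nsf_weight :: "'a::chilbert oper set \<Rightarrow> ('a oper \<Rightarrow> ennreal) \<Rightarrow> bool" where
  "nsf_weight M \<phi> \<longleftrightarrow> weight M \<phi> \<and> normal_weight M \<phi> \<and> semifinite_weight M \<phi> \<and> faithful_weight M \<phi>"

text \<open>The linear extension of a weight to the span of its finite cone.\<close>

definition weight_ext :: "'a::chilbert oper set \<Rightarrow> ('a oper \<Rightarrow> ennreal) \<Rightarrow> 'a oper \<Rightarrow> complex" where
  "weight_ext M \<phi> z = (THE v. \<exists>a\<in>weight_cone M \<phi>. \<exists>b\<in>weight_cone M \<phi>. \<exists>c\<in>weight_cone M \<phi>. \<exists>d\<in>weight_cone M \<phi>.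
     z = a - b + scale_op \<i> (c - d)
     \<and> v = Complex (enn2real (\<phi> a) - enn2real (\<phi> b)) (enn2real (\<phi> c) - enn2real (\<phi> d)))"

text \<open>
  \<open>\<Lambda>\<close> exhibits the Hilbert space \<open>'k\<close> as the completion of \<open>\<nn>\<^sub>\<phi>\<close> for the inner product \<open>\<phi>(y\<^sup>* x)\<close>; such a completion
  is unique up to a unitary compatible with \<open>\<Lambda>\<close>.
\<close>

definition gns_space :: "'h::chilbert oper set \<Rightarrow> ('h oper \<Rightarrow> ennreal) \<Rightarrow> ('h oper \<Rightarrow> 'k::chilbert) \<Rightarrow> bool" where
  "gns_space M \<phi> \<Lambda> \<longleftrightarrow>
     (\<forall>x\<in>weight_ideal M \<phi>. \<forall>y\<in>weight_ideal M \<phi>. \<Lambda> (x + y) = \<Lambda> x + \<Lambda> y)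
     \<and> (\<forall>c. \<forall>x\<in>weight_ideal M \<phi>. \<Lambda> (scale_op c x) = c *\<^sub>C \<Lambda> x)
     \<and> (\<forall>x\<in>weight_ideal M \<phi>. \<forall>y\<in>weight_ideal M \<phi>. cinner (\<Lambda> x) (\<Lambda> y) = weight_ext M \<phi> (adj y o\<^sub>L x))
     \<and> closure (\<Lambda> ` weight_ideal M \<phi>) = UNIV"

definition gns_rep :: "'h::chilbert oper set \<Rightarrow> ('h oper \<Rightarrow> ennreal) \<Rightarrow> ('h oper \<Rightarrow> 'k::chilbert) \<Rightarrow> 'h oper \<Rightarrow> 'k oper" where
  "gns_rep M \<phi> \<Lambda> a = (THE T. T \<in> bounded_ops \<and> (\<forall>b\<in>weight_ideal M \<phi>. T (\<Lambda> b) = \<Lambda> (a o\<^sub>L b)))"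

text \<open>
  The GNS map \<open>\<Lambda> \<otimes> \<Lambda>\<close> of the weight \<open>\<phi> \<otimes> \<phi>\<close>, as a relation: the closure of the graph of the algebraic tensor
  product \<open>\<Lambda> \<odot> \<Lambda>\<close> for the \<open>\<sigma>\<close>-strong* topology on \<open>M \<otimes>\<^sub>v M\<close> and the norm topology on the Hilbert space.  The
  \<open>\<sigma>\<close>-strong* topology is given by the seminorms \<open>f(x\<^sup>* x)\<^sup>1\<^sup>/\<^sup>2\<close> and \<open>f(x x\<^sup>*)\<^sup>1\<^sup>/\<^sup>2\<close> for normal positive \<open>f\<close>; a single \<open>f\<close> suffices
  in a basic neighbourhood because such functionals can be added.
\<close>

definition gns_tensor_graph :: "'h::chilbert oper set \<Rightarrow> ('h oper \<Rightarrow> ennreal) \<Rightarrow> ('h oper \<Rightarrow> 'k::chilbert) \<Rightarrow>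
    (('h, 'h) htensor oper \<times> ('k, 'k) htensor) set" where
  "gns_tensor_graph M \<phi> \<Lambda> = {(\<Sum>i<n. x i \<otimes>\<^sub>o y i, \<Sum>i<n. \<Lambda> (x i) \<otimes>\<^sub>h \<Lambda> (y i)) |(n::nat) x y.
     \<forall>i<n. x i \<in> weight_ideal M \<phi> \<and> y i \<in> weight_ideal M \<phi>}"

definition gns_tensor :: "'h::chilbert oper set \<Rightarrow> ('h oper \<Rightarrow> ennreal) \<Rightarrow> ('h oper \<Rightarrow> 'k::chilbert) \<Rightarrow>
    ('h, 'h) htensor oper \<Rightarrow> ('k, 'k) htensor \<Rightarrow> bool" where
  "gns_tensor M \<phi> \<Lambda> X v \<longleftrightarrow> X \<in> M \<otimes>\<^sub>v M \<and>
     (\<forall>f \<epsilon>. normal_functional (M \<otimes>\<^sub>v M) f \<and> positive_functional (M \<otimes>\<^sub>v M) f \<and> 0 < \<epsilon> \<longrightarrow>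
       (\<exists>(Y, w)\<in>gns_tensor_graph M \<phi> \<Lambda>. cmod (f (adj (X - Y) o\<^sub>L (X - Y))) < \<epsilon>
          \<and> cmod (f ((X - Y) o\<^sub>L adj (X - Y))) < \<epsilon> \<and> norm (v - w) < \<epsilon>))"


section \<open>Locally compact quantum groups\<close>

text \<open>Coassociativity is tested on elementary tensors, identifying \<open>(a \<otimes> b) \<otimes> c\<close> with \<open>a \<otimes> (b \<otimes> c)\<close>.\<close>

definition hopf_von_neumann_algebra :: "'h::chilbert oper set \<Rightarrow> ('h oper \<Rightarrow> ('h, 'h) htensor oper) \<Rightarrow> bool" where
  "hopf_von_neumann_algebra M \<Delta> \<longleftrightarrow> von_neumann_algebra M \<and> normal_star_hom M (M \<otimes>\<^sub>v M) \<Delta> \<and> inj_on \<Delta> M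
     \<and> (\<forall>x\<in>M. \<forall>a b c a' b' c'.
          cinner (hom_tens M M (M \<otimes>\<^sub>v M) M \<Delta> (\<lambda>y. y) (\<Delta> x) ((a \<otimes>\<^sub>h b) \<otimes>\<^sub>h c)) ((a' \<otimes>\<^sub>h b') \<otimes>\<^sub>h c')
          = cinner (hom_tens M M M (M \<otimes>\<^sub>v M) (\<lambda>y. y) \<Delta> (\<Delta> x) (a \<otimes>\<^sub>h (b \<otimes>\<^sub>h c))) (a' \<otimes>\<^sub>h (b' \<otimes>\<^sub>h c')))"

definition locally_compact_quantum_group :: "'h::chilbert oper set \<Rightarrow> ('h oper \<Rightarrow> ('h, 'h) htensor oper) \<Rightarrow>
    ('h oper \<Rightarrow> ennreal) \<Rightarrow> ('h oper \<Rightarrow> ennreal) \<Rightarrow> bool" where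
  "locally_compact_quantum_group M \<Delta> \<phi> \<psi> \<longleftrightarrow> hopf_von_neumann_algebra M \<Delta> \<and> nsf_weight M \<phi> \<and> nsf_weight M \<psi>
     \<and> (\<forall>f. normal_functional M f \<and> positive_functional M f \<longrightarrow> (\<forall>x\<in>pos_part M.
          \<phi> (slice_left f (\<Delta> x)) = ennreal (Re (f id_blinfun)) * \<phi> x
          \<and> \<psi> (slice_right f (\<Delta> x)) = ennreal (Re (f id_blinfun)) * \<psi> x))"

text \<open>The module actions \<open>F \<cdot> \<omega>\<close> and \<open>\<omega> \<cdot> F\<close> of the predual.\<close>

definition act_right :: "('h oper \<Rightarrow> ('h, 'h) htensor oper) \<Rightarrow> 'h oper \<Rightarrow> ('h oper \<Rightarrow> complex) \<Rightarrow> 'h::chilbert oper" where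
  "act_right \<Delta> F \<omega> = slice_left \<omega> (\<Delta> F)"

definition act_left :: "('h oper \<Rightarrow> ('h, 'h) htensor oper) \<Rightarrow> ('h oper \<Rightarrow> complex) \<Rightarrow> 'h oper \<Rightarrow> 'h::chilbert oper" where
  "act_left \<Delta> \<omega> F = slice_right \<omega> (\<Delta> F)"

definition mult_unitary :: "'h::chilbert oper set \<Rightarrow> ('h oper \<Rightarrow> ('h, 'h) htensor oper) \<Rightarrow> ('h oper \<Rightarrow> ennreal) \<Rightarrow>
    ('h oper \<Rightarrow> 'k::chilbert) \<Rightarrow> ('k, 'k) htensor oper" where
  "mult_unitary M \<Delta> \<phi> \<Lambda> = (THE W. unitary_op W \<and> W \<in> (gns_rep M \<phi> \<Lambda> ` M) \<otimes>\<^sub>v bounded_ops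
     \<and> (\<forall>x\<in>weight_ideal M \<phi>. \<forall>y\<in>weight_ideal M \<phi>.
          gns_tensor M \<phi> \<Lambda> (\<Delta> y o\<^sub>L (x \<otimes>\<^sub>o id_blinfun)) (adj W (\<Lambda> x \<otimes>\<^sub>h \<Lambda> y))))"

text \<open>A functional on \<open>M\<close> is transported to \<open>\<pi>\<^sub>\<phi>(M)\<close> along the faithful representation \<open>\<pi>\<^sub>\<phi>\<close> before slicing \<open>W\<close>.\<close>

definition left_regular :: "'h::chilbert oper set \<Rightarrow> ('h oper \<Rightarrow> ('h, 'h) htensor oper) \<Rightarrow> ('h oper \<Rightarrow> ennreal) \<Rightarrow>
    ('h oper \<Rightarrow> 'k::chilbert) \<Rightarrow> ('h oper \<Rightarrow> complex) \<Rightarrow> 'k oper" where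
  "left_regular M \<Delta> \<phi> \<Lambda> \<omega> = slice_left (\<omega> \<circ> inv_into M (gns_rep M \<phi> \<Lambda>)) (mult_unitary M \<Delta> \<phi> \<Lambda>)"

definition reduced_cstar :: "'h::chilbert oper set \<Rightarrow> ('h oper \<Rightarrow> ('h, 'h) htensor oper) \<Rightarrow> ('h oper \<Rightarrow> ennreal) \<Rightarrow>
    ('h oper \<Rightarrow> 'k::chilbert) \<Rightarrow> 'k oper set" where
  "reduced_cstar M \<Delta> \<phi> \<Lambda> = cstar_generated (left_regular M \<Delta> \<phi> \<Lambda> ` {\<omega>. normal_functional M \<omega>})"

definition group_vn :: "'h::chilbert oper set \<Rightarrow> ('h oper \<Rightarrow> ('h, 'h) htensor oper) \<Rightarrow> ('h oper \<Rightarrow> ennreal) \<Rightarrow>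
    ('h oper \<Rightarrow> 'k::chilbert) \<Rightarrow> 'k oper set" where
  "group_vn M \<Delta> \<phi> \<Lambda> = vn_generated (left_regular M \<Delta> \<phi> \<Lambda> ` {\<omega>. normal_functional M \<omega>})"

definition regular_family :: "'h::chilbert oper set \<Rightarrow> ('h oper \<Rightarrow> ('h, 'h) htensor oper) \<Rightarrow> ('h oper \<Rightarrow> ennreal) \<Rightarrow>
    ('h oper \<Rightarrow> 'k::chilbert) \<Rightarrow> ('h oper \<Rightarrow> complex) set \<Rightarrow> bool" where
  "regular_family M \<Delta> \<phi> \<Lambda> \<Gamma> \<longleftrightarrow> (\<forall>\<gamma>\<in>\<Gamma>. normal_functional M \<gamma> \<and> state M \<gamma>)
     \<and> (\<forall>\<omega> \<epsilon>. normal_functional M \<omega> \<and> 0 < \<epsilon> \<longrightarrow>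
          (\<exists>F c. finite F \<and> F \<subseteq> \<Gamma> \<and> (\<forall>x\<in>M. cmod (\<omega> x - (\<Sum>\<gamma>\<in>F. c \<gamma> * \<gamma> x)) \<le> \<epsilon> * norm x)))
     \<and> (\<forall>\<gamma>\<in>\<Gamma>. left_regular M \<Delta> \<phi> \<Lambda> \<gamma> \<in> reduced_cstar M \<Delta> \<phi> \<Lambda> \<and> unitary_op (left_regular M \<Delta> \<phi> \<Lambda> \<gamma>))"

definition left_covariant :: "'h::chilbert oper set \<Rightarrow> ('h oper \<Rightarrow> ('h, 'h) htensor oper) \<Rightarrow> ('h oper \<Rightarrow> ennreal) \<Rightarrow>
    ('h oper \<Rightarrow> 'k::chilbert) \<Rightarrow> ('h oper \<Rightarrow> complex) set \<Rightarrow> bool" where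
  "left_covariant M \<Delta> \<phi> \<Lambda> \<Gamma> \<longleftrightarrow> (\<forall>\<omega>\<in>\<Gamma>. normal_star_aut M (act_left \<Delta> \<omega>)
     \<and> (\<forall>F\<in>M. gns_rep M \<phi> \<Lambda> (act_left \<Delta> \<omega> F)
          = left_regular M \<Delta> \<phi> \<Lambda> \<omega> o\<^sub>L gns_rep M \<phi> \<Lambda> F o\<^sub>L adj (left_regular M \<Delta> \<phi> \<Lambda> \<omega>)))"

definition right_covariant :: "'h::chilbert oper set \<Rightarrow> ('h oper \<Rightarrow> ('h, 'h) htensor oper) \<Rightarrow> ('h oper \<Rightarrow> ennreal) \<Rightarrow>
    ('h oper \<Rightarrow> 'k::chilbert) \<Rightarrow> ('h oper \<Rightarrow> complex) set \<Rightarrow> bool" where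
  "right_covariant M \<Delta> \<phi> \<Lambda> \<Gamma> \<longleftrightarrow> (\<forall>\<omega>\<in>\<Gamma>. normal_star_aut M (\<lambda>F. act_right \<Delta> F \<omega>)
     \<and> (\<forall>F\<in>M. gns_rep M \<phi> \<Lambda> (act_right \<Delta> F \<omega>)
          = adj (left_regular M \<Delta> \<phi> \<Lambda> \<omega>) o\<^sub>L gns_rep M \<phi> \<Lambda> F o\<^sub>L left_regular M \<Delta> \<phi> \<Lambda> \<omega>))"

definition left_invariant_mean :: "'h::chilbert oper set \<Rightarrow> ('h oper \<Rightarrow> ('h, 'h) htensor oper) \<Rightarrow>
    ('h oper \<Rightarrow> complex) \<Rightarrow> bool" where
  "left_invariant_mean M \<Delta> \<mu> \<longleftrightarrow> state M \<mu>
     \<and> (\<forall>F\<in>M. \<forall>\<omega>. normal_functional M \<omega> \<longrightarrow> \<mu> (slice_left \<omega> (\<Delta> F)) = \<omega> id_blinfun * \<mu> F)"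

definition right_invariant_mean :: "'h::chilbert oper set \<Rightarrow> ('h oper \<Rightarrow> ('h, 'h) htensor oper) \<Rightarrow>
    ('h oper \<Rightarrow> complex) \<Rightarrow> bool" where
  "right_invariant_mean M \<Delta> \<mu> \<longleftrightarrow> state M \<mu>
     \<and> (\<forall>F\<in>M. \<forall>\<omega>. normal_functional M \<omega> \<longrightarrow> \<mu> (slice_right \<omega> (\<Delta> F)) = \<omega> id_blinfun * \<mu> F)"

definition normal_tracial_state :: "'a::chilbert oper set \<Rightarrow> ('a oper \<Rightarrow> complex) \<Rightarrow> bool" where
  "normal_tracial_state N \<tau> \<longleftrightarrow> normal_functional N \<tau> \<and> state N \<tau> \<and> (\<forall>x\<in>N. \<forall>y\<in>N. \<tau> (x o\<^sub>L y) = \<tau> (y o\<^sub>L x))"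


section \<open>Approximate amenability\<close>

text \<open>
  \<open>A\<close> is a norm closed algebra of operators.  A Banach \<open>A\<close>-bimodule is an explicit carrier \<open>X\<close> with its operations,
  since bimodules are quantified over in the definition of approximate amenability.
\<close>

locale banach_bimodule =
  fixes A :: "'a::chilbert oper set"
    and X :: "'x set"
    and add :: "'x \<Rightarrow> 'x \<Rightarrow> 'x"
    and zero :: 'x
    and smult :: "complex \<Rightarrow> 'x \<Rightarrow> 'x"
    and nrm :: "'x \<Rightarrow> real"
    and lact :: "'a oper \<Rightarrow> 'x \<Rightarrow> 'x"
    and ract :: "'x \<Rightarrow> 'a oper \<Rightarrow> 'x"
  assumes add_closed: "x \<in> X \<Longrightarrow> y \<in> X \<Longrightarrow> add x y \<in> X"
    and zero_closed: "zero \<in> X"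
    and smult_closed: "x \<in> X \<Longrightarrow> smult c x \<in> X"
    and add_assoc: "x \<in> X \<Longrightarrow> y \<in> X \<Longrightarrow> z \<in> X \<Longrightarrow> add (add x y) z = add x (add y z)"
    and add_commute: "x \<in> X \<Longrightarrow> y \<in> X \<Longrightarrow> add x y = add y x"
    and add_zero: "x \<in> X \<Longrightarrow> add zero x = x"
    and smult_zero: "x \<in> X \<Longrightarrow> smult 0 x = zero"
    and smult_one: "x \<in> X \<Longrightarrow> smult 1 x = x"
    and smult_smult: "x \<in> X \<Longrightarrow> smult c (smult d x) = smult (c * d) x"
    and smult_add_left: "x \<in> X \<Longrightarrow> smult (c + d) x = add (smult c x) (smult d x)"
    and smult_add_right: "x \<in> X \<Longrightarrow> y \<in> X \<Longrightarrow> smult c (add x y) = add (smult c x) (smult c y)"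
    and nrm_nonneg: "x \<in> X \<Longrightarrow> 0 \<le> nrm x"
    and nrm_eq_0: "x \<in> X \<Longrightarrow> nrm x = 0 \<longleftrightarrow> x = zero"
    and nrm_add: "x \<in> X \<Longrightarrow> y \<in> X \<Longrightarrow> nrm (add x y) \<le> nrm x + nrm y"
    and nrm_smult: "x \<in> X \<Longrightarrow> nrm (smult c x) = cmod c * nrm x"
    and complete: "(\<And>n. s n \<in> X) \<Longrightarrow>
      (\<And>\<epsilon>. 0 < \<epsilon> \<Longrightarrow> \<exists>N. \<forall>m\<ge>N. \<forall>n\<ge>N. nrm (add (s m) (smult (-1) (s n))) < \<epsilon>) \<Longrightarrow>
      \<exists>x\<in>X. (\<lambda>n::nat. nrm (add (s n) (smult (-1) x))) \<longlonglongrightarrow> 0"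
    and lact_closed: "a \<in> A \<Longrightarrow> x \<in> X \<Longrightarrow> lact a x \<in> X"
    and ract_closed: "a \<in> A \<Longrightarrow> x \<in> X \<Longrightarrow> ract x a \<in> X"
    and lact_add: "a \<in> A \<Longrightarrow> x \<in> X \<Longrightarrow> y \<in> X \<Longrightarrow> lact a (add x y) = add (lact a x) (lact a y)"
    and lact_smult: "a \<in> A \<Longrightarrow> x \<in> X \<Longrightarrow> lact a (smult c x) = smult c (lact a x)"
    and add_lact: "a \<in> A \<Longrightarrow> b \<in> A \<Longrightarrow> x \<in> X \<Longrightarrow> lact (a + b) x = add (lact a x) (lact b x)"
    and scale_lact: "a \<in> A \<Longrightarrow> x \<in> X \<Longrightarrow> lact (scale_op c a) x = smult c (lact a x)"
    and ract_add: "a \<in> A \<Longrightarrow> x \<in> X \<Longrightarrow> y \<in> X \<Longrightarrow> ract (add x y) a = add (ract x a) (ract y a)"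
    and ract_smult: "a \<in> A \<Longrightarrow> x \<in> X \<Longrightarrow> ract (smult c x) a = smult c (ract x a)"
    and add_ract: "a \<in> A \<Longrightarrow> b \<in> A \<Longrightarrow> x \<in> X \<Longrightarrow> ract x (a + b) = add (ract x a) (ract x b)"
    and scale_ract: "a \<in> A \<Longrightarrow> x \<in> X \<Longrightarrow> ract x (scale_op c a) = smult c (ract x a)"
    and lact_lact: "a \<in> A \<Longrightarrow> b \<in> A \<Longrightarrow> x \<in> X \<Longrightarrow> lact a (lact b x) = lact (a o\<^sub>L b) x"
    and ract_ract: "a \<in> A \<Longrightarrow> b \<in> A \<Longrightarrow> x \<in> X \<Longrightarrow> ract (ract x a) b = ract x (a o\<^sub>L b)"
    and lact_ract: "a \<in> A \<Longrightarrow> b \<in> A \<Longrightarrow> x \<in> X \<Longrightarrow> ract (lact a x) b = lact a (ract x b)"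
    and act_bounded: "\<exists>K. \<forall>a\<in>A. \<forall>x\<in>X. nrm (lact a x) \<le> K * norm a * nrm x \<and> nrm (ract x a) \<le> K * norm a * nrm x"
begin

definition continuous_derivation :: "('a oper \<Rightarrow> 'x) \<Rightarrow> bool" where
  "continuous_derivation D \<longleftrightarrow> D ` A \<subseteq> X \<and> (\<forall>a\<in>A. \<forall>b\<in>A. D (a + b) = add (D a) (D b))
     \<and> (\<forall>c. \<forall>a\<in>A. D (scale_op c a) = smult c (D a))
     \<and> (\<forall>a\<in>A. \<forall>b\<in>A. D (a o\<^sub>L b) = add (ract (D a) b) (lact a (D b)))
     \<and> (\<exists>K. \<forall>a\<in>A. nrm (D a) \<le> K * norm a)"

text \<open>Nets in \<open>X\<close> are rendered as proper filters concentrated on \<open>X\<close>.\<close>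

definition approximately_inner :: "('a oper \<Rightarrow> 'x) \<Rightarrow> bool" where
  "approximately_inner D \<longleftrightarrow> (\<exists>F. F \<noteq> bot \<and> (\<forall>\<^sub>F x in F. x \<in> X)
     \<and> (\<forall>a\<in>A. ((\<lambda>x. nrm (add (D a) (smult (-1) (add (lact a x) (smult (-1) (ract x a)))))) \<longlongrightarrow> 0) F))"

end

text \<open>
  HOL cannot quantify over all types inside a formula, so the bimodules range over those carried by subsets of
  \<^typ>\<open>'a oper \<Rightarrow> complex\<close>.  Nothing is lost: a continuous derivation into any Banach \<open>A\<close>-bimodule takes values in the
  closed sub-bimodule generated by its range, which has at most \<open>\<bar>A\<bar>\<^sup>\<aleph>\<^sup>0\<close> elements unless the derivation is zero, hence is
  isomorphic to one of these; and a net in the sub-bimodule is a net in the bimodule.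
\<close>

definition approximately_amenable :: "'a::chilbert oper set \<Rightarrow> bool" where
  "approximately_amenable A \<longleftrightarrow> (\<forall>(X :: ('a oper \<Rightarrow> complex) set) add zero smult nrm lact ract D.
     banach_bimodule A X add zero smult nrm lact ract
     \<and> banach_bimodule.continuous_derivation A X add smult nrm lact ract D
     \<longrightarrow> banach_bimodule.approximately_inner A X add smult nrm lact ract D)"

end

theory Submission
  imports Defs
begin

text \<open>
  Write \<open>\<tau>\<close> as a series of vector functionals; the same series extends it to a bounded functional \<open>m\<close> on all operators, and since
  \<open>\<tau>\<close> is a trace, \<open>a \<mapsto> a\<cdot>m - m\<cdot>a\<close> is a derivation of \<open>A = C\<^sub>r\<^sup>*\<close> into the annihilator of \<open>A\<close>.  Approximate amenability
  yields functionals \<open>g\<close> (\<open>m\<close> minus elements of that annihilator) with \<open>g(1) = 1\<close> that asymptotically commute with \<open>A\<close>.  They are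
  neither positive nor bounded uniformly, but \<open>\<parallel>g\<parallel> \<ge> 1\<close>, so one may replace \<open>g\<close> by an approximation of \<open>\<bar>g\<bar> / \<parallel>g\<parallel>\<close>: choose a
  contraction \<open>T\<close> at which \<open>g\<close> almost attains its norm and take \<open>S \<mapsto> g(S T) / \<parallel>g\<parallel>\<close>.  If \<open>u\<close> is a unitary of \<open>A\<close>, \<open>g\<close> also
  almost attains its norm at \<open>u\<^sup>*T u\<close>, and two almost norming contractions give almost the same functional; so these functionals
  are asymptotically \<open>u\<close>-invariant.  A weak* cluster point is a state invariant under conjugation by all \<open>\<lambda>(\<gamma>)\<close>, \<open>\<gamma> \<in> \<Gamma>\<close>; by covariance
  its composition with \<open>\<pi>\<^sub>\<phi>\<close> satisfies the mean property for \<open>\<gamma> \<in> \<Gamma>\<close>, and for all normal functionals by density.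
\<close>

section \<open>Operators on complex Hilbert spaces\<close>

text \<open>The normalisation \<open>g(1) = 1\<close> survives because the correcting functionals
  vanish on \<open>A\<close> and \<open>A\<close> contains 1; the latter holds since
  \<open>A\<close> contains a unitary \<open>u\<close>, hence also \<open>u* u\<close>. The almost
  norming contraction replaces the polar decomposition of \<open>g\<close>, which for a functional
  that is not normal would require the bidual. Positivity is not tracked on the way: the limit is
  contractive with value 1 at 1, and this forces it to be positive. The limit is formed on all
  operators of the GNS space because the unitaries \<open>\<lambda>(\<gamma>)\<close> need not
  belong to \<open>\<pi>(M)\<close>. A second difficulty comes from the encoding. Elements of
  \<open>'a oper\<close> are only real linear, so functionals, adjoints and generated algebras have
  to be kept under control outside \<open>bounded_ops\<close> as well.\<close>

lemma scale_op_apply: "scale_op c T x = c *\<^sub>C T x" for T :: "'a::chilbert oper"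
  unfolding scale_op_def
  by (subst bounded_linear_Blinfun_apply)
     (auto intro!: bounded_linear_compose[OF bounded_linear_scaleC] blinfun.bounded_linear_right)

lemma norm_scale_op: "norm (scale_op c T) = cmod c * norm T" for T :: "'a::chilbert oper"
proof (rule antisym)
  have le: "norm (scale_op c T) \<le> cmod c * norm T" for c and T :: "'a oper"
    by (rule norm_blinfun_bound)
       (auto simp: scale_op_apply norm_scaleC mult.assoc intro!: mult_left_mono norm_blinfun)
  then show "norm (scale_op c T) \<le> cmod c * norm T" .
  show "cmod c * norm T \<le> norm (scale_op c T)"
  proof (cases "c = 0")
    case False
    then have "T = scale_op (inverse c) (scale_op c T)"
      by (intro blinfun_eqI) (simp add: scale_op_apply scaleC_scaleC scaleC_one)
    then have "norm T \<le> cmod (inverse c) * norm (scale_op c T)" using le by metis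
    then have "cmod c * norm T \<le> cmod c * (cmod (inverse c) * norm (scale_op c T))"
      by (rule mult_left_mono) simp
    also have "\<dots> = norm (scale_op c T)" using False by (simp add: norm_inverse mult.assoc[symmetric])
    finally show ?thesis .
  qed simp
qed

lemma scale_op_scaleR: "scale_op (of_real r) T = r *\<^sub>R T" for T :: "'a::chilbert oper"
  by (rule blinfun_eqI) (simp add: scale_op_apply scaleC_of_real blinfun.scaleR_left)

lemma scale_op_simps [simp]:
  "scale_op 1 T = T" "scale_op 0 T = 0" "scale_op (-1) T = - T" for T :: "'a::chilbert oper"
  using scale_op_scaleR[of 1 T] scale_op_scaleR[of 0 T] scale_op_scaleR[of "-1" T] by simp_all

lemma scale_op_compose_left: "scale_op c S o\<^sub>L T = scale_op c (S o\<^sub>L T)" for S T :: "'a::chilbert oper"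
  by (rule blinfun_eqI) (simp add: scale_op_apply)

lemma scale_op_compose_right:
  "S \<in> bounded_ops \<Longrightarrow> S o\<^sub>L scale_op c T = scale_op c (S o\<^sub>L T)" for S T :: "'a::chilbert oper"
  by (rule blinfun_eqI) (simp add: scale_op_apply bounded_ops_def)

lemma bounded_opsD: "T \<in> bounded_ops \<Longrightarrow> T (c *\<^sub>C x) = c *\<^sub>C T x"
  by (simp add: bounded_ops_def)

lemma scaleC_diff_right: "c *\<^sub>C (x - y) = c *\<^sub>C x - c *\<^sub>C y" for x :: "'a::chilbert"
  by (rule linear_diff[OF linear_scaleC])

lemma scaleC_commute: "c *\<^sub>C d *\<^sub>C x = d *\<^sub>C c *\<^sub>C x" for x :: "'a::chilbert"
  by (simp add: scaleC_scaleC mult.commute)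

lemma bounded_ops_closed:
  "0 \<in> bounded_ops" "id_blinfun \<in> bounded_ops"
  "S \<in> bounded_ops \<Longrightarrow> T \<in> bounded_ops \<Longrightarrow> S + T \<in> bounded_ops"
  "S \<in> bounded_ops \<Longrightarrow> T \<in> bounded_ops \<Longrightarrow> S - T \<in> bounded_ops"
  "T \<in> bounded_ops \<Longrightarrow> scale_op c T \<in> bounded_ops"
  "S \<in> bounded_ops \<Longrightarrow> T \<in> bounded_ops \<Longrightarrow> S o\<^sub>L T \<in> bounded_ops"
  for S T :: "'a::chilbert oper"
  by (auto simp: bounded_ops_def blinfun.add_left blinfun.diff_left scaleC_add_right scaleC_diff_right
      scale_op_apply linear_0[OF linear_scaleC] scaleC_commute)

lemma closed_bounded_ops: "closed (bounded_ops :: 'a::chilbert oper set)"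
proof -
  have "bounded_ops = (\<Inter>c. \<Inter>x. {T :: 'a oper. T (c *\<^sub>C x) = c *\<^sub>C T x})"
    by (auto simp: bounded_ops_def)
  moreover have "closed {T :: 'a oper. T (c *\<^sub>C x) = c *\<^sub>C T x}" for c x
    by (intro closed_Collect_eq linear_continuous_on bounded_linear_compose[OF bounded_linear_scaleC])
       (auto intro: blinfun.bounded_linear_left)
  ultimately show ?thesis
    using closed_INT[of UNIV "\<lambda>c. \<Inter>x. {T :: 'a oper. T (c *\<^sub>C x) = c *\<^sub>C T x}"] by (simp add: closed_INT)
qed

lemma cinner_swap: "cinner a b = cinner c d \<Longrightarrow> cinner b a = cinner d c" for a b :: "'a::chilbert" and c d :: "'b::chilbert"
  using cinner_commute[of b a] cinner_commute[of d c] by simp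

lemma cinner_eqI: "(\<And>z. cinner x z = cinner y z) \<Longrightarrow> x = y" for x y :: "'a::chilbert"
  by (metis cinner_diff_left cinner_self diff_self eq_iff_diff_eq_0 norm_eq_zero of_real_eq_0_iff zero_eq_power2)

lemma blinfun_cinner_eqI: "(\<And>x y. cinner (S x) y = cinner (T x) y) \<Longrightarrow> S = T"
  for S T :: "'b::real_normed_vector \<Rightarrow>\<^sub>L 'a::chilbert"
  by (rule blinfun_eqI, rule cinner_eqI)

section \<open>Riesz representation and adjoints\<close>

text \<open>The vector is the minimum point of \<open>y \<mapsto> \<parallel>y\<parallel>\<^sup>2 - 2 f(y)\<close>.\<close>

lemma riesz_real:
  fixes f :: "'a::{banach,real_inner} \<Rightarrow> real"
  assumes "bounded_linear f"
  shows "\<exists>y. \<forall>x. f x = inner x y"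
proof -
  interpret f: bounded_linear f by fact
  obtain K where K: "K \<ge> 0" "\<And>x. \<bar>f x\<bar> \<le> norm x * K" using f.nonneg_bounded by (auto simp: real_norm_def)
  define J where "J y = (norm y)\<^sup>2 - 2 * f y" for y
  have lower: "- K\<^sup>2 \<le> J y" for y
  proof -
    have "f y \<le> norm y * K" using K(2)[of y] by simp
    moreover have "0 \<le> (norm y - K)\<^sup>2" by simp
    ultimately show ?thesis by (simp add: J_def power2_diff)
  qed
  define m where "m = (INF y. J y)"
  have bdd: "bdd_below (range J)" using lower by (auto simp: bdd_below_def)
  have m: "m \<le> J y" for y unfolding m_def by (rule cINF_lower[OF bdd]) simp
  \<comment> \<open>The parallelogram law together with \<open>m \<le> J\<close> at the midpoint
    makes every minimising sequence Cauchy.\<close>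
  have mid: "(norm (a - b))\<^sup>2 \<le> 2 * J a + 2 * J b - 4 * m" for a b
  proof -
    have "4 * J ((1/2) *\<^sub>R (a + b)) = (norm (a + b))\<^sup>2 - 4 * f a - 4 * f b"
    proof -
      have "norm ((1/2) *\<^sub>R (a + b)) = norm (a + b) / 2" "f ((1/2) *\<^sub>R (a + b)) = (f a + f b) / 2"
        by (simp_all add: f.add f.scaleR add_divide_distrib del: scaleR_add_right)
      then show ?thesis unfolding J_def by (simp add: power_divide)
    qed
    then have "4 * m \<le> (norm (a + b))\<^sup>2 - 4 * f a - 4 * f b"
      using m[of "(1/2) *\<^sub>R (a + b)"] by linarith
    then show ?thesis
      by (simp add: J_def power2_norm_eq_inner inner_add_left inner_add_right inner_diff_left inner_diff_right inner_commute)
  qed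
  have "\<exists>y. J y < m + 1 / Suc n" for n
    using cINF_less_iff[OF _ bdd, of "m + 1 / Suc n"] m_def by auto
  then obtain y where y: "J (y n) < m + 1 / Suc n" for n by metis
  have "Cauchy y"
  proof (rule metric_CauchyI)
    fix e :: real assume e: "0 < e"
    obtain N where N: "4 / e\<^sup>2 < real N" using reals_Archimedean2 by blast
    have N': "4 < real N * e\<^sup>2" using N e by (simp add: divide_less_eq)
    have "dist (y a) (y b) < e" if ab: "N \<le> a" "N \<le> b" for a b
    proof -
      have Np: "0 < N" using N e by (metis gr0I of_nat_0 divide_pos_pos not_less_iff_gr_or_eq zero_less_numeral zero_less_power)
      have r: "1 / Suc n < e\<^sup>2 / 4" if "N \<le> n" for n
      proof -
        have "real N * e\<^sup>2 \<le> real (Suc n) * e\<^sup>2" using that by (intro mult_right_mono) auto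
        then show ?thesis using N' by (simp add: field_simps)
      qed
      have "(norm (y a - y b))\<^sup>2 < e\<^sup>2"
        using mid[of "y a" "y b"] y[of a] y[of b] r[OF ab(1)] r[OF ab(2)] by linarith
      then show ?thesis using e by (simp add: dist_norm power_less_imp_less_base)
    qed
    then show "\<exists>M. \<forall>a\<ge>M. \<forall>b\<ge>M. dist (y a) (y b) < e" by blast
  qed
  then obtain z where z: "y \<longlonglongrightarrow> z" using Cauchy_convergent convergentD by blast
  have "(\<lambda>n. J (y n)) \<longlonglongrightarrow> J z"
    unfolding J_def by (intro tendsto_intros z f.tendsto)
  moreover have "(\<lambda>n. m + 1 / Suc n) \<longlonglongrightarrow> m + 0"
    using LIMSEQ_inverse_real_of_nat by (intro tendsto_add tendsto_const) (simp add: inverse_eq_divide)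
  ultimately have Jz: "J z \<le> m"
    using y by (intro LIMSEQ_le[where X="\<lambda>n. J (y n)" and Y="\<lambda>n. m + 1 / Suc n"]) (auto intro: less_imp_le)
  have "f x = inner x z" for x
  proof (rule ccontr)
    define d where "d = f x - inner x z"
    assume "f x \<noteq> inner x z"
    then have d: "d \<noteq> 0" by (simp add: d_def)
    then have x: "x \<noteq> 0" by (auto simp: d_def f.zero)
    \<comment> \<open>This \<open>t\<close> minimises the quadratic polynomial
      \<open>J (z + t x)\<close> in \<open>t\<close>.\<close>
    define t where "t = d / (norm x)\<^sup>2"
    have "J (z + t *\<^sub>R x) = J z - 2 * t * d + t\<^sup>2 * (norm x)\<^sup>2"
      unfolding J_def d_def power2_norm_eq_inner
      by (simp add: f.add f.scaleR inner_add_left inner_add_right inner_commute[of z x] power2_eq_square)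
         (simp add: algebra_simps)
    also have "\<dots> = J z - d\<^sup>2 / (norm x)\<^sup>2"
      using x by (simp add: t_def field_simps power2_eq_square)
    also have "\<dots> < J z" using d x by simp
    finally show False using m[of "z + t *\<^sub>R x"] Jz by simp
  qed
  then show ?thesis by blast
qed

text \<open>Adjoints, slices, the conjugation and the flip are all obtained from this form of the
  Riesz theorem. Only real homogeneity is asked in the first argument because the form of the
  conjugation is conjugate linear there. A negative \<open>K\<close> can occur only if one of the
  spaces is zero; \<open>max K 0\<close> covers that case.\<close>

lemma sesquilinear_operator:
  fixes B :: "'a::chilbert \<Rightarrow> 'b::chilbert \<Rightarrow> complex"
  assumes add_l: "\<And>x x' y. B (x + x') y = B x y + B x' y"
    and add_r: "\<And>x y y'. B x (y + y') = B x y + B x y'"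
    and scale_r: "\<And>c x y. B x (c *\<^sub>C y) = cnj c * B x y"
    and scale_l: "\<And>r x y. B (r *\<^sub>R x) y = of_real r * B x y"
    and bound: "\<And>x y. cmod (B x y) \<le> K * norm x * norm y"
  shows "\<exists>T :: 'a \<Rightarrow>\<^sub>L 'b. (\<forall>x y. cinner (blinfun_apply T x) y = B x y) \<and> norm T \<le> max K 0"
proof -
  have "\<exists>z. \<forall>y. Re (B x y) = inner y z" for x
  proof (rule riesz_real, rule bounded_linear_intro)
    fix y y' r
    show "Re (B x (y + y')) = Re (B x y) + Re (B x y')" by (simp add: add_r)
    show "Re (B x (r *\<^sub>R y)) = r *\<^sub>R Re (B x y)" by (simp add: scaleC_of_real[symmetric] scale_r)
    show "norm (Re (B x y)) \<le> norm y * (K * norm x)"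
      using bound[of x y] abs_Re_le_cmod[of "B x y"] by (simp add: mult_ac)
  qed
  then obtain t where t: "Re (B x y) = inner y (t x)" for x y by metis
  \<comment> \<open>The real functional determines only the real part of \<open>B\<close>;
    evaluation at \<open>\<i> *\<^sub>C y\<close> recovers the imaginary part.\<close>
  have cin: "cinner (t x) y = B x y" for x y
    using t[of x y] t[of x "\<i> *\<^sub>C y"] Re_cinner[of "t x" y] Re_cinner[of "t x" "\<i> *\<^sub>C y"]
    by (simp add: complex_eq_iff scale_r inner_commute cinner_scaleC_right)
  have "norm (t x) \<le> max K 0 * norm x" for x
  proof (cases "t x = 0")
    case False
    have "norm (t x) * norm (t x) = cmod (cinner (t x) (t x))"
      by (simp add: cinner_self power2_eq_square norm_mult)
    also have "\<dots> \<le> K * norm x * norm (t x)" unfolding cin by (rule bound)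
    also have "\<dots> \<le> max K 0 * norm x * norm (t x)" by (intro mult_right_mono) auto
    finally show ?thesis using False by simp
  qed auto
  then have bl: "bounded_linear t"
    by (intro bounded_linear_intro[where K="max K 0"] cinner_eqI)
       (simp_all add: cin add_l scale_l cinner_add_left cinner_scaleR_left mult.commute)
  show ?thesis
  proof (intro exI[of _ "Blinfun t"] conjI allI)
    show "norm (Blinfun t) \<le> max K 0"
      using \<open>\<And>x. norm (t x) \<le> max K 0 * norm x\<close>
      by (intro norm_blinfun_bound) (simp_all add: bounded_linear_Blinfun_apply[OF bl])
  qed (simp add: bounded_linear_Blinfun_apply[OF bl] cin)
qed

lemma adj_exists:
  fixes T :: "'a::chilbert oper"
  assumes T: "T \<in> bounded_ops"
  shows "\<exists>!S. S \<in> bounded_ops \<and> (\<forall>x y. cinner (T x) y = cinner x (S y))"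
proof -
  have "\<exists>S :: 'a oper. (\<forall>x y. cinner (blinfun_apply S x) y = cinner x (T y)) \<and> norm S \<le> max (norm T) 0"
  proof (rule sesquilinear_operator)
    fix x y :: 'a
    show "cmod (cinner x (T y)) \<le> norm T * norm x * norm y"
      using cinner_bound[of x "T y"] mult_left_mono[OF norm_blinfun[of T y], of "norm x"] by (simp add: mult_ac)
  qed (simp_all add: cinner_add_left cinner_add_right blinfun.add_right bounded_opsD[OF T] cinner_scaleC_right
      cinner_scaleR_left)
  then obtain S :: "'a oper" where S: "\<And>x y. cinner (S x) y = cinner x (T y)" by blast
  have S': "cinner (T x) y = cinner x (S y)" for x y by (rule cinner_swap) (simp add: S)
  have "S \<in> bounded_ops"
    unfolding bounded_ops_def
  proof (intro CollectI allI)
    show "S (c *\<^sub>C x) = c *\<^sub>C S x" for c x by (rule cinner_eqI) (simp add: S cinner_scaleC_left)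
  qed
  moreover have "R = S" if "\<forall>x y. cinner (T x) y = cinner x (R y)" for R :: "'a oper"
  proof (rule blinfun_cinner_eqI)
    show "cinner (R x) y = cinner (S x) y" for x y
      by (rule cinner_swap) (simp add: that[rule_format, symmetric] S')
  qed
  ultimately show ?thesis using S' by blast
qed

lemma
  fixes T :: "'a::chilbert oper"
  assumes T: "T \<in> bounded_ops"
  shows adj_bounded: "adj T \<in> bounded_ops"
    and cinner_adj_right: "cinner x (adj T y) = cinner (T x) y"
    and cinner_adj_left: "cinner (adj T x) y = cinner x (T y)"
proof -
  have *: "adj T \<in> bounded_ops \<and> (\<forall>x y. cinner (T x) y = cinner x (adj T y))"
    unfolding adj_def by (rule theI'[OF adj_exists[OF T]])
  then show "adj T \<in> bounded_ops" "cinner x (adj T y) = cinner (T x) y" by auto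
  show "cinner (adj T x) y = cinner x (T y)" by (rule cinner_swap) (simp add: *)
qed

lemma adj_eqI:
  fixes S T :: "'a::chilbert oper"
  assumes T: "T \<in> bounded_ops" and "\<And>x y. cinner (T x) y = cinner x (S y)"
  shows "adj T = S"
  by (rule blinfun_cinner_eqI, rule cinner_swap) (simp add: cinner_adj_right[OF T] assms(2)[symmetric])

lemma adj_simps:
  fixes S T :: "'a::chilbert oper"
  assumes "S \<in> bounded_ops" "T \<in> bounded_ops"
  shows "adj (adj S) = S" "adj (S + T) = adj S + adj T" "adj (S - T) = adj S - adj T"
    "adj (S o\<^sub>L T) = adj T o\<^sub>L adj S" "adj (scale_op c S) = scale_op (cnj c) (adj S)"
proof -
  note c = bounded_ops_closed adj_bounded[OF assms(1)] adj_bounded[OF assms(2)]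
    assms cinner_adj_right[OF assms(1)] cinner_adj_right[OF assms(2)] cinner_adj_left[OF assms(1)]
  show "adj (adj S) = S" by (rule adj_eqI) (simp_all only: c)
  show "adj (S + T) = adj S + adj T"
    by (rule adj_eqI) (simp_all add: c blinfun.add_left cinner_add_left cinner_add_right)
  show "adj (S - T) = adj S - adj T"
    by (rule adj_eqI) (simp_all add: c blinfun.diff_left cinner_diff_left cinner_diff_right)
  show "adj (S o\<^sub>L T) = adj T o\<^sub>L adj S"
    by (rule adj_eqI) (simp_all add: c)
  show "adj (scale_op c S) = scale_op (cnj c) (adj S)"
    by (rule adj_eqI) (simp_all add: c bounded_ops_closed scale_op_apply cinner_scaleC_left cinner_scaleC_right)
qed

lemma adj_id [simp]: "adj id_blinfun = (id_blinfun :: 'a::chilbert oper)"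
  by (rule adj_eqI) (simp_all add: bounded_ops_closed)

lemma norm_le_of_cinner:
  fixes T :: "'b::real_normed_vector \<Rightarrow>\<^sub>L 'a::chilbert"
  assumes "0 \<le> K" "\<And>x y. cmod (cinner (T x) y) \<le> K * norm x * norm y"
  shows "norm T \<le> K"
proof (rule norm_blinfun_bound)
  fix x
  have "norm (T x) * norm (T x) = cmod (cinner (T x) (T x))"
    by (simp add: cinner_self power2_eq_square norm_mult)
  also have "\<dots> \<le> K * norm x * norm (T x)" by (rule assms)
  finally show "norm (T x) \<le> K * norm x" using assms(1) by (cases "T x = 0") auto
qed fact

lemma norm_adj_le:
  fixes T :: "'a::chilbert oper"
  assumes T: "T \<in> bounded_ops"
  shows "norm (adj T) \<le> norm T"
proof (rule norm_le_of_cinner)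
  fix x y
  show "cmod (cinner (adj T x) y) \<le> norm T * norm x * norm y"
    unfolding cinner_adj_left[OF T]
    using cinner_bound[of x "T y"] mult_left_mono[OF norm_blinfun[of T y], of "norm x"] by (simp add: mult_ac)
qed simp

lemma norm_id_blinfun_le: "norm (id_blinfun :: 'a::real_normed_vector \<Rightarrow>\<^sub>L 'a) \<le> 1"
  by (rule norm_blinfun_bound) simp_all

lemma unitary_opD:
  fixes U :: "'a::chilbert oper"
  assumes "unitary_op U"
  shows "U \<in> bounded_ops" "adj U o\<^sub>L U = id_blinfun" "U o\<^sub>L adj U = id_blinfun"
    "norm U \<le> 1" "norm (adj U) \<le> 1"
proof -
  show U: "U \<in> bounded_ops" "adj U o\<^sub>L U = id_blinfun" "U o\<^sub>L adj U = id_blinfun"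
    using assms by (auto simp: unitary_op_def)
  show "norm U \<le> 1"
  proof (rule norm_blinfun_bound)
    fix x
    have "adj U (U x) = x" by (metis U(2) blinfun_apply_blinfun_compose blinfun_apply_id_blinfun id_apply)
    then have "cinner (U x) (U x) = cinner x x"
      using cinner_adj_right[OF U(1), of x "U x"] by simp
    then have "(norm (U x))\<^sup>2 = (norm x)\<^sup>2"
      by (metis cinner_self of_real_eq_iff)
    then show "norm (U x) \<le> 1 * norm x" by (simp add: power2_eq_iff_nonneg)
  qed simp
  then show "norm (adj U) \<le> 1" using norm_adj_le[OF U(1)] by simp
qed

section \<open>Operator algebras\<close>

lemma blinfun_compose_assoc: "(R o\<^sub>L S) o\<^sub>L T = R o\<^sub>L (S o\<^sub>L T)"
  by (rule blinfun_eqI) simp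

lemma commutantI: "T \<in> bounded_ops \<Longrightarrow> (\<And>S. S \<in> \<S> \<Longrightarrow> S o\<^sub>L T = T o\<^sub>L S) \<Longrightarrow> T \<in> commutant \<S>"
  by (simp add: commutant_def)

lemma commutantD: "T \<in> commutant \<S> \<Longrightarrow> S \<in> \<S> \<Longrightarrow> S o\<^sub>L T = T o\<^sub>L S"
  by (simp add: commutant_def)

lemma commutant_subset_bounded: "commutant \<S> \<subseteq> bounded_ops"
  by (auto simp: commutant_def)

lemma commutant_antimono: "\<S> \<subseteq> \<T> \<Longrightarrow> commutant \<T> \<subseteq> commutant \<S>"
  by (auto simp: commutant_def)

lemma subset_bicommutant: "\<S> \<subseteq> bounded_ops \<Longrightarrow> \<S> \<subseteq> commutant (commutant \<S>)"
  by (auto simp: commutant_def)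

lemma id_in_commutant: "id_blinfun \<in> commutant \<S>"
  by (auto intro!: commutantI bounded_ops_closed blinfun_eqI)

lemma closed_commutant: "closed (commutant \<S>)"
proof -
  have "commutant \<S> = bounded_ops \<inter> (\<Inter>S\<in>\<S>. {T. S o\<^sub>L T = T o\<^sub>L S})"
    by (auto simp: commutant_def)
  moreover have "closed {T. S o\<^sub>L T = T o\<^sub>L S}" for S :: "'a oper"
    by (intro closed_Collect_eq linear_continuous_on
        bounded_bilinear.bounded_linear_left[OF bounded_bilinear_blinfun_compose]
        bounded_bilinear.bounded_linear_right[OF bounded_bilinear_blinfun_compose])
  ultimately show ?thesis using closed_bounded_ops by (auto intro!: closed_Int closed_INT)
qed

lemma commutant_adj:
  assumes "\<S> \<subseteq> bounded_ops" "\<And>S. S \<in> \<S> \<Longrightarrow> adj S \<in> \<S>" "T \<in> commutant \<S>"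
  shows "adj T \<in> commutant \<S>"
proof (rule commutantI)
  have T: "T \<in> bounded_ops" using assms(3) commutant_subset_bounded by blast
  then show "adj T \<in> bounded_ops" by (rule adj_bounded)
  fix S assume S: "S \<in> \<S>"
  then have Sb: "S \<in> bounded_ops" using assms(1) by blast
  have "adj (adj S o\<^sub>L T) = adj (T o\<^sub>L adj S)"
    using commutantD[OF assms(3) assms(2)[OF S]] by simp
  then show "S o\<^sub>L adj T = adj T o\<^sub>L S"
    using Sb T by (simp add: adj_simps adj_bounded)
qed

text \<open>Commutants reverse inclusions and a set lies in its bicommutant, so the third commutant
  equals the first. Commutants are the von Neumann algebras by which \<open>vn_generated\<close> is
  bounded from above later.\<close>

lemma von_neumann_commutant:
  assumes "\<S> \<subseteq> bounded_ops" "\<And>S. S \<in> \<S> \<Longrightarrow> adj S \<in> \<S>"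
  shows "von_neumann_algebra (commutant \<S>)"
  unfolding von_neumann_algebra_def
proof (intro conjI ballI)
  show "commutant (commutant (commutant \<S>)) = commutant \<S>"
    using commutant_antimono[OF subset_bicommutant[OF assms(1)]]
      subset_bicommutant[OF commutant_subset_bounded[of \<S>]] by blast
qed (simp_all add: commutant_subset_bounded commutant_adj[OF assms])

lemma cstar_commutant:
  assumes "\<S> \<subseteq> bounded_ops" "\<And>S. S \<in> \<S> \<Longrightarrow> adj S \<in> \<S>"
  shows "cstar_algebra (commutant \<S>)"
  unfolding cstar_algebra_def
proof (intro conjI ballI allI)
  fix S T c assume ST: "S \<in> commutant \<S>" "T \<in> commutant \<S>"
  then have b: "S \<in> bounded_ops" "T \<in> bounded_ops" using commutant_subset_bounded by auto
  show "S + T \<in> commutant \<S>"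
  proof (rule commutantI)
    fix R assume R: "R \<in> \<S>"
    show "R o\<^sub>L (S + T) = (S + T) o\<^sub>L R"
      by (simp add: commutantD[OF ST(1) R] commutantD[OF ST(2) R]
          bounded_bilinear.add_left[OF bounded_bilinear_blinfun_compose]
          bounded_bilinear.add_right[OF bounded_bilinear_blinfun_compose])
  qed (simp add: b bounded_ops_closed)
  show "scale_op c S \<in> commutant \<S>"
  proof (rule commutantI)
    fix R assume R: "R \<in> \<S>"
    then show "R o\<^sub>L scale_op c S = scale_op c S o\<^sub>L R"
      using assms(1) by (simp add: commutantD[OF ST(1) R] scale_op_compose_left scale_op_compose_right subset_iff)
  qed (simp add: b bounded_ops_closed)
  show "S o\<^sub>L T \<in> commutant \<S>"
  proof (rule commutantI)
    fix R assume R: "R \<in> \<S>"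
    show "R o\<^sub>L (S o\<^sub>L T) = S o\<^sub>L T o\<^sub>L R"
      using commutantD[OF ST(1) R] commutantD[OF ST(2) R] by (metis blinfun_compose_assoc)
  qed (simp add: b bounded_ops_closed)
qed (auto simp: commutant_subset_bounded closed_commutant commutant_adj[OF assms] intro!: commutantI bounded_ops_closed
       blinfun_eqI blinfun.zero_right)

lemma von_neumann_cstar:
  assumes "von_neumann_algebra M"
  shows "cstar_algebra M" "id_blinfun \<in> M"
proof -
  have M: "M = commutant (commutant M)" "M \<subseteq> bounded_ops" "\<And>T. T \<in> M \<Longrightarrow> adj T \<in> M"
    using assms by (auto simp: von_neumann_algebra_def)
  then show "cstar_algebra M"
    using cstar_commutant[of "commutant M"] commutant_adj[of M] commutant_subset_bounded by metis
  show "id_blinfun \<in> M" using M(1) id_in_commutant by metis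
qed

lemma cstar_algebraD:
  assumes "cstar_algebra A"
  shows "A \<subseteq> bounded_ops" "0 \<in> A" "closed A"
    "S \<in> A \<Longrightarrow> T \<in> A \<Longrightarrow> S + T \<in> A" "S \<in> A \<Longrightarrow> scale_op c S \<in> A"
    "S \<in> A \<Longrightarrow> T \<in> A \<Longrightarrow> S o\<^sub>L T \<in> A" "S \<in> A \<Longrightarrow> adj S \<in> A"
    "S \<in> A \<Longrightarrow> r *\<^sub>R S \<in> A" "S \<in> A \<Longrightarrow> T \<in> A \<Longrightarrow> S - T \<in> A"
proof -
  show *: "A \<subseteq> bounded_ops" "0 \<in> A" "closed A"
    "\<And>S T. S \<in> A \<Longrightarrow> T \<in> A \<Longrightarrow> S + T \<in> A" "\<And>S c. S \<in> A \<Longrightarrow> scale_op c S \<in> A"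
    "\<And>S T. S \<in> A \<Longrightarrow> T \<in> A \<Longrightarrow> S o\<^sub>L T \<in> A" "\<And>S. S \<in> A \<Longrightarrow> adj S \<in> A"
    using assms by (auto simp: cstar_algebra_def)
  show r: "\<And>S r. S \<in> A \<Longrightarrow> r *\<^sub>R S \<in> A" by (metis *(5) scale_op_scaleR)
  show "S \<in> A \<Longrightarrow> T \<in> A \<Longrightarrow> S - T \<in> A"
    using *(4)[of S "(-1) *\<^sub>R T"] r[of T "-1"] by simp
qed

text \<open>The hypothesis excludes the intersection of the empty family, which is
  \<open>UNIV\<close> and in general contains operators that are not complex linear.\<close>

lemma cstar_generated_cstar:
  assumes "\<exists>A. cstar_algebra A \<and> S \<subseteq> A"
  shows "cstar_algebra (cstar_generated S)"
proof -
  have D: "\<And>A. A \<in> {A. cstar_algebra A \<and> S \<subseteq> A} \<Longrightarrow> cstar_algebra A" by simp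
  note A = cstar_algebraD[OF D]
  have "cstar_generated S \<subseteq> bounded_ops" using assms A(1) by (force simp: cstar_generated_def)
  moreover have "closed (cstar_generated S)" unfolding cstar_generated_def by (rule closed_Inter) (use A(3) in blast)
  ultimately show ?thesis
    unfolding cstar_algebra_def cstar_generated_def
    by (intro conjI ballI allI InterI; simp add: A)
qed

lemma cstar_generated_subset_vn_generated: "cstar_generated S \<subseteq> vn_generated S"
  using von_neumann_cstar by (auto simp: cstar_generated_def vn_generated_def)

lemma id_in_vn_generated: "id_blinfun \<in> vn_generated S"
  using von_neumann_cstar by (auto simp: vn_generated_def)

lemma vn_generated_least: "von_neumann_algebra M \<Longrightarrow> S \<subseteq> M \<Longrightarrow> vn_generated S \<subseteq> M"
  by (auto simp: vn_generated_def)

section \<open>The annihilator bimodule\<close>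

text \<open>Multiplication by \<i> is turned into an operator so that composing with it on the left
  and on the right can be distinguished.\<close>

definition imag_unit :: "'a::chilbert oper" where
  "imag_unit = scale_op \<i> id_blinfun"

lemma imag_unit_apply: "imag_unit x = \<i> *\<^sub>C x"
  by (simp add: imag_unit_def scale_op_apply)

lemma scale_op_imag_unit: "scale_op c T = Re c *\<^sub>R T + Im c *\<^sub>R (imag_unit o\<^sub>L T)" for T :: "'a::chilbert oper"
proof (rule blinfun_eqI)
  fix x
  have "c *\<^sub>C T x = (of_real (Re c) + of_real (Im c) * \<i>) *\<^sub>C T x"
    by (metis complex_eq mult.commute)
  then show "scale_op c T x = (Re c *\<^sub>R T + Im c *\<^sub>R (imag_unit o\<^sub>L T)) x"
    by (simp add: scale_op_apply imag_unit_apply blinfun.add_left blinfun.scaleR_left scaleC_add_left scaleC_of_real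
        scaleC_scaleC[symmetric])
qed

lemma imag_unit_commute: "T \<in> bounded_ops \<Longrightarrow> T o\<^sub>L imag_unit = imag_unit o\<^sub>L T" for T :: "'a::chilbert oper"
  by (rule blinfun_eqI) (simp add: imag_unit_apply bounded_opsD)

text \<open>
  Operators of type \<^typ>\<open>'a oper\<close> are only real linear, and left and right multiplication by \<open>\<i>\<close> differ on them.  A functional
  that is homogeneous for both vanishes on conjugate linear operators, so these functionals are the dual of
  \<^const>\<open>bounded_ops\<close>, but extensional and with the norm of the ambient space.
\<close>

definition complex_functionals :: "('a::chilbert oper \<Rightarrow> complex) set" where
  "complex_functionals = {f. bounded_linear f \<and> (\<forall>T. f (imag_unit o\<^sub>L T) = \<i> * f T) \<and> (\<forall>T. f (T o\<^sub>L imag_unit) = \<i> * f T)}"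

lemma complex_functionalsD:
  assumes "f \<in> complex_functionals"
  shows "bounded_linear f" "f (imag_unit o\<^sub>L T) = \<i> * f T" "f (T o\<^sub>L imag_unit) = \<i> * f T"
    "f (S + T) = f S + f T" "f (S - T) = f S - f T" "f (r *\<^sub>R T) = of_real r * f T"
    "f (scale_op c T) = c * f T"
    "cmod (f T) \<le> onorm f * norm T"
proof -
  show *: "bounded_linear f" "\<And>T. f (imag_unit o\<^sub>L T) = \<i> * f T" "\<And>T. f (T o\<^sub>L imag_unit) = \<i> * f T"
    using assms by (auto simp: complex_functionals_def)
  interpret f: bounded_linear f by fact
  show "f (S + T) = f S + f T" "f (S - T) = f S - f T" "f (r *\<^sub>R T) = of_real r * f T"
    by (simp_all add: f.add f.diff f.scaleR scaleR_conv_of_real)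
  have "of_real (Re c) * f T + of_real (Im c) * (\<i> * f T) = (of_real (Re c) + of_real (Im c) * \<i>) * f T"
    by (simp add: algebra_simps)
  also have "of_real (Re c) + of_real (Im c) * \<i> = c" by (metis complex_eq mult.commute)
  finally show "f (scale_op c T) = c * f T"
    by (simp add: scale_op_imag_unit f.add f.scaleR *(2) scaleR_conv_of_real)
  show "cmod (f T) \<le> onorm f * norm T" by (rule onorm[OF *(1)])
qed

text \<open>The factor \<i> cannot be moved past a general \<open>T\<close>. It can be moved past
  the complex linear \<open>a\<close> to the far right, where the second homogeneity condition
  absorbs it.\<close>

lemma complex_functional_scale_right:
  assumes f: "f \<in> complex_functionals" and a: "a \<in> bounded_ops"
  shows "f (T o\<^sub>L scale_op c a) = c * f (T o\<^sub>L a)"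
proof -
  interpret f: bounded_linear f by (rule complex_functionalsD(1)[OF f])
  have "T o\<^sub>L scale_op c a = Re c *\<^sub>R (T o\<^sub>L a) + Im c *\<^sub>R ((T o\<^sub>L a) o\<^sub>L imag_unit)"
    by (rule blinfun_eqI)
       (simp add: scale_op_imag_unit blinfun.add_left blinfun.add_right blinfun.scaleR_left blinfun.scaleR_right
         imag_unit_apply bounded_opsD[OF a])
  then have "f (T o\<^sub>L scale_op c a) = (of_real (Re c) + of_real (Im c) * \<i>) * f (T o\<^sub>L a)"
    by (simp add: f.add f.scaleR complex_functionalsD(3)[OF f] scaleR_conv_of_real algebra_simps)
  also have "of_real (Re c) + of_real (Im c) * \<i> = c" by (metis complex_eq mult.commute)
  finally show ?thesis .
qed

lemma bounded_linear_compose_right: "bounded_linear (\<lambda>T. T o\<^sub>L a)"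
  and bounded_linear_compose_left: "bounded_linear (\<lambda>T. a o\<^sub>L T)"
  by (rule bounded_bilinear.bounded_linear_left[OF bounded_bilinear_blinfun_compose]
      bounded_bilinear.bounded_linear_right[OF bounded_bilinear_blinfun_compose])+

lemma complex_functionals_closed:
  assumes "f \<in> complex_functionals"
  shows "g \<in> complex_functionals \<Longrightarrow> (\<lambda>T. f T + g T) \<in> complex_functionals"
    "g \<in> complex_functionals \<Longrightarrow> (\<lambda>T. f T - g T) \<in> complex_functionals"
    "(\<lambda>T. c * f T) \<in> complex_functionals"
    "a \<in> bounded_ops \<Longrightarrow> (\<lambda>T. f (T o\<^sub>L a)) \<in> complex_functionals"
    "a \<in> bounded_ops \<Longrightarrow> (\<lambda>T. f (a o\<^sub>L T)) \<in> complex_functionals"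
proof -
  note f = complex_functionalsD[OF assms]
  {
    assume "g \<in> complex_functionals"
    note g = complex_functionalsD[OF this]
    show "(\<lambda>T. f T + g T) \<in> complex_functionals" "(\<lambda>T. f T - g T) \<in> complex_functionals"
      using f(1) g(1)
      by (auto simp: complex_functionals_def f(2,3) g(2,3) algebra_simps intro: bounded_linear_add bounded_linear_sub)
  }
  show "(\<lambda>T. c * f T) \<in> complex_functionals"
    using bounded_linear_const_mult[OF f(1)] by (auto simp: complex_functionals_def f(2,3))
  assume a: "a \<in> bounded_ops"
  show "(\<lambda>T. f (T o\<^sub>L a)) \<in> complex_functionals"
    using bounded_linear_compose[OF f(1) bounded_linear_compose_right]
    by (auto simp: complex_functionals_def f(2,3) blinfun_compose_assoc imag_unit_commute[OF a, symmetric])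
       (simp_all add: blinfun_compose_assoc[symmetric] f(2,3))
  show "(\<lambda>T. f (a o\<^sub>L T)) \<in> complex_functionals"
    using bounded_linear_compose[OF f(1) bounded_linear_compose_left]
    by (auto simp: complex_functionals_def f(2,3) blinfun_compose_assoc[symmetric] imag_unit_commute[OF a])
       (simp_all add: blinfun_compose_assoc f(2,3))
qed

text \<open>Its elements are functions \<open>'a oper \<Rightarrow> complex\<close>, so that it is
  one of the carriers over which \<open>approximately_amenable\<close> quantifies.\<close>

definition annihilator :: "'a::chilbert oper set \<Rightarrow> ('a oper \<Rightarrow> complex) set" where
  "annihilator A = {f \<in> complex_functionals. \<forall>a\<in>A. f a = 0}"

lemma onorm_compose_right_le:
  fixes f :: "'a::chilbert oper \<Rightarrow> complex"
  assumes f: "bounded_linear f"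
  shows "onorm (\<lambda>T. f (T o\<^sub>L a)) \<le> norm a * onorm f" "onorm (\<lambda>T. f (a o\<^sub>L T)) \<le> norm a * onorm f"
proof -
  have *: "cmod (f R) \<le> norm a * onorm f * norm T" if "norm R \<le> norm T * norm a" for R T :: "'a oper"
    using order_trans[OF onorm[OF f, of R] mult_left_mono[OF that onorm_pos_le[OF f]]] by (simp add: mult_ac)
  have "norm (a o\<^sub>L T) \<le> norm T * norm a" for T using norm_blinfun_compose[of a T] by (simp add: mult.commute)
  then show "onorm (\<lambda>T. f (T o\<^sub>L a)) \<le> norm a * onorm f" "onorm (\<lambda>T. f (a o\<^sub>L T)) \<le> norm a * onorm f"
    by (auto intro!: onorm_bound mult_nonneg_nonneg onorm_pos_le[OF f] * norm_blinfun_compose)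
qed

lemma onorm_cmult:
  fixes f :: "'a::real_normed_vector \<Rightarrow> complex"
  assumes f: "bounded_linear f"
  shows "onorm (\<lambda>x. c * f x) = cmod c * onorm f"
proof (rule antisym)
  have le: "onorm (\<lambda>x. c * f x) \<le> cmod c * onorm f" if "bounded_linear f" for c and f :: "'a \<Rightarrow> complex"
    by (intro onorm_bound mult_nonneg_nonneg onorm_pos_le that)
       (auto simp: norm_mult mult.assoc intro!: mult_left_mono onorm[OF that])
  show "onorm (\<lambda>x. c * f x) \<le> cmod c * onorm f" by (rule le[OF f])
  show "cmod c * onorm f \<le> onorm (\<lambda>x. c * f x)"
  proof (cases "c = 0")
    case False
    have "(\<lambda>x. inverse c * (c * f x)) = f" using False by (auto simp: mult.assoc[symmetric])
    then have "onorm f = onorm (\<lambda>x. inverse c * (c * f x))" by simp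
    also have "\<dots> \<le> cmod (inverse c) * onorm (\<lambda>x. c * f x)"
      by (rule le[OF bounded_linear_const_mult[OF f]])
    finally have "cmod c * onorm f \<le> cmod c * (cmod (inverse c) * onorm (\<lambda>x. c * f x))"
      by (rule mult_left_mono) simp
    also have "\<dots> = onorm (\<lambda>x. c * f x)" using False by (simp add: norm_inverse mult.assoc[symmetric])
    finally show ?thesis .
  qed (simp add: onorm_pos_le f onorm_zero)
qed

text \<open>All defining conditions survive pointwise limits, so completeness is inherited from the
  Banach space of bounded linear maps into the complex numbers.\<close>

lemma annihilator_complete:
  assumes s: "\<And>n::nat. s n \<in> annihilator A"
    and Cauchy: "\<And>\<epsilon>. 0 < \<epsilon> \<Longrightarrow> \<exists>N. \<forall>m\<ge>N. \<forall>n\<ge>N. onorm (\<lambda>T. s m T - s n T) < \<epsilon>"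
  shows "\<exists>f\<in>annihilator A. (\<lambda>n. onorm (\<lambda>T. s n T - f T)) \<longlonglongrightarrow> 0"
proof -
  have sc: "s n \<in> complex_functionals" for n using s by (auto simp: annihilator_def)
  have bl: "bounded_linear (s n)" for n by (rule complex_functionalsD(1)[OF sc])
  have Bs: "blinfun_apply (Blinfun (s n)) = s n" for n by (rule bounded_linear_Blinfun_apply[OF bl])
  have "Cauchy (\<lambda>n. Blinfun (s n))"
  proof (rule metric_CauchyI)
    fix e :: real assume "0 < e"
    then show "\<exists>N. \<forall>m\<ge>N. \<forall>n\<ge>N. dist (Blinfun (s m)) (Blinfun (s n)) < e"
      using Cauchy[of e] by (simp add: dist_norm norm_blinfun.rep_eq minus_blinfun.rep_eq Bs)
  qed
  then obtain l where l: "(\<lambda>n. Blinfun (s n)) \<longlonglongrightarrow> l" using Cauchy_convergent convergentD by blast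
  have lT: "(\<lambda>n. s n T) \<longlonglongrightarrow> l T" for T
    using blinfun.tendsto[OF l tendsto_const[of T]] by (simp add: Bs)
  have "blinfun_apply l \<in> annihilator A"
    unfolding annihilator_def complex_functionals_def
  proof (intro CollectI conjI allI ballI)
    fix T
    show "l (imag_unit o\<^sub>L T) = \<i> * l T"
      using LIMSEQ_unique[OF lT[of "imag_unit o\<^sub>L T"]] tendsto_mult_left[OF lT[of T], of \<i>]
      by (simp add: complex_functionalsD(2)[OF sc])
    show "l (T o\<^sub>L imag_unit) = \<i> * l T"
      using LIMSEQ_unique[OF lT[of "T o\<^sub>L imag_unit"]] tendsto_mult_left[OF lT[of T], of \<i>]
      by (simp add: complex_functionalsD(3)[OF sc])
  next
    fix a assume "a \<in> A"
    then have "s n a = 0" for n using s by (simp add: annihilator_def)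
    then show "l a = 0" using LIMSEQ_unique[OF lT[of a]] by simp
  qed (rule blinfun.bounded_linear_right)
  moreover have "(\<lambda>n. onorm (\<lambda>T. s n T - l T)) \<longlonglongrightarrow> 0"
    using tendsto_norm_zero[OF LIM_zero[OF l]] by (simp add: norm_blinfun.rep_eq minus_blinfun.rep_eq Bs)
  ultimately show ?thesis by blast
qed

text \<open>The actions are those of a dual bimodule: multiplying a functional on one side
  multiplies its argument on the other side.\<close>

lemma annihilator_bimodule:
  assumes A: "cstar_algebra A"
  shows "banach_bimodule A (annihilator A) (\<lambda>f g T. f T + g T) (\<lambda>_. 0) (\<lambda>c f T. c * f T) onorm
    (\<lambda>a f T. f (T o\<^sub>L a)) (\<lambda>f a T. f (a o\<^sub>L T))"
proof -
  note A' = cstar_algebraD[OF A]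
  have c: "f \<in> complex_functionals" if "f \<in> annihilator A" for f using that by (simp add: annihilator_def)
  note d = complex_functionalsD[OF c]
  have b: "a \<in> bounded_ops" if "a \<in> A" for a using that A'(1) by blast
  have zero: "(\<lambda>_. 0) \<in> complex_functionals" by (simp add: complex_functionals_def)
  show ?thesis
  proof (unfold_locales, goal_cases)
    \<comment> \<open>Goal 16 is completeness; goal 30 is boundedness of the two actions, with
      constant 1.\<close>
    case (16 s)
    then show ?case using annihilator_complete[of s A] by simp
  next
    case 30
    have "onorm (\<lambda>T. f (T o\<^sub>L a)) \<le> 1 * norm a * onorm f" "onorm (\<lambda>T. f (a o\<^sub>L T)) \<le> 1 * norm a * onorm f"
      if "f \<in> annihilator A" for f a
      using onorm_compose_right_le[OF d(1)[OF that], of a] by simp_all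
    then show ?case by blast
  qed (use zero in \<open>auto simp: annihilator_def fun_eq_iff algebra_simps A' b complex_functionals_closed complex_functionalsD
      onorm_pos_le onorm_eq_0 onorm_triangle onorm_cmult complex_functional_scale_right scale_op_compose_left
      bounded_bilinear.add_left[OF bounded_bilinear_blinfun_compose]
      bounded_bilinear.add_right[OF bounded_bilinear_blinfun_compose] blinfun_compose_assoc\<close>)
qed

section \<open>Invariant functionals from approximate amenability\<close>

lemma approximately_amenable_functionals:
  fixes A :: "'a::chilbert oper set"
  assumes A: "cstar_algebra A" "id_blinfun \<in> A" "approximately_amenable A"
    and m: "m \<in> complex_functionals" "m id_blinfun = 1"
    and trace: "\<And>a b. a \<in> A \<Longrightarrow> b \<in> A \<Longrightarrow> m (a o\<^sub>L b) = m (b o\<^sub>L a)"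
  shows "\<exists>F. F \<noteq> bot \<and> (\<forall>\<^sub>F g in F. g \<in> complex_functionals \<and> g id_blinfun = 1)
     \<and> (\<forall>a\<in>A. ((\<lambda>g. onorm (\<lambda>T. g (T o\<^sub>L a) - g (a o\<^sub>L T))) \<longlongrightarrow> 0) F)"
proof -
  let ?add = "\<lambda>(f :: 'a oper \<Rightarrow> complex) g T. f T + g T" and ?smult = "\<lambda>c (f :: 'a oper \<Rightarrow> complex) T. c * f T"
    and ?lact = "\<lambda>a (f :: 'a oper \<Rightarrow> complex) T. f (T o\<^sub>L a)" and ?ract = "\<lambda>(f :: 'a oper \<Rightarrow> complex) a T. f (a o\<^sub>L T)"
  interpret banach_bimodule A "annihilator A" ?add "\<lambda>_. 0" ?smult onorm ?lact ?ract
    by (rule annihilator_bimodule[OF A(1)])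
  note A' = cstar_algebraD[OF A(1)]
  \<comment> \<open>\<open>D\<close> is inner in the bimodule of all
    \<open>complex_functionals\<close>, implemented by \<open>m\<close>. Since \<open>m\<close> is 1
    at the identity, it is not in the annihilator, and approximating it from inside the annihilator
    is a genuine demand.\<close>
  define D where "D a = (\<lambda>T. m (T o\<^sub>L a) - m (a o\<^sub>L T))" for a
  have Dc: "D a \<in> complex_functionals" if "a \<in> A" for a
    unfolding D_def using A'(1) that by (intro complex_functionals_closed m) auto
  have "continuous_derivation D"
    unfolding continuous_derivation_def
  proof (intro conjI ballI allI)
    show "D ` A \<subseteq> annihilator A"
      using Dc trace by (auto simp: annihilator_def) (simp add: D_def)
    fix a b c assume a: "a \<in> A"
    then have ab: "a \<in> bounded_ops" using A'(1) by blast
    show "D (scale_op c a) = ?smult c (D a)"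
      by (simp add: D_def fun_eq_iff complex_functional_scale_right[OF m(1) ab] scale_op_compose_left
          complex_functionalsD(7)[OF m(1)] algebra_simps)
    assume b: "b \<in> A"
    show "D (a + b) = ?add (D a) (D b)"
      by (simp add: D_def fun_eq_iff complex_functionalsD(4)[OF m(1)] bounded_bilinear.add_left[OF bounded_bilinear_blinfun_compose]
         bounded_bilinear.add_right[OF bounded_bilinear_blinfun_compose])
    show "D (a o\<^sub>L b) = ?add (?ract (D a) b) (?lact a (D b))"
      by (simp add: D_def fun_eq_iff blinfun_compose_assoc)
  next
    have "onorm (D a) \<le> (2 * onorm m) * norm a" for a
    proof (rule onorm_bound)
      show "0 \<le> 2 * onorm m * norm a" by (simp add: onorm_pos_le complex_functionalsD(1)[OF m(1)])
      fix T
      have "cmod (D a T) \<le> cmod (m (T o\<^sub>L a)) + cmod (m (a o\<^sub>L T))" unfolding D_def by (rule norm_triangle_ineq4)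
      also have "\<dots> \<le> onorm m * norm (T o\<^sub>L a) + onorm m * norm (a o\<^sub>L T)"
        by (intro add_mono complex_functionalsD[OF m(1)])
      also have "\<dots> \<le> onorm m * (norm T * norm a) + onorm m * (norm a * norm T)"
        by (intro add_mono mult_left_mono norm_blinfun_compose onorm_pos_le complex_functionalsD[OF m(1)])
      finally show "cmod (D a T) \<le> 2 * onorm m * norm a * norm T" by (simp add: algebra_simps)
    qed
    then show "\<exists>K. \<forall>a\<in>A. onorm (D a) \<le> K * norm a" by blast
  qed
  then have "approximately_inner D"
    using A(3) banach_bimodule_axioms unfolding approximately_amenable_def by blast
  then obtain F where F: "F \<noteq> bot" "\<forall>\<^sub>F x in F. x \<in> annihilator A"
    and lim: "\<And>a. a \<in> A \<Longrightarrow> ((\<lambda>x. onorm (?add (D a) (?smult (-1) (?add (?lact a x) (?smult (-1) (?ract x a)))))) \<longlongrightarrow> 0) F"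
    unfolding approximately_inner_def by blast
  \<comment> \<open>If \<open>D a\<close> is close to \<open>a\<cdot>x - x\<cdot>a\<close>, then
    \<open>m - x\<close> nearly commutes with \<open>a\<close>. As \<open>x\<close> vanishes on
    \<open>A\<close>, the value 1 at the identity is kept.\<close>
  define G where "G = filtermap (\<lambda>x T. m T - x T) F"
  show ?thesis
  proof (intro exI[of _ G] conjI ballI)
    show "G \<noteq> bot" using F(1) by (simp add: G_def filtermap_bot_iff)
    show "\<forall>\<^sub>F g in G. g \<in> complex_functionals \<and> g id_blinfun = 1"
      unfolding G_def eventually_filtermap
      by (rule eventually_mono[OF F(2)]) (use m A(2) in \<open>auto simp: annihilator_def intro!: complex_functionals_closed\<close>)
    fix a assume "a \<in> A"
    then show "((\<lambda>g. onorm (\<lambda>T. g (T o\<^sub>L a) - g (a o\<^sub>L T))) \<longlongrightarrow> 0) G"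
      using lim unfolding G_def filterlim_filtermap by (simp add: D_def algebra_simps)
  qed
qed

section \<open>Almost norming contractions\<close>

text \<open>
  If two contractions \<open>T, T'\<close> almost attain the norm of \<open>g\<close>, so does \<open>V = (T + T')/2\<close>; by the parallelogram law
  the column of \<open>V\<close> and \<open>D = (T - T')/2\<close> is a contraction, so adding a multiple of \<open>S \<circ> D\<close> to \<open>V\<close> increases the norm
  only to second order.
\<close>

lemma almost_norming_unique:
  fixes g :: "'a::chilbert oper \<Rightarrow> complex"
  assumes g: "g \<in> complex_functionals"
    and T: "norm T \<le> 1" "(1 - d) * onorm g \<le> Re (g T)"
    and T': "norm T' \<le> 1" "(1 - d) * onorm g \<le> Re (g T')"
    and d: "0 < d"
  shows "cmod (g (S o\<^sub>L T) - g (S o\<^sub>L T')) \<le> 3 * sqrt d * onorm g * norm S"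
proof (cases "S = 0")
  case False
  define V where "V = (1/2) *\<^sub>R (T + T')"
  define D where "D = (1/2) *\<^sub>R (T - T')"
  define N where "N = onorm g"
  define r where "r = sqrt d"
  define w where "w = g (S o\<^sub>L D)"
  \<comment> \<open>The phase that rotates \<open>w\<close> to its modulus; the default 1 for
    \<open>w = 0\<close> keeps \<open>c\<close> of modulus 1.\<close>
  define c where "c = (if w = 0 then 1 else of_real (cmod w) / w)"
  have c: "cmod c = 1" "c * w = of_real (cmod w)" by (auto simp: c_def norm_divide)
  \<comment> \<open>The perturbation has size \<open>r = sqrt d\<close>. It raises the real part of
    \<open>g\<close> by \<open>r * cmod w / norm S\<close>, which is of first order in
    \<open>r\<close>, while the norm of \<open>W\<close> exceeds 1 only by a term of order
    \<open>d = r\<^sup>2\<close>.\<close>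
  define W where "W = V + r *\<^sub>R scale_op (c / of_real (norm S)) (S o\<^sub>L D)"
  have r: "0 < r" "r\<^sup>2 = d" using d by (auto simp: r_def)
  have sqs: "(norm (V x))\<^sup>2 + (norm (D x))\<^sup>2 \<le> (norm x)\<^sup>2" for x
  proof -
    have le: "(norm (R x))\<^sup>2 \<le> (norm x)\<^sup>2" if "norm R \<le> 1" for R :: "'a oper"
      using norm_blinfun[of R x] mult_right_mono[OF that norm_ge_zero[of x]] by (intro power_mono) auto
    have "(norm (V x))\<^sup>2 + (norm (D x))\<^sup>2 = ((norm (T x))\<^sup>2 + (norm (T' x))\<^sup>2) / 2"
      unfolding V_def D_def power2_norm_eq_inner
      by (simp add: blinfun.add_left blinfun.diff_left blinfun.scaleR_left inner_add_left inner_add_right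
          inner_diff_left inner_diff_right inner_commute[of "T' x" "T x"] field_simps)
    also have "\<dots> \<le> (norm x)\<^sup>2"
    proof -
      have "(a + b) / 2 \<le> c" if "a \<le> c" "b \<le> c" for a b c :: real using that by simp
      then show ?thesis using le[OF T(1)] le[OF T'(1)] by blast
    qed
    finally show ?thesis .
  qed
  have "norm W \<le> sqrt (1 + d)"
  proof (rule norm_blinfun_bound)
    fix x
    have "norm (W x) \<le> norm (V x) + r * (norm (S (D x)) / norm S)"
      unfolding W_def
      by (simp add: blinfun.add_left blinfun.scaleR_left scale_op_apply)
         (rule order_trans[OF norm_triangle_ineq], use r c in \<open>simp add: norm_scaleC norm_divide\<close>)
    also have "\<dots> \<le> norm (V x) + r * norm (D x)"
      using r False norm_blinfun[of S "D x"] by (intro add_mono mult_left_mono) (auto simp: divide_le_eq mult.commute)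
    finally have 1: "norm (W x) \<le> norm (V x) + r * norm (D x)" .
    have "(norm (W x))\<^sup>2 \<le> (norm (V x) + r * norm (D x))\<^sup>2" by (rule power_mono[OF 1]) simp
    \<comment> \<open>The Cauchy-Schwarz inequality for the vectors (1, r) and (norm of
      \<open>V x\<close>, norm of \<open>D x\<close>); the defect is the square of
      \<open>r * norm (V x) - norm (D x)\<close>.\<close>
    also have "\<dots> \<le> (1 + d) * ((norm (V x))\<^sup>2 + (norm (D x))\<^sup>2)"
      using zero_le_power2[of "r * norm (V x) - norm (D x)"]
      unfolding r(2)[symmetric] by (simp add: algebra_simps power2_eq_square)
    also have "\<dots> \<le> (1 + d) * (norm x)\<^sup>2" using d sqs by (intro mult_left_mono) auto
    also have "\<dots> = (sqrt (1 + d) * norm x)\<^sup>2" using d by (simp add: power_mult_distrib)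
    finally show "norm (W x) \<le> sqrt (1 + d) * norm x"
      using d by (auto intro: power2_le_imp_le)
  qed (use d in simp)
  also have "sqrt (1 + d) \<le> 1 + d / 2"
    by (rule real_le_lsqrt) (use d in \<open>auto simp: power2_eq_square field_simps\<close>)
  finally have W: "norm W \<le> 1 + d / 2" .
  have N: "0 \<le> N" unfolding N_def by (rule onorm_pos_le[OF complex_functionalsD(1)[OF g]])
  have "g W = g V + of_real (r * cmod w / norm S)"
    using c(2) by (simp add: W_def complex_functionalsD[OF g] w_def[symmetric] mult.assoc[symmetric])
  moreover have "(1 - d) * N \<le> Re (g V)"
    using T(2) T'(2) by (simp add: V_def complex_functionalsD[OF g] N_def)
  ultimately have "(1 - d) * N + r * cmod w / norm S \<le> Re (g W)" by simp
  also have "\<dots> \<le> cmod (g W)" by (rule complex_Re_le_cmod)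
  also have "\<dots> \<le> N * norm W" unfolding N_def by (rule complex_functionalsD[OF g])
  also have "\<dots> \<le> N * (1 + d / 2)" using W N by (rule mult_left_mono)
  \<comment> \<open>Comparing \<open>(1 - d) * N\<close> with \<open>(1 + d / 2) * N\<close> leaves
    \<open>3 / 2 * d * N\<close>. The factor 3 of the statement is twice 3/2, because
    \<open>T - T'\<close> is \<open>2 *\<^sub>R D\<close>.\<close>
  finally have "r * (cmod w / norm S) \<le> r * (3 / 2 * r * N)"
    unfolding r(2)[symmetric] by (simp add: algebra_simps power2_eq_square)
  then have "cmod w / norm S \<le> 3 / 2 * r * N" by (rule mult_left_le_imp_le[OF _ r(1)])
  then have "2 * cmod w \<le> 3 * r * N * norm S" using False by (simp add: divide_le_eq)
  moreover have "g (S o\<^sub>L T) - g (S o\<^sub>L T') = 2 * w"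
  proof -
    have "(S o\<^sub>L T) - (S o\<^sub>L T') = 2 *\<^sub>R (S o\<^sub>L D)"
      by (rule blinfun_eqI) (simp add: D_def blinfun.diff_left blinfun.diff_right blinfun.scaleR_left blinfun.scaleR_right)
    then show ?thesis unfolding w_def
      by (metis complex_functionalsD(5,6)[OF g] of_real_numeral)
  qed
  ultimately show ?thesis by (simp add: norm_mult r_def N_def)
qed (simp add: complex_functionalsD(6)[OF g, of 0, simplified])

text \<open>The definition of the norm supplies \<open>T\<close> up to scaling and a phase. The
  value is rotated onto the real axis so that \<open>g T / onorm g\<close> lies between
  \<open>1 - d\<close> and 1, which puts the later functional within \<open>d\<close> of 1 at the
  identity.\<close>

lemma almost_norming_exists:
  fixes g :: "'a::chilbert oper \<Rightarrow> complex"
  assumes g: "g \<in> complex_functionals" and N: "0 < onorm g" and d: "0 < d" "d \<le> 1"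
  obtains T where "norm T \<le> 1" "(1 - d) * onorm g \<le> Re (g T)" "g T = of_real (Re (g T))"
proof -
  have "\<exists>T. (1 - d) * onorm g * norm T < cmod (g T)"
  proof (rule ccontr)
    assume "\<not> ?thesis"
    then have "cmod (g T) \<le> (1 - d) * onorm g * norm T" for T by (simp add: not_less)
    then have "onorm g \<le> (1 - d) * onorm g" using N d by (intro onorm_bound) auto
    then show False using mult_pos_pos[OF d(1) N] by (simp add: algebra_simps)
  qed
  then obtain T where T: "(1 - d) * onorm g * norm T < cmod (g T)" by blast
  have "T \<noteq> 0"
  proof
    assume "T = 0"
    then show False using T complex_functionalsD(6)[OF g, of 0 T] by simp
  qed
  define c where "c = (if g T = 0 then 1 else of_real (cmod (g T)) / g T)"
  have c: "cmod c = 1" "c * g T = of_real (cmod (g T))" by (auto simp: c_def norm_divide)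
  define T' where "T' = (1 / norm T) *\<^sub>R scale_op c T"
  have gT': "g T' = of_real (cmod (g T) / norm T)"
    using c(2) by (simp add: T'_def complex_functionalsD[OF g] field_simps)
  show ?thesis
  proof (rule that)
    show "norm T' \<le> 1" using c \<open>T \<noteq> 0\<close> by (simp add: T'_def norm_scale_op)
    show "(1 - d) * onorm g \<le> Re (g T')" using T \<open>T \<noteq> 0\<close> by (simp add: gT' field_simps)
    show "g T' = of_real (Re (g T'))" by (simp add: gT')
  qed
qed

text \<open>The defect \<open>\<eta> u\<close> measures how far \<open>g\<close> is from commuting
  with \<open>u\<close>. The estimates for \<open>h\<close> contain no norm of \<open>g\<close>, and
  this is what makes unbounded nets admissible.\<close>

lemma approximately_invariant_contraction:
  fixes g :: "'a::chilbert oper \<Rightarrow> complex"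
  assumes g: "g \<in> complex_functionals" "g id_blinfun = 1" and d: "0 < d" "d \<le> 1"
  defines "\<eta> \<equiv> \<lambda>u. onorm (\<lambda>T. g (T o\<^sub>L u) - g (u o\<^sub>L T))"
  shows "\<exists>h. (\<forall>S S'. h (S + S') = h S + h S') \<and> (\<forall>c S. h (scale_op c S) = c * h S)
    \<and> (\<forall>S. cmod (h S) \<le> norm S) \<and> cmod (h id_blinfun - 1) \<le> d
    \<and> (\<forall>u S. unitary_op u \<longrightarrow> cmod (h (u o\<^sub>L S o\<^sub>L adj u) - h S) \<le> (\<eta> u + 3 * sqrt (d + \<eta> u)) * norm S)"
proof -
  define N where "N = onorm g"
  note gD = complex_functionalsD[OF g(1)]
  have N1: "1 \<le> N"
  proof -
    have "1 \<le> onorm g * norm (id_blinfun :: 'a oper)" using gD(8)[of id_blinfun] g(2) by simp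
    also have "\<dots> \<le> onorm g * 1" by (intro mult_left_mono norm_id_blinfun_le onorm_pos_le gD)
    finally show ?thesis by (simp add: N_def)
  qed
  obtain T where T: "norm T \<le> 1" "(1 - d) * N \<le> Re (g T)" "g T = of_real (Re (g T))"
    using almost_norming_exists[OF g(1) _ d] N1 unfolding N_def by (metis less_le_trans zero_less_one)
  define h where "h S = g (S o\<^sub>L T) / of_real N" for S
  have gb: "cmod (g R) \<le> N * norm R" for R unfolding N_def by (rule gD)
  have "cmod (h S) \<le> norm S" for S
  proof -
    have "norm (S o\<^sub>L T) \<le> norm S"
      using norm_blinfun_compose[of S T] mult_left_mono[OF T(1), of "norm S"] by simp
    then have "cmod (g (S o\<^sub>L T)) \<le> N * norm S"
      using gb[of "S o\<^sub>L T"] mult_left_mono[of _ _ N] N1 by (meson order_trans zero_le_one)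
    then show ?thesis using N1 by (simp add: h_def norm_divide divide_le_eq mult.commute)
  qed
  moreover have "cmod (h id_blinfun - 1) \<le> d"
  proof -
    have "id_blinfun o\<^sub>L T = T" by (rule blinfun_eqI) simp
    then have h1: "h id_blinfun = of_real (Re (g T) / N)" using T(3) by (simp add: h_def)
    have "Re (g T) \<le> cmod (g T)" by (rule complex_Re_le_cmod)
    also have "\<dots> \<le> N * 1" using N1 by (intro order_trans[OF gb] mult_left_mono T) simp
    finally have "Re (g T) / N \<le> 1" using N1 by simp
    moreover have "1 - d \<le> Re (g T) / N" using T(2) N1 by (simp add: le_divide_eq)
    ultimately have "\<bar>Re (g T) / N - 1\<bar> \<le> d" by simp
    moreover have "h id_blinfun - 1 = of_real (Re (g T) / N - 1)" by (simp add: h1)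
    ultimately show ?thesis by (simp only: norm_of_real)
  qed
  moreover have "cmod (h (u o\<^sub>L S o\<^sub>L adj u) - h S) \<le> (\<eta> u + 3 * sqrt (d + \<eta> u)) * norm S"
    if u: "unitary_op u" for u S
  proof -
    note U = unitary_opD[OF u]
    have bl: "bounded_linear (\<lambda>T. g (T o\<^sub>L u) - g (u o\<^sub>L T))"
      by (intro complex_functionalsD(1) complex_functionals_closed g U)
    have e: "cmod (g (R o\<^sub>L u) - g (u o\<^sub>L R)) \<le> \<eta> u * norm R" for R
      unfolding \<eta>_def by (rule onorm[OF bl])
    have e0: "0 \<le> \<eta> u" unfolding \<eta>_def by (rule onorm_pos_le[OF bl])
    \<comment> \<open>Moving \<open>u\<close> to the front changes \<open>g(u* T u)\<close> into
      \<open>g(u u* T) = g T\<close> at the cost of \<open>\<eta> u\<close>, so \<open>T'\<close> is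
      almost norming as well.\<close>
    define T' where "T' = adj u o\<^sub>L T o\<^sub>L u"
    have adjT: "norm (adj u o\<^sub>L T) \<le> 1"
      by (rule order_trans[OF norm_blinfun_compose mult_le_one]) (use U T in auto)
    have T': "norm T' \<le> 1"
      unfolding T'_def by (rule order_trans[OF norm_blinfun_compose mult_le_one]) (use U adjT in auto)
    have uu: "u o\<^sub>L (adj u o\<^sub>L T) = T"
      by (metis U(3) blinfun_compose_assoc blinfun_eqI blinfun_apply_blinfun_compose blinfun_apply_id_blinfun id_apply)
    have "cmod (g T' - g T) \<le> \<eta> u"
      using e[of "adj u o\<^sub>L T"] mult_left_mono[OF adjT e0] by (simp add: T'_def uu)
    then have "Re (g T) - Re (g T') \<le> \<eta> u"
      using complex_Re_le_cmod[of "g T - g T'"] by (simp add: norm_minus_commute)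
    \<comment> \<open>The absolute error \<open>\<eta> u\<close> becomes an error relative to
      \<open>N\<close> because \<open>N\<close> is at least 1.\<close>
    moreover have "\<eta> u \<le> \<eta> u * N" using e0 N1 mult_left_mono[OF N1 e0] by simp
    ultimately have RT': "(1 - (d + \<eta> u)) * N \<le> Re (g T')" using T(2) by (simp add: algebra_simps)
    have RT: "(1 - (d + \<eta> u)) * N \<le> Re (g T)"
      using T(2) mult_nonneg_nonneg[OF e0, of N] N1 by (simp add: algebra_simps)
    have "cmod (g (S o\<^sub>L T) - g (S o\<^sub>L T')) \<le> 3 * sqrt (d + \<eta> u) * N * norm S"
      using almost_norming_unique[OF g(1) T(1) _ T', of "d + \<eta> u" S] RT RT' d e0 by (simp add: N_def)
    \<comment> \<open>Here \<open>S T' = (S u* T) u\<close>, and moving the last \<open>u\<close> to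
      the front gives \<open>u S u* T\<close>.\<close>
    moreover have "cmod (g (S o\<^sub>L T') - g (u o\<^sub>L S o\<^sub>L adj u o\<^sub>L T)) \<le> \<eta> u * N * norm S"
    proof -
      have "norm (S o\<^sub>L (adj u o\<^sub>L T)) \<le> norm S"
        using norm_blinfun_compose[of S "adj u o\<^sub>L T"] mult_left_mono[OF adjT, of "norm S"] by simp
      then have "\<eta> u * norm (S o\<^sub>L (adj u o\<^sub>L T)) \<le> \<eta> u * norm S" using e0 by (rule mult_left_mono)
      also have "\<dots> \<le> \<eta> u * N * norm S" using \<open>\<eta> u \<le> \<eta> u * N\<close> by (rule mult_right_mono) simp
      finally show ?thesis
        using e[of "S o\<^sub>L (adj u o\<^sub>L T)"] by (simp add: T'_def blinfun_compose_assoc)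
    qed
    ultimately have "cmod (g (u o\<^sub>L S o\<^sub>L adj u o\<^sub>L T) - g (S o\<^sub>L T)) \<le> 3 * sqrt (d + \<eta> u) * N * norm S + \<eta> u * N * norm S"
      using norm_triangle_ineq[of "g (S o\<^sub>L T) - g (S o\<^sub>L T')" "g (S o\<^sub>L T') - g (u o\<^sub>L S o\<^sub>L adj u o\<^sub>L T)"]
      by (simp add: norm_minus_commute)
    also have "\<dots> = (\<eta> u + 3 * sqrt (d + \<eta> u)) * norm S * N" by (simp add: algebra_simps)
    finally show ?thesis
      using N1 by (simp add: h_def diff_divide_distrib[symmetric] norm_divide divide_le_eq)
  qed
  moreover have "h (S + S') = h S + h S'" "h (scale_op c S) = c * h S" for S S' c
    by (simp_all add: h_def bounded_bilinear.add_left[OF bounded_bilinear_blinfun_compose] gD scale_op_compose_left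
        add_divide_distrib)
  ultimately show ?thesis by blast
qed

text \<open>Tychonoff's theorem for the product of the discs of radius \<open>B S\<close>.\<close>

lemma pointwise_cluster_point:
  fixes h :: "'i \<Rightarrow> 'b \<Rightarrow> complex"
  assumes F: "F \<noteq> bot" and bound: "\<forall>\<^sub>F i in F. \<forall>S. cmod (h i S) \<le> B S"
  shows "\<exists>m G. G \<noteq> bot \<and> G \<le> F \<and> (\<forall>S. ((\<lambda>i. h i S) \<longlongrightarrow> m S) G)"
proof -
  define K where "K = (\<Pi>\<^sub>E S\<in>UNIV. cball (0::complex) (B S))"
  have "compactin (product_topology (\<lambda>_. euclidean) UNIV) K"
    unfolding K_def by (subst compactin_PiE) (auto simp: compactin_euclidean_iff)
  then have "compact K" by (simp add: euclidean_product_topology)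
  moreover have "eventually (\<lambda>f. f \<in> K) (filtermap h F)"
    unfolding eventually_filtermap by (rule eventually_mono[OF bound]) (auto simp: K_def)
  ultimately obtain m where m: "inf (nhds m) (filtermap h F) \<noteq> bot"
    using F unfolding compact_filter by (metis filtermap_bot_iff)
  \<comment> \<open>This refinement of \<open>F\<close> plays the role of a subnet along which
    \<open>h\<close> converges to the cluster point.\<close>
  define G where "G = inf F (filtercomap h (nhds m))"
  have "G \<noteq> bot"
  proof
    assume "G = bot"
    then have "eventually (\<lambda>_. False) G" by simp
    then obtain P Q where PQ: "eventually P F" "eventually Q (nhds m)" "\<And>i. P i \<Longrightarrow> \<not> Q (h i)"
      unfolding G_def eventually_inf eventually_filtercomap by blast
    then have "eventually (\<lambda>f. \<not> Q f) (filtermap h F)"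
      unfolding eventually_filtermap by (auto elim: eventually_mono)
    then have "eventually (\<lambda>_. False) (inf (nhds m) (filtermap h F))"
      unfolding eventually_inf using PQ(2) by blast
    then show False using m by (simp add: trivial_limit_def)
  qed
  moreover have "((\<lambda>i. h i S) \<longlongrightarrow> m S) G" for S
  proof -
    have "filterlim h (nhds m) G"
      unfolding G_def by (rule filterlim_mono[OF filterlim_filtercomap order_refl inf_le2])
    then show ?thesis
      using continuous_on_tendsto_compose[OF continuous_on_product_coordinates[of S], of h m G] by simp
  qed
  ultimately show ?thesis by (intro exI[of _ m] exI[of _ G]) (auto simp: G_def)
qed

lemma invariant_contraction:
  fixes A :: "'a::chilbert oper set"
  assumes F: "F \<noteq> bot" "\<forall>\<^sub>F g in F. g \<in> complex_functionals \<and> g id_blinfun = 1"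
    and lim: "\<And>a. a \<in> A \<Longrightarrow> ((\<lambda>g. onorm (\<lambda>T. g (T o\<^sub>L a) - g (a o\<^sub>L T))) \<longlongrightarrow> 0) F"
  shows "\<exists>m :: 'a oper \<Rightarrow> complex. (\<forall>S S'. m (S + S') = m S + m S') \<and> (\<forall>c S. m (scale_op c S) = c * m S)
    \<and> (\<forall>S. cmod (m S) \<le> norm S) \<and> m id_blinfun = 1
    \<and> (\<forall>u\<in>A. unitary_op u \<longrightarrow> (\<forall>S. m (u o\<^sub>L S o\<^sub>L adj u) = m S))"
proof -
  define \<eta> where "\<eta> g u = onorm (\<lambda>T. g (T o\<^sub>L u) - g (u o\<^sub>L T))" for g :: "'a oper \<Rightarrow> complex" and u
  define P where "P g n h \<longleftrightarrow> (\<forall>S S'. h (S + S') = h S + h S') \<and> (\<forall>c S. h (scale_op c S) = c * h S)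
    \<and> (\<forall>S. cmod (h S) \<le> norm S) \<and> cmod (h id_blinfun - 1) \<le> inverse (real (Suc n))
    \<and> (\<forall>u S. unitary_op u \<longrightarrow> cmod (h (u o\<^sub>L S o\<^sub>L adj u) - h S)
       \<le> (\<eta> g u + 3 * sqrt (inverse (real (Suc n)) + \<eta> g u)) * norm S)" for g n and h :: "'a oper \<Rightarrow> complex"
  have "\<exists>h. P g n h" if "g \<in> complex_functionals \<and> g id_blinfun = 1" for g n
    unfolding P_def \<eta>_def
    by (rule approximately_invariant_contraction) (use that in \<open>auto simp: inverse_le_1_iff\<close>)
  then have h: "P g n (SOME h. P g n h)" if "g \<in> complex_functionals \<and> g id_blinfun = 1" for g n
    using that by (metis someI_ex)
  define h where "h i = (SOME h. P (fst i) (snd i) h)" for i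
  \<comment> \<open>The product with \<open>sequentially\<close> lets the tolerance
    \<open>1 / (n + 1)\<close> tend to 0 independently of \<open>g\<close>.\<close>
  define F' where "F' = F \<times>\<^sub>F sequentially"
  have F': "F' \<noteq> bot" using F(1) by (simp add: F'_def prod_filter_eq_bot)
  have fst: "filterlim fst F F'" and snd: "filterlim snd sequentially F'"
    unfolding F'_def by (rule filterlim_fst filterlim_snd)+
  have ev: "\<forall>\<^sub>F i in F'. P (fst i) (snd i) (h i)"
    using eventually_compose_filterlim[OF F(2) fst] by (rule eventually_mono) (simp only: h_def h)
  have "\<forall>\<^sub>F i in F'. \<forall>S. cmod (h i S) \<le> norm S" using ev by (rule eventually_mono) (simp add: P_def)
  then obtain m G where G: "G \<noteq> bot" "G \<le> F'" and m: "\<And>S. ((\<lambda>i. h i S) \<longlongrightarrow> m S) G"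
    using pointwise_cluster_point[OF F', of h norm] by blast
  have evG: "\<forall>\<^sub>F i in G. P (fst i) (snd i) (h i)" using ev G(2) by (rule filter_leD[rotated])
  have n0: "((\<lambda>i. inverse (real (Suc (snd i)))) \<longlongrightarrow> 0) G"
    by (rule tendsto_mono[OF G(2)], rule filterlim_compose[OF LIMSEQ_inverse_real_of_nat snd])
  have "m (S + S') = m S + m S'" for S S'
  proof (rule tendsto_unique[OF G(1) m])
    show "((\<lambda>i. h i (S + S')) \<longlongrightarrow> m S + m S') G"
      by (rule Lim_transform_eventually[OF tendsto_add[OF m m]])
         (rule eventually_mono[OF evG], simp add: P_def)
  qed
  moreover have "m (scale_op c S) = c * m S" for c S
  proof (rule tendsto_unique[OF G(1) m])
    show "((\<lambda>i. h i (scale_op c S)) \<longlongrightarrow> c * m S) G"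
      by (rule Lim_transform_eventually[OF tendsto_mult_left[OF m]])
         (rule eventually_mono[OF evG], simp add: P_def)
  qed
  moreover have "cmod (m S) \<le> norm S" for S
    by (rule tendsto_upperbound[OF tendsto_norm[OF m] _ G(1)])
       (rule eventually_mono[OF evG], simp add: P_def)
  moreover have "m id_blinfun = 1"
  proof (rule tendsto_unique[OF G(1) m])
    have "((\<lambda>i. h i id_blinfun - 1) \<longlongrightarrow> 0) G"
      by (rule Lim_null_comparison[OF _ n0]) (rule eventually_mono[OF evG], simp add: P_def)
    then show "((\<lambda>i. h i id_blinfun) \<longlongrightarrow> 1) G" by (rule LIM_zero_cancel)
  qed
  moreover have "m (u o\<^sub>L S o\<^sub>L adj u) = m S" if u: "u \<in> A" "unitary_op u" for u S
  proof -
    have \<eta>0: "((\<lambda>i. \<eta> (fst i) u) \<longlongrightarrow> 0) G"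
      unfolding \<eta>_def by (rule tendsto_mono[OF G(2)], rule filterlim_compose[OF lim[OF u(1)] fst])
    have "((\<lambda>i. (\<eta> (fst i) u + 3 * sqrt (inverse (real (Suc (snd i))) + \<eta> (fst i) u)) * norm S) \<longlongrightarrow>
        (0 + 3 * sqrt (0 + 0)) * norm S) G"
      by (intro tendsto_intros \<eta>0 n0)
    then have "((\<lambda>i. (\<eta> (fst i) u + 3 * sqrt (inverse (real (Suc (snd i))) + \<eta> (fst i) u)) * norm S) \<longlongrightarrow> 0) G"
      by simp
    then have "((\<lambda>i. h i (u o\<^sub>L S o\<^sub>L adj u) - h i S) \<longlongrightarrow> 0) G"
      by (rule Lim_null_comparison[rotated])
         (rule eventually_mono[OF evG], use u(2) in \<open>simp add: P_def\<close>)
    moreover have "((\<lambda>i. h i (u o\<^sub>L S o\<^sub>L adj u) - h i S) \<longlongrightarrow> m (u o\<^sub>L S o\<^sub>L adj u) - m S) G"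
      by (rule tendsto_diff[OF m m])
    ultimately show ?thesis using tendsto_unique[OF G(1)] by fastforce
  qed
  ultimately show ?thesis by blast
qed

section \<open>Extension of normal functionals to all operators\<close>

text \<open>Each term is at most \<open>norm T\<close> times the sum of the two squared norms. The
  estimate uses only boundedness of \<open>T\<close>, so the series is defined on the whole operator
  type and not just on \<open>M\<close>.\<close>

lemma vector_series_bounded_linear:
  fixes \<xi> \<eta> :: "nat \<Rightarrow> 'a::chilbert"
  assumes \<xi>: "summable (\<lambda>n. (norm (\<xi> n))\<^sup>2)" and \<eta>: "summable (\<lambda>n. (norm (\<eta> n))\<^sup>2)"
  shows "summable (\<lambda>n. cinner (blinfun_apply T (\<xi> n)) (\<eta> n))"
    and "bounded_linear (\<lambda>T. \<Sum>n. cinner (blinfun_apply T (\<xi> n)) (\<eta> n))"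
proof -
  let ?b = "\<lambda>n. (norm (\<xi> n))\<^sup>2 + (norm (\<eta> n))\<^sup>2"
  have b: "summable ?b" by (rule summable_add[OF \<xi> \<eta>])
  have le: "cmod (cinner (T (\<xi> n)) (\<eta> n)) \<le> norm T * ?b n" for n and T :: "'a oper"
  proof -
    have "cmod (cinner (T (\<xi> n)) (\<eta> n)) \<le> norm T * norm (\<xi> n) * norm (\<eta> n)"
      by (rule order_trans[OF cinner_bound mult_right_mono[OF norm_blinfun]]) simp
    also have "\<dots> = norm T * (norm (\<xi> n) * norm (\<eta> n))" by simp
    also have "\<dots> \<le> norm T * ?b n"
    proof (rule mult_left_mono)
      show "norm (\<xi> n) * norm (\<eta> n) \<le> ?b n"
        using sum_squares_bound[of "norm (\<xi> n)" "norm (\<eta> n)"]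
          mult_nonneg_nonneg[OF norm_ge_zero[of "\<xi> n"] norm_ge_zero[of "\<eta> n"]] by linarith
    qed simp
    finally show ?thesis .
  qed
  have an: "summable (\<lambda>n. cmod (cinner (T (\<xi> n)) (\<eta> n)))" for T :: "'a oper"
    by (rule summable_comparison_test[OF _ summable_mult[OF b, of "norm T"]]) (use le in auto)
  show s: "summable (\<lambda>n. cinner (blinfun_apply T (\<xi> n)) (\<eta> n))" for T by (rule summable_norm_cancel[OF an])
  show "bounded_linear (\<lambda>T. \<Sum>n. cinner (blinfun_apply T (\<xi> n)) (\<eta> n))"
  proof (rule bounded_linear_intro[where K="\<Sum>n. ?b n"])
    fix S T :: "'a oper" and r
    show "(\<Sum>n. cinner ((S + T) (\<xi> n)) (\<eta> n)) = (\<Sum>n. cinner (S (\<xi> n)) (\<eta> n)) + (\<Sum>n. cinner (T (\<xi> n)) (\<eta> n))"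
      by (simp add: blinfun.add_left cinner_add_left suminf_add[OF s s])
    show "(\<Sum>n. cinner ((r *\<^sub>R T) (\<xi> n)) (\<eta> n)) = r *\<^sub>R (\<Sum>n. cinner (T (\<xi> n)) (\<eta> n))"
      by (simp add: blinfun.scaleR_left cinner_scaleR_left suminf_mult[OF s] scaleR_conv_of_real)
    have "cmod (\<Sum>n. cinner (T (\<xi> n)) (\<eta> n)) \<le> (\<Sum>n. norm T * ?b n)"
      by (rule order_trans[OF summable_norm[OF an] suminf_le[OF le an summable_mult[OF b]]])
    then show "norm (\<Sum>n. cinner (T (\<xi> n)) (\<eta> n)) \<le> norm T * (\<Sum>n. ?b n)"
      by (simp add: suminf_mult[OF b])
  qed
qed

text \<open>Scalars on the left of an operator come out of the inner product. Scalars on its right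
  need not do so if the operator is only real linear, which is why a correction follows.\<close>

lemma normal_functional_bounded_linear:
  fixes M :: "'a::chilbert oper set"
  assumes "normal_functional M f"
  obtains g where "bounded_linear g" "\<And>c T. g (scale_op c T) = c * g T" "\<And>x. x \<in> M \<Longrightarrow> f x = g x"
proof -
  obtain \<xi> \<eta> :: "nat \<Rightarrow> 'a" where s: "summable (\<lambda>n. (norm (\<xi> n))\<^sup>2)" "summable (\<lambda>n. (norm (\<eta> n))\<^sup>2)"
    and f: "\<And>x. x \<in> M \<Longrightarrow> f x = (\<Sum>n. cinner (x (\<xi> n)) (\<eta> n))"
    using assms unfolding normal_functional_def by blast
  show ?thesis
    by (rule that[OF vector_series_bounded_linear(2)[OF s] _ f])
       (simp add: scale_op_apply cinner_scaleC_left suminf_mult[OF vector_series_bounded_linear(1)[OF s]])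
qed

text \<open>Composing with the projection \<open>T \<mapsto> (T - \<i>T\<i>)/2\<close> onto the complex linear part makes the functional homogeneous on both sides.\<close>

lemma normal_functional_extension:
  fixes M :: "'a::chilbert oper set"
  assumes M: "M \<subseteq> bounded_ops" and f: "normal_functional M f"
  obtains m where "m \<in> complex_functionals" "\<And>x. x \<in> M \<Longrightarrow> m x = f x"
proof -
  obtain g where g: "bounded_linear g" "\<And>c T. g (scale_op c T) = c * g T" "\<And>x. x \<in> M \<Longrightarrow> f x = g x"
    by (rule normal_functional_bounded_linear[OF f]) blast
  define P where "P T = (1/2) *\<^sub>R (T - (imag_unit o\<^sub>L (T o\<^sub>L imag_unit)))" for T :: "'a oper"
  have blP: "bounded_linear P"
    unfolding P_def
    by (intro bounded_linear_compose[OF bounded_linear_scaleR_right] bounded_linear_sub bounded_linear_ident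
        bounded_linear_compose[OF bounded_linear_compose_left] bounded_linear_compose_right)
  have ii: "\<i> *\<^sub>C \<i> *\<^sub>C x = - x" for x :: 'a
    using scaleC_of_real[of "-1" x] by (simp add: scaleC_scaleC)
  have P1: "P (imag_unit o\<^sub>L T) = scale_op \<i> (P T)" and P2: "P (T o\<^sub>L imag_unit) = scale_op \<i> (P T)" for T
    by (rule blinfun_eqI, simp add: P_def imag_unit_apply scale_op_apply blinfun.diff_left blinfun.scaleR_left ii
        scaleC_diff_right linear_scale[OF linear_scaleC] blinfun.minus_right algebra_simps)+
  have "P T = T" if "T \<in> bounded_ops" for T
    by (rule blinfun_eqI) (simp add: P_def imag_unit_apply blinfun.diff_left blinfun.scaleR_left bounded_opsD[OF that] ii
        scaleR_2[symmetric])
  then have "g (P x) = f x" if "x \<in> M" for x using that M g(3) by auto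
  moreover have "(\<lambda>T. g (P T)) \<in> complex_functionals"
    unfolding complex_functionals_def using bounded_linear_compose[OF g(1) blP] by (simp add: P1 P2 g(2))
  ultimately show ?thesis using that by blast
qed

section \<open>A conjugation, and the degenerate case of generated algebras\<close>

lemma onb_eqI: "(\<And>e. e \<in> onb \<Longrightarrow> cinner x e = cinner y e) \<Longrightarrow> x = y" for x y :: "'a::chilbert"
  using onb_maximal[of "x - y"] by (simp add: cinner_diff_left)

text \<open>\<open>C\<close> conjugates the coordinates with respect to \<open>onb\<close>, and
  \<open>B x y\<close> is the form of which \<open>C\<close> is the Riesz operator.\<close>

lemma conjugation_exists:
  "\<exists>C :: 'a::chilbert oper. C o\<^sub>L C = id_blinfun \<and> C o\<^sub>L imag_unit = - (imag_unit o\<^sub>L C)"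
proof -
  define B where "B x y = (\<Sum>\<^sub>\<infinity>e\<in>onb. cinner e x * cinner e y)" for x y :: 'a
  \<comment> \<open>The Cauchy-Schwarz inequality for finite sums and Bessel's inequality; this
    gives both summability and the bound of the form by 1.\<close>
  have fin: "(\<Sum>e\<in>F. cmod (cinner e x * cinner e y)) \<le> norm x * norm y" if F: "finite F" "F \<subseteq> onb" for F and x y :: 'a
  proof -
    have sw: "cmod (cinner e z) = cmod (cinner z e)" for e z :: 'a
      by (subst cinner_commute) simp
    have "(\<Sum>e\<in>F. cmod (cinner e x * cinner e y)) = (\<Sum>e\<in>F. \<bar>cmod (cinner x e)\<bar> * \<bar>cmod (cinner y e)\<bar>)"
      by (simp add: norm_mult sw)
    also have "\<dots> \<le> L2_set (\<lambda>e. cmod (cinner x e)) F * L2_set (\<lambda>e. cmod (cinner y e)) F"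
      by (rule L2_set_mult_ineq)
    also have "\<dots> \<le> norm x * norm y"
      unfolding L2_set_def using bessel[OF F]
      by (intro mult_mono real_le_lsqrt[OF norm_ge_zero] real_sqrt_ge_zero sum_nonneg) (auto intro!: real_le_lsqrt sum_nonneg)
    finally show ?thesis .
  qed
  have as: "(\<lambda>e. cmod (cinner e x * cinner e y)) summable_on onb" for x y :: 'a
    by (rule nonneg_bdd_above_summable_on) (auto simp: bdd_above_def intro!: exI[of _ "norm x * norm y"] fin)
  have s: "(\<lambda>e. cinner e x * cinner e y) summable_on onb" for x y :: 'a
    by (rule abs_summable_summable[OF as])
  have "\<exists>C :: 'a oper. (\<forall>x y. cinner (blinfun_apply C x) y = B x y) \<and> norm C \<le> max 1 0"
  proof (rule sesquilinear_operator)
    fix x x' y y' :: 'a and r c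
    show "B (x + x') y = B x y + B x' y" "B x (y + y') = B x y + B x y'"
      by (simp_all add: B_def cinner_add_right algebra_simps infsum_add[OF s s])
    show "B x (c *\<^sub>C y) = cnj c * B x y" "B (r *\<^sub>R x) y = of_real r * B x y"
      by (simp_all add: B_def cinner_scaleC_right cinner_scaleR_right infsum_cmult_right'[symmetric] mult_ac)
    have "cmod (B x y) \<le> (\<Sum>\<^sub>\<infinity>e\<in>onb. cmod (cinner e x * cinner e y))"
      unfolding B_def by (rule norm_infsum_bound[OF as])
    also have "\<dots> \<le> norm x * norm y" by (rule infsum_le_finite_sums[OF as fin])
    finally show "cmod (B x y) \<le> 1 * norm x * norm y" by simp
  qed
  then obtain C :: "'a oper" where C: "\<And>x y. cinner (C x) y = B x y" by blast
  have Ce: "cinner (C x) f = cinner f x" if f: "f \<in> onb" for x f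
  proof -
    have "((\<lambda>e. cinner e x * cinner e f) has_sum cinner f x) onb"
      by (rule has_sum_finite_neutralI[where B="{f}"]) (use f in \<open>auto simp: onb_cinner\<close>)
    then show ?thesis unfolding C B_def by (rule infsumI)
  qed
  have "C o\<^sub>L C = id_blinfun"
  proof (rule blinfun_eqI, rule onb_eqI)
    fix x e :: 'a assume e: "e \<in> onb"
    have "cinner (C (C x)) e = cinner x e"
      unfolding Ce[OF e] by (rule cinner_swap[OF Ce[OF e]])
    then show "cinner ((C o\<^sub>L C) x) e = cinner (id_blinfun x) e" by simp
  qed
  moreover have "C o\<^sub>L imag_unit = - (imag_unit o\<^sub>L C)"
    by (rule blinfun_eqI, rule onb_eqI)
       (simp add: blinfun.minus_left imag_unit_apply Ce cinner_scaleC_right cinner_scaleC_left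
         linear_neg[OF linear_cinner_left])
  ultimately show ?thesis by blast
qed

text \<open>
  If no C*-algebra contains \<open>S\<close>, both \<open>cstar_generated S\<close> and \<open>vn_generated S\<close> are the junk value \<^term>\<open>UNIV\<close>.
  Multiplication by \<open>\<i>\<close> then anticommutes with a conjugation, so a trace kills it, although \<open>\<tau>(\<i>) = \<i>\<close>.
\<close>

lemma no_tracial_state_UNIV: "\<not> normal_tracial_state (UNIV :: 'a::chilbert oper set) \<tau>"
proof
  assume t: "normal_tracial_state (UNIV :: 'a oper set) \<tau>"
  then have trace: "\<tau> (S o\<^sub>L T) = \<tau> (T o\<^sub>L S)" and scale: "\<tau> (scale_op c T) = c * \<tau> T" and one: "\<tau> id_blinfun = 1"
    for S T :: "'a oper" and c
    unfolding normal_tracial_state_def state_def positive_functional_def bounded_functional_def by blast+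
  obtain C :: "'a oper" where C: "C o\<^sub>L C = id_blinfun" "C o\<^sub>L imag_unit = - (imag_unit o\<^sub>L C)"
    using conjugation_exists by blast
  have id: "T o\<^sub>L id_blinfun = T" for T :: "'a oper" by (rule blinfun_eqI) simp
  have neg: "- T o\<^sub>L C = scale_op (-1) (T o\<^sub>L C)" for T
    by (rule blinfun_eqI) (simp add: blinfun.minus_left)
  have "\<tau> imag_unit = \<tau> ((imag_unit o\<^sub>L C) o\<^sub>L C)" by (simp add: blinfun_compose_assoc C(1) id)
  also have "\<dots> = \<tau> ((C o\<^sub>L imag_unit) o\<^sub>L C)" using trace[of "imag_unit o\<^sub>L C" C] by (simp add: blinfun_compose_assoc)
  also have "\<dots> = - \<tau> ((imag_unit o\<^sub>L C) o\<^sub>L C)" unfolding C(2) neg scale by simp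
  also have "\<dots> = - \<tau> imag_unit" by (simp add: blinfun_compose_assoc C(1) id)
  finally have "\<tau> imag_unit = 0" by simp
  then show False using scale[of \<i> id_blinfun] one by (simp add: imag_unit_def)
qed

text \<open>The unitary \<open>u\<close> brings the identity into the C*-algebra through
  \<open>adj u o\<^sub>L u\<close>, and the trace excludes the degenerate value \<open>UNIV\<close>.
  After that the normal extension of \<tau> serves as the starting functional.\<close>

lemma tracial_amenable_contraction:
  fixes S :: "'a::chilbert oper set"
  assumes tau: "normal_tracial_state (vn_generated S) \<tau>"
    and am: "approximately_amenable (cstar_generated S)"
    and u: "u \<in> cstar_generated S" "unitary_op u"
  shows "\<exists>m :: 'a oper \<Rightarrow> complex. (\<forall>R T. m (R + T) = m R + m T) \<and> (\<forall>c T. m (scale_op c T) = c * m T)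
    \<and> (\<forall>T. cmod (m T) \<le> norm T) \<and> m id_blinfun = 1
    \<and> (\<forall>u\<in>cstar_generated S. unitary_op u \<longrightarrow> (\<forall>T. m (u o\<^sub>L T o\<^sub>L adj u) = m T))"
proof -
  let ?A = "cstar_generated S" and ?N = "vn_generated S"
  have AN: "?A \<subseteq> ?N" by (rule cstar_generated_subset_vn_generated)
  have "\<exists>A. cstar_algebra A \<and> S \<subseteq> A"
  proof (rule ccontr)
    assume "\<not> ?thesis"
    then have "?A = UNIV" by (auto simp: cstar_generated_def)
    then have "?N = UNIV" using AN by blast
    then show False using tau no_tracial_state_UNIV by metis
  qed
  then have A: "cstar_algebra ?A" by (rule cstar_generated_cstar)
  note A' = cstar_algebraD[OF A]
  have id: "id_blinfun \<in> ?A"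
    using A'(6)[OF A'(7)[OF u(1)] u(1)] unitary_opD(2)[OF u(2)] by simp
  have "normal_functional ?A \<tau>"
    using tau AN unfolding normal_tracial_state_def normal_functional_def by (meson subsetD)
  then obtain m where m: "m \<in> complex_functionals" "\<And>x. x \<in> ?A \<Longrightarrow> m x = \<tau> x"
    by (rule normal_functional_extension[OF A'(1)]) blast
  have "m (a o\<^sub>L b) = m (b o\<^sub>L a)" if "a \<in> ?A" "b \<in> ?A" for a b
    using that m(2) A'(6) tau AN unfolding normal_tracial_state_def by (metis subsetD)
  moreover have "m id_blinfun = 1" using m(2)[OF id] tau by (simp add: normal_tracial_state_def state_def)
  ultimately obtain F where "F \<noteq> bot" "\<forall>\<^sub>F g in F. g \<in> complex_functionals \<and> g id_blinfun = 1"
    "\<And>a. a \<in> ?A \<Longrightarrow> ((\<lambda>g. onorm (\<lambda>T. g (T o\<^sub>L a) - g (a o\<^sub>L T))) \<longlongrightarrow> 0) F"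
    using approximately_amenable_functionals[OF A id am m(1)] by blast
  then show ?thesis by (rule invariant_contraction)
qed

section \<open>Tensor products and slice maps\<close>

lemma le_zero_of_small_multiples:
  fixes x c :: real
  assumes le: "\<And>\<epsilon>. 0 < \<epsilon> \<Longrightarrow> x \<le> \<epsilon> * c" and c: "0 \<le> c"
  shows "x \<le> 0"
proof (rule ccontr)
  assume x: "\<not> x \<le> 0"
  have "x \<le> x / (2 * (c + 1)) * c" using x c by (intro le) simp
  then have "x * (c + 2) \<le> 0" using c by (simp add: field_simps)
  then show False using x c by (simp add: mult_le_0_iff)
qed

lemma tens_cinner_eqI:
  assumes "\<And>x y. cinner v (x \<otimes>\<^sub>h y) = cinner w (x \<otimes>\<^sub>h y)"
  shows "v = w"
proof -
  define z where "z = v - w"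
  have z: "cinner z (x \<otimes>\<^sub>h y) = 0" for x y using assms by (simp add: z_def cinner_diff_left)
  have "cspan {x \<otimes>\<^sub>h y |x y. True} \<subseteq> {u. cinner z u = 0}"
    by (auto simp: cspan_def cinner_sum_right cinner_scaleC_right subset_iff z intro!: sum.neutral) (metis z)
  moreover have "closed {u. cinner z u = 0}"
    by (intro closed_Collect_eq linear_continuous_on bounded_linear_cinner_right continuous_on_const)
  ultimately have "closure (cspan {x \<otimes>\<^sub>h y |x y. True}) \<subseteq> {u. cinner z u = 0}" by (rule closure_minimal)
  then have "cinner z z = 0" using tens_total by blast
  then show ?thesis by (simp add: z_def cinner_self)
qed

text \<open>Taking adjoints moves the elementary tensor into the second argument of the inner
  product, where totality applies.\<close>

lemma tens_operator_eqI:
  fixes R S :: "('a::chilbert, 'b::chilbert) htensor oper"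
  assumes "R \<in> bounded_ops" "S \<in> bounded_ops" "\<And>x y. R (x \<otimes>\<^sub>h y) = S (x \<otimes>\<^sub>h y)"
  shows "R = S"
proof (rule blinfun_cinner_eqI, rule arg_cong[where f="\<lambda>u. cinner u _"])
  fix v
  have "adj R w = adj S w" for w
  proof (rule tens_cinner_eqI)
    show "cinner (adj R w) (x \<otimes>\<^sub>h y) = cinner (adj S w) (x \<otimes>\<^sub>h y)" for x y
      by (simp add: cinner_adj_left assms)
  qed
  then have "cinner (R v) w = cinner (S v) w" for w
    by (metis assms(1,2) cinner_adj_right)
  then show "R v = S v" by (rule cinner_eqI)
qed

text \<open>The realisation of the tensor product treats its factors differently, so operators on
  the second factor are reached by exchanging the factors.\<close>

lemma flip_exists:
  "\<exists>\<Phi> :: ('a::chilbert, 'b::chilbert) htensor \<Rightarrow>\<^sub>L ('b, 'a) htensor.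
     (\<forall>x y. blinfun_apply \<Phi> (x \<otimes>\<^sub>h y) = y \<otimes>\<^sub>h x) \<and> (\<forall>c v. blinfun_apply \<Phi> (c *\<^sub>C v) = c *\<^sub>C blinfun_apply \<Phi> v)"
proof -
  \<comment> \<open>With \<open>w\<close> expanded as the sum of
    \<open>Rep_htensor w e \<otimes>\<^sub>h e\<close>, the form \<open>B v w\<close> is the inner
    product of \<open>v\<close> with the flipped \<open>w\<close>.\<close>
  let ?t = "\<lambda>(v :: ('a, 'b) htensor) (w :: ('b, 'a) htensor) e. cinner v (e \<otimes>\<^sub>h Rep_htensor w e)"
  define B where "B v w = (\<Sum>\<^sub>\<infinity>e\<in>onb. ?t v w e)" for v w
  have fin: "(\<Sum>e\<in>F. cmod (?t v w e)) \<le> norm v * norm w" if F: "finite F" "F \<subseteq> onb" for F v w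
  proof -
    \<comment> \<open>The phases collect the sum of absolute values into a single inner product with
      \<open>z\<close>. The summands of \<open>z\<close> are orthogonal, so its norm is at most that
      of \<open>w\<close>.\<close>
    define c where "c e = (if ?t v w e = 0 then 1 else of_real (cmod (?t v w e)) / ?t v w e)" for e
    have c: "cmod (c e) = 1" "c e * ?t v w e = of_real (cmod (?t v w e))" for e by (auto simp: c_def norm_divide)
    define z where "z = (\<Sum>e\<in>F. cnj (c e) *\<^sub>C (e \<otimes>\<^sub>h Rep_htensor w e))"
    have ez: "cinner (e \<otimes>\<^sub>h Rep_htensor w e) z = c e * of_real ((norm (Rep_htensor w e))\<^sup>2)" if e: "e \<in> F" for e
    proof -
      have "cinner (e \<otimes>\<^sub>h Rep_htensor w e) z
          = (\<Sum>f\<in>F. if f = e then c e * of_real ((norm (Rep_htensor w e))\<^sup>2) else 0)"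
        unfolding z_def cinner_sum_right using e F(2)
        by (intro sum.cong refl) (auto simp: cinner_scaleC_right cinner_tens onb_cinner cinner_self subset_iff)
      then show ?thesis using e F(1) by simp
    qed
    have cc: "cnj (c e) * c e = 1" for e
      using complex_norm_square[of "c e"] c(1)[of e] by (simp add: mult.commute)
    have "cinner z z = (\<Sum>e\<in>F. cnj (c e) * cinner (e \<otimes>\<^sub>h Rep_htensor w e) z)"
      by (subst (1) z_def) (simp add: cinner_sum_left cinner_scaleC_left)
    also have "\<dots> = (\<Sum>e\<in>F. of_real ((norm (Rep_htensor w e))\<^sup>2))"
      by (intro sum.cong refl) (simp add: ez cc mult.assoc[symmetric])
    also have "\<dots> = of_real (\<Sum>e\<in>F. (norm (Rep_htensor w e))\<^sup>2)" by simp
    finally have "(norm z)\<^sup>2 = (\<Sum>e\<in>F. (norm (Rep_htensor w e))\<^sup>2)" unfolding cinner_self of_real_eq_iff .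
    then have "(norm z)\<^sup>2 \<le> (norm w)\<^sup>2" using htensor_finite_sum_le[OF F] by metis
    then have z: "norm z \<le> norm w" by (rule power2_le_imp_le) simp
    have vz: "cinner v z = of_real (\<Sum>e\<in>F. cmod (?t v w e))"
      by (simp add: z_def cinner_sum_right cinner_scaleC_right c(2))
    have "(\<Sum>e\<in>F. cmod (?t v w e)) = cmod (cinner v z)"
      unfolding vz norm_of_real by (simp add: sum_nonneg)
    also have "\<dots> \<le> norm v * norm w"
      by (rule order_trans[OF cinner_bound mult_left_mono[OF z]]) simp
    finally show ?thesis .
  qed
  have as: "(\<lambda>e. cmod (?t v w e)) summable_on onb" for v w
    by (rule nonneg_bdd_above_summable_on) (auto simp: bdd_above_def intro!: exI[of _ "norm v * norm w"] fin)
  have s: "(?t v w) summable_on onb" for v w by (rule abs_summable_summable[OF as])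
  have "\<exists>\<Phi> :: ('a, 'b) htensor \<Rightarrow>\<^sub>L ('b, 'a) htensor. (\<forall>v w. cinner (blinfun_apply \<Phi> v) w = B v w) \<and> norm \<Phi> \<le> max 1 0"
  proof (rule sesquilinear_operator)
    fix v v' :: "('a, 'b) htensor" and w w' :: "('b, 'a) htensor" and r c
    show "B (v + v') w = B v w + B v' w"
      by (simp add: B_def cinner_add_left infsum_add[OF s s])
    show "B v (w + w') = B v w + B v w'"
      by (simp add: B_def plus_htensor.rep_eq tens_add_right cinner_add_right infsum_add[OF s s])
    show "B v (c *\<^sub>C w) = cnj c * B v w" "B (r *\<^sub>R v) w = of_real r * B v w"
      by (simp_all add: B_def scaleC_htensor.rep_eq tens_scaleC_right cinner_scaleC_right cinner_scaleR_left
          infsum_cmult_right')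
    have "cmod (B v w) \<le> (\<Sum>\<^sub>\<infinity>e\<in>onb. cmod (?t v w e))"
      unfolding B_def by (rule norm_infsum_bound[OF as])
    also have "\<dots> \<le> norm v * norm w" by (rule infsum_le_finite_sums[OF as fin])
    finally show "cmod (B v w) \<le> 1 * norm v * norm w" by simp
  qed
  then obtain \<Phi> :: "('a, 'b) htensor \<Rightarrow>\<^sub>L ('b, 'a) htensor" where \<Phi>: "\<And>v w. cinner (\<Phi> v) w = B v w" by blast
  have "\<Phi> (c *\<^sub>C v) = c *\<^sub>C \<Phi> v" for c v
    by (rule cinner_eqI) (simp add: \<Phi> B_def cinner_scaleC_left infsum_cmult_right')
  moreover have "\<Phi> (x \<otimes>\<^sub>h y) = y \<otimes>\<^sub>h x" for x y
  proof (rule tens_cinner_eqI)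
    fix y' x'
    have "((\<lambda>e. cinner y y' * (cinner x e * cinner e x')) has_sum cinner y y' * cinner x x') onb"
      by (rule has_sum_cmult_right[OF parseval])
    then have "((\<lambda>e. cinner (x \<otimes>\<^sub>h y) (e \<otimes>\<^sub>h Rep_htensor (y' \<otimes>\<^sub>h x') e)) has_sum cinner y y' * cinner x x') onb"
      by (rule has_sum_cong[THEN iffD1, rotated])
         (simp add: cinner_tens tens.rep_eq cinner_scaleC_right cinner_commute[of _ x'] mult_ac)
    then show "cinner (\<Phi> (x \<otimes>\<^sub>h y)) (y' \<otimes>\<^sub>h x') = cinner (y \<otimes>\<^sub>h x) (y' \<otimes>\<^sub>h x')"
      unfolding \<Phi> B_def cinner_tens by (rule infsumI)
  qed
  ultimately show ?thesis by blast
qed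

text \<open>An element of the tensor product is a family in the first factor, and \<open>S\<close>
  is applied to each of its members.\<close>

lemma amplification_exists:
  fixes S :: "'a::chilbert oper"
  assumes S: "S \<in> bounded_ops"
  shows "\<exists>R \<in> bounded_ops. \<forall>x (y::'b::chilbert). blinfun_apply R (x \<otimes>\<^sub>h y) = S x \<otimes>\<^sub>h y"
proof -
  define A where "A v = Abs_htensor (\<lambda>e. S (Rep_htensor v e))" for v :: "('a, 'b) htensor"
  have le: "(norm (S z))\<^sup>2 \<le> (norm S)\<^sup>2 * (norm z)\<^sup>2" for z
    using power_mono[OF norm_blinfun[of S z], of 2] by (simp add: power_mult_distrib)
  have "(\<lambda>e. (norm (S (Rep_htensor v e)))\<^sup>2) summable_on onb" for v :: "('a, 'b) htensor"
    by (rule summable_on_comparison_test[OF summable_on_cmult_right[OF htensor_summable[of v], of "(norm S)\<^sup>2"]])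
       (use le in auto)
  then have RA: "Rep_htensor (A v) = (\<lambda>e. S (Rep_htensor v e))" for v
    unfolding A_def using Rep_htensor[of v] by (intro Abs_htensor_inverse) (auto simp: blinfun.zero_right)
  have "(norm (A v))\<^sup>2 \<le> (norm S * norm v)\<^sup>2" for v
    unfolding power_mult_distrib htensor_norm_sq
    by (subst infsum_cmult_right'[symmetric], rule infsum_mono[OF htensor_summable summable_on_cmult_right[OF htensor_summable]])
       (simp add: RA le)
  then have "norm (A v) \<le> norm S * norm v" for v by (rule power2_le_imp_le) simp
  then have bl: "bounded_linear A"
    by (intro bounded_linear_intro[where K="norm S"])
       (simp_all add: Rep_htensor_inject[symmetric] RA plus_htensor.rep_eq scaleR_htensor.rep_eq blinfun.add_right
         blinfun.scaleR_right mult.commute)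
  show ?thesis
  proof (intro bexI[of _ "Blinfun A"] allI)
    show "Blinfun A \<in> bounded_ops"
      by (simp add: bounded_ops_def bounded_linear_Blinfun_apply[OF bl] Rep_htensor_inject[symmetric] RA
          scaleC_htensor.rep_eq bounded_opsD[OF S])
    show "Blinfun A (x \<otimes>\<^sub>h y) = S x \<otimes>\<^sub>h y" for x y
      by (auto simp: bounded_linear_Blinfun_apply[OF bl] Rep_htensor_inject[symmetric] RA tens.rep_eq
          bounded_opsD[OF S] blinfun.zero_right)
  qed
qed

lemma
  fixes S :: "'a::chilbert oper" and T :: "'b::chilbert oper"
  assumes S: "S \<in> bounded_ops" and T: "T \<in> bounded_ops"
  shows op_tens_bounded: "S \<otimes>\<^sub>o T \<in> bounded_ops"
    and op_tens_apply: "(S \<otimes>\<^sub>o T) (x \<otimes>\<^sub>h y) = S x \<otimes>\<^sub>h T y"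
proof -
  obtain R1 :: "('a, 'b) htensor oper" where R1: "R1 \<in> bounded_ops" "\<And>x y. R1 (x \<otimes>\<^sub>h y) = S x \<otimes>\<^sub>h y"
    using amplification_exists[OF S] by blast
  obtain R2 :: "('b, 'a) htensor oper" where R2: "R2 \<in> bounded_ops" "\<And>y x. R2 (y \<otimes>\<^sub>h x) = T y \<otimes>\<^sub>h x"
    using amplification_exists[OF T] by blast
  obtain \<Phi> :: "('a, 'b) htensor \<Rightarrow>\<^sub>L ('b, 'a) htensor"
    where \<Phi>: "\<And>x y. \<Phi> (x \<otimes>\<^sub>h y) = y \<otimes>\<^sub>h x" "\<And>c v. \<Phi> (c *\<^sub>C v) = c *\<^sub>C \<Phi> v" using flip_exists by blast
  obtain \<Psi> :: "('b, 'a) htensor \<Rightarrow>\<^sub>L ('a, 'b) htensor"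
    where \<Psi>: "\<And>x y. \<Psi> (x \<otimes>\<^sub>h y) = y \<otimes>\<^sub>h x" "\<And>c v. \<Psi> (c *\<^sub>C v) = c *\<^sub>C \<Psi> v" using flip_exists by blast
  \<comment> \<open>The amplification of \<open>T\<close> to the second factor is its amplification
    to the first, placed between two flips.\<close>
  define R where "R = R1 o\<^sub>L (\<Psi> o\<^sub>L (R2 o\<^sub>L \<Phi>))"
  have R: "R \<in> bounded_ops" "\<And>x y. R (x \<otimes>\<^sub>h y) = S x \<otimes>\<^sub>h T y"
    by (auto simp: R_def bounded_ops_def \<Phi> \<Psi> R1(2) R2(2) bounded_opsD[OF R1(1)] bounded_opsD[OF R2(1)])
  then have "\<exists>!R. R \<in> bounded_ops \<and> (\<forall>x y. R (x \<otimes>\<^sub>h y) = S x \<otimes>\<^sub>h T y)"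
    by (intro ex1I[of _ R]) (auto intro: tens_operator_eqI)
  from theI'[OF this] show "S \<otimes>\<^sub>o T \<in> bounded_ops" "(S \<otimes>\<^sub>o T) (x \<otimes>\<^sub>h y) = S x \<otimes>\<^sub>h T y"
    unfolding op_tens_def by auto
qed

lemma op_tens_adj:
  fixes S :: "'a::chilbert oper" and T :: "'b::chilbert oper"
  assumes S: "S \<in> bounded_ops" and T: "T \<in> bounded_ops"
  shows "adj (S \<otimes>\<^sub>o T) = adj S \<otimes>\<^sub>o adj T"
proof (rule tens_operator_eqI)
  note a = adj_bounded[OF S] adj_bounded[OF T]
  show "adj (S \<otimes>\<^sub>o T) \<in> bounded_ops" "adj S \<otimes>\<^sub>o adj T \<in> bounded_ops"
    by (simp_all add: adj_bounded op_tens_bounded S T a)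
  fix x y
  show "adj (S \<otimes>\<^sub>o T) (x \<otimes>\<^sub>h y) = (adj S \<otimes>\<^sub>o adj T) (x \<otimes>\<^sub>h y)"
    by (rule tens_cinner_eqI)
       (simp add: cinner_adj_left op_tens_bounded op_tens_apply S T a cinner_tens)
qed

lemma op_tens_commute:
  fixes S S' :: "'a::chilbert oper" and T T' :: "'b::chilbert oper"
  assumes "S \<in> bounded_ops" "T \<in> bounded_ops" "S' \<in> bounded_ops" "T' \<in> bounded_ops"
    "S o\<^sub>L S' = S' o\<^sub>L S" "T o\<^sub>L T' = T' o\<^sub>L T"
  shows "(S \<otimes>\<^sub>o T) o\<^sub>L (S' \<otimes>\<^sub>o T') = (S' \<otimes>\<^sub>o T') o\<^sub>L (S \<otimes>\<^sub>o T)"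
proof (rule tens_operator_eqI)
  have "S (S' x) = S' (S x)" "T (T' y) = T' (T y)" for x y
    using assms(5,6) by (metis blinfun_apply_blinfun_compose)+
  then show "((S \<otimes>\<^sub>o T) o\<^sub>L (S' \<otimes>\<^sub>o T')) (x \<otimes>\<^sub>h y) = ((S' \<otimes>\<^sub>o T') o\<^sub>L (S \<otimes>\<^sub>o T)) (x \<otimes>\<^sub>h y)" for x y
    using assms by (simp add: op_tens_apply)
qed (simp_all add: assms op_tens_bounded bounded_ops_closed)

lemma vn_tensor_bounded: "M \<otimes>\<^sub>v N \<subseteq> bounded_ops" if "M \<subseteq> bounded_ops" "N \<subseteq> bounded_ops"
proof -
  \<comment> \<open>\<open>commutant {}\<close> is \<open>bounded_ops\<close>, written so that it is
    visibly a von Neumann algebra.\<close>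
  have "M \<otimes>\<^sub>v N \<subseteq> commutant {}"
    unfolding vn_tensor_def
    by (intro vn_generated_least von_neumann_commutant) (use that in \<open>auto intro!: commutantI op_tens_bounded\<close>)
  then show ?thesis using commutant_subset_bounded by blast
qed

text \<open>The elementary half of the commutation theorem for tensor products: the relation holds
  for the generators, and the commutant of the set \<open>?S\<close> is a von Neumann algebra. This
  half is enough to locate slices in \<open>M\<close>.\<close>

lemma vn_tensor_commute:
  assumes M: "M \<subseteq> bounded_ops" "N \<subseteq> bounded_ops" "\<And>x. x \<in> M \<Longrightarrow> adj x \<in> M" "\<And>x. x \<in> N \<Longrightarrow> adj x \<in> N"
    and x: "x \<in> commutant M" and y: "y \<in> commutant N" and T: "T \<in> M \<otimes>\<^sub>v N"
  shows "T o\<^sub>L (x \<otimes>\<^sub>o y) = (x \<otimes>\<^sub>o y) o\<^sub>L T"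
proof -
  let ?S = "{x \<otimes>\<^sub>o y |x y. x \<in> commutant M \<and> y \<in> commutant N}"
  have b: "x \<in> bounded_ops" if "x \<in> commutant M" for x using that commutant_subset_bounded by blast
  have b': "x \<in> bounded_ops" if "x \<in> commutant N" for x using that commutant_subset_bounded by blast
  have "M \<otimes>\<^sub>v N \<subseteq> commutant ?S"
    unfolding vn_tensor_def
  proof (intro vn_generated_least von_neumann_commutant)
    show "?S \<subseteq> bounded_ops" using b b' by (auto intro!: op_tens_bounded)
    show "adj R \<in> ?S" if RS: "R \<in> ?S" for R
    proof -
      obtain x y where R: "R = x \<otimes>\<^sub>o y" and xy: "x \<in> commutant M" "y \<in> commutant N" using RS by blast
      have "adj R = adj x \<otimes>\<^sub>o adj y" unfolding R by (rule op_tens_adj[OF b[OF xy(1)] b'[OF xy(2)]])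
      then show ?thesis using commutant_adj[OF M(1,3) xy(1)] commutant_adj[OF M(2,4) xy(2)] by blast
    qed
    show "{x \<otimes>\<^sub>o y |x y. x \<in> M \<and> y \<in> N} \<subseteq> commutant ?S"
    proof clarify
      fix p q assume pq: "p \<in> M" "q \<in> N"
      then have pq': "p \<in> bounded_ops" "q \<in> bounded_ops" using M(1,2) by auto
      show "p \<otimes>\<^sub>o q \<in> commutant ?S"
      proof (rule commutantI)
        fix R assume "R \<in> ?S"
        then obtain x y where R: "R = x \<otimes>\<^sub>o y" and xy: "x \<in> commutant M" "y \<in> commutant N" by blast
        show "R o\<^sub>L (p \<otimes>\<^sub>o q) = (p \<otimes>\<^sub>o q) o\<^sub>L R"
          unfolding R
          by (rule op_tens_commute[OF b[OF xy(1)] b'[OF xy(2)] pq'])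
             (rule commutantD[OF xy(1) pq(1), symmetric] commutantD[OF xy(2) pq(2), symmetric])+
      qed (rule op_tens_bounded[OF pq'])
    qed
  qed
  then have "T \<in> commutant ?S" using T by blast
  moreover have "x \<otimes>\<^sub>o y \<in> ?S" using x y by blast
  ultimately show ?thesis by (rule commutantD[symmetric])
qed

section \<open>Slice maps\<close>

lemma bounded_sesquilinear_THE:
  fixes B :: "'d::chilbert \<Rightarrow> 'd \<Rightarrow> complex"
  assumes "\<And>x x' y. B (x + x') y = B x y + B x' y" "\<And>x y y'. B x (y + y') = B x y + B x y'"
    "\<And>c x y. B x (c *\<^sub>C y) = cnj c * B x y" "\<And>c x y. B (c *\<^sub>C x) y = c * B x y"
    "\<And>x y. cmod (B x y) \<le> K * norm x * norm y"
  defines "S \<equiv> THE S. S \<in> bounded_ops \<and> (\<forall>x y. cinner (blinfun_apply S x) y = B x y)"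
  shows "S \<in> bounded_ops" "cinner (S x) y = B x y"
proof -
  have "\<exists>T :: 'd oper. (\<forall>x y. cinner (blinfun_apply T x) y = B x y) \<and> norm T \<le> max K 0"
    by (rule sesquilinear_operator) (use assms(1-5) in \<open>simp_all add: scaleC_of_real[symmetric]\<close>)
  then obtain T :: "'d oper" where T: "\<And>x y. cinner (T x) y = B x y" by blast
  have "T \<in> bounded_ops"
    unfolding bounded_ops_def
  proof (intro CollectI allI)
    show "T (c *\<^sub>C x) = c *\<^sub>C T x" for c x by (rule cinner_eqI) (simp add: T cinner_scaleC_left assms(4))
  qed
  then have "\<exists>!S. S \<in> bounded_ops \<and> (\<forall>x y. cinner (blinfun_apply S x) y = B x y)"
    using T by (intro ex1I[of _ T]) (auto intro!: blinfun_cinner_eqI)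
  from theI'[OF this] show "S \<in> bounded_ops" "cinner (S x) y = B x y" unfolding S_def by auto
qed

text \<open>
  The two kinds of slice maps are treated together: the embedding \<open>E\<close> is \<open>(\<otimes>\<^sub>h)\<close> for \<^const>\<open>slice_right\<close>, and \<open>(\<otimes>\<^sub>h)\<close>
  with its arguments exchanged for \<^const>\<open>slice_left\<close>.
\<close>

locale tensor_embedding =
  fixes E :: "'a::chilbert \<Rightarrow> 'b::chilbert \<Rightarrow> 'c::chilbert"
  assumes cinner_E: "cinner (E x y) (E x' y') = cinner x x' * cinner y y'"
    and E_add_left: "E (x + x') y = E x y + E x' y"
    and E_add_right: "E x (y + y') = E x y + E x y'"
    and E_scale_left: "E (c *\<^sub>C x) y = c *\<^sub>C E x y"
    and E_scale_right: "E x (c *\<^sub>C y) = c *\<^sub>C E x y"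
begin

definition vec_slice :: "'a \<Rightarrow> 'a \<Rightarrow> 'c oper \<Rightarrow> 'b oper" where
  "vec_slice h h' T = (THE S. S \<in> bounded_ops \<and> (\<forall>k l. cinner (S k) l = cinner (T (E h k)) (E h' l)))"

definition slice :: "('b oper \<Rightarrow> complex) \<Rightarrow> 'c oper \<Rightarrow> 'a oper" where
  "slice f T = (THE S. S \<in> bounded_ops \<and> (\<forall>h h'. cinner (S h) h' = f (vec_slice h h' T)))"

lemma norm_E: "norm (E x y) = norm x * norm y"
proof -
  have "complex_of_real ((norm (E x y))\<^sup>2) = complex_of_real ((norm x * norm y)\<^sup>2)"
    unfolding cinner_self[symmetric] cinner_E by (simp add: cinner_self power_mult_distrib)
  then have "(norm (E x y))\<^sup>2 = (norm x * norm y)\<^sup>2" unfolding of_real_eq_iff .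
  then show ?thesis by (simp add: power2_eq_iff_nonneg)
qed

context
  fixes T :: "'c oper" assumes T: "T \<in> bounded_ops"
begin

lemma vec_slice_form_bound: "cmod (cinner (T (E h k)) (E h' l)) \<le> norm T * norm h * norm h' * norm k * norm l"
proof -
  have "cmod (cinner (T (E h k)) (E h' l)) \<le> norm T * norm (E h k) * norm (E h' l)"
    by (rule order_trans[OF cinner_bound mult_right_mono[OF norm_blinfun]]) simp
  then show ?thesis by (simp add: norm_E mult_ac)
qed

lemma vec_slice_bounded: "vec_slice h h' T \<in> bounded_ops"
  and cinner_vec_slice: "cinner (vec_slice h h' T k) l = cinner (T (E h k)) (E h' l)"
  unfolding vec_slice_def
  by (rule bounded_sesquilinear_THE[where B="\<lambda>k l. cinner (T (E h k)) (E h' l)" and K="norm T * norm h * norm h'"];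
      simp add: E_add_right E_scale_right bounded_opsD[OF T] blinfun.add_right cinner_add_left cinner_add_right
        cinner_scaleC_left cinner_scaleC_right vec_slice_form_bound)+

lemma norm_vec_slice: "norm (vec_slice h h' T) \<le> norm T * norm h * norm h'"
  by (rule norm_le_of_cinner) (simp_all add: cinner_vec_slice vec_slice_form_bound)

lemma vec_slice_sesquilinear:
  "vec_slice (h + g) h' T = vec_slice h h' T + vec_slice g h' T"
  "vec_slice h (h' + g') T = vec_slice h h' T + vec_slice h g' T"
  "vec_slice (c *\<^sub>C h) h' T = scale_op c (vec_slice h h' T)"
  "vec_slice h (c *\<^sub>C h') T = scale_op (cnj c) (vec_slice h h' T)"
  by (rule blinfun_cinner_eqI;
      simp add: cinner_vec_slice E_add_left E_scale_left bounded_opsD[OF T] blinfun.add_right blinfun.add_left scale_op_apply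
        cinner_add_left cinner_add_right cinner_scaleC_left cinner_scaleC_right)+

text \<open>\<open>Y\<close> is the amplification of \<open>y\<close>, described only by its action
  on \<open>E\<close> so that both orders of the factors are covered. With the bicommutant property
  this places vector slices in the algebra.\<close>

lemma vec_slice_commute:
  assumes y: "y \<in> bounded_ops" and Y: "Y \<in> bounded_ops" "T o\<^sub>L Y = Y o\<^sub>L T"
    "\<And>h k. Y (E h k) = E h (y k)" "\<And>h k. adj Y (E h k) = E h (adj y k)"
  shows "y o\<^sub>L vec_slice h h' T = vec_slice h h' T o\<^sub>L y"
proof (rule blinfun_cinner_eqI)
  fix k l
  have "cinner (y (vec_slice h h' T k)) l = cinner (T (E h k)) (adj Y (E h' l))"
    by (simp add: cinner_adj_right[OF y, symmetric] cinner_vec_slice Y(4))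
  also have "\<dots> = cinner ((T o\<^sub>L Y) (E h k)) (E h' l)" by (simp only: Y(2) cinner_adj_right[OF Y(1)] blinfun_apply_blinfun_compose)
  also have "\<dots> = cinner (vec_slice h h' T (y k)) l" by (simp add: Y(3) cinner_vec_slice)
  finally show "cinner ((y o\<^sub>L vec_slice h h' T) k) l = cinner ((vec_slice h h' T o\<^sub>L y) k) l" by simp
qed

text \<open>Outside \<open>M\<close> nothing is known about \<open>f\<close>. As all vector slices
  lie in \<open>M\<close>, it may be replaced there by an everywhere defined bounded linear
  functional, which gives the form its linearity and its bound.\<close>

lemma cinner_slice:
  assumes M: "\<And>h h'. vec_slice h h' T \<in> M" and f: "normal_functional M f"
  shows "cinner (slice f T h) h' = f (vec_slice h h' T)"
proof -
  obtain g where g: "bounded_linear g" "\<And>c T. g (scale_op c T) = c * g T" "\<And>x. x \<in> M \<Longrightarrow> f x = g x"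
    by (rule normal_functional_bounded_linear[OF f]) blast
  interpret g: bounded_linear g by fact
  have bound: "cmod (f (vec_slice h h' T)) \<le> (onorm g * norm T) * norm h * norm h'" for h h'
    unfolding g(3)[OF M]
    using order_trans[OF onorm[OF g(1)] mult_left_mono[OF norm_vec_slice[of h h'] onorm_pos_le[OF g(1)]]] by (simp add: mult_ac)
  have lin: "f (vec_slice (h + k) h' T) = f (vec_slice h h' T) + f (vec_slice k h' T)"
    "f (vec_slice h (h' + k') T) = f (vec_slice h h' T) + f (vec_slice h k' T)"
    "f (vec_slice (c *\<^sub>C h) h' T) = c * f (vec_slice h h' T)"
    "f (vec_slice h (c *\<^sub>C h') T) = cnj c * f (vec_slice h h' T)" for h h' k k' c
    unfolding g(3)[OF M] by (simp_all add: vec_slice_sesquilinear g(2) g.add)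
  show ?thesis
    unfolding slice_def
    by (rule bounded_sesquilinear_THE[where B="\<lambda>h h'. f (vec_slice h h' T)" and K="onorm g * norm T"];
        simp add: lin bound)
qed

text \<open>The norm of a slice is controlled by the size of the functional on \<open>M\<close>.
  Hence an approximation of \<omega> by combinations of \<Gamma> approximates
  \<open>slice \<omega> T\<close> in norm; since \<open>N\<close> is closed and \<mu> is contractive
  there, both membership and value pass to the limit.\<close>

lemma slice_invariant:
  fixes \<mu> :: "'a oper \<Rightarrow> complex"
  assumes N: "cstar_algebra N"
    and M: "\<And>h h'. vec_slice h h' T \<in> M" "id_blinfun \<in> M"
    and \<Gamma>: "\<And>\<gamma>. \<gamma> \<in> \<Gamma> \<Longrightarrow> normal_functional M \<gamma> \<and> \<gamma> id_blinfun = 1"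
    and dense: "\<And>\<epsilon>. 0 < \<epsilon> \<Longrightarrow> \<exists>F c. finite F \<and> F \<subseteq> \<Gamma> \<and> (\<forall>x\<in>M. cmod (\<omega> x - (\<Sum>\<gamma>\<in>F. c \<gamma> * \<gamma> x)) \<le> \<epsilon> * norm x)"
    and \<omega>: "normal_functional M \<omega>"
    and slice: "\<And>\<gamma>. \<gamma> \<in> \<Gamma> \<Longrightarrow> slice \<gamma> T \<in> N \<and> \<mu> (slice \<gamma> T) = z"
    and \<mu>: "\<And>x y. x \<in> N \<Longrightarrow> y \<in> N \<Longrightarrow> \<mu> (x + y) = \<mu> x + \<mu> y" "\<And>c x. x \<in> N \<Longrightarrow> \<mu> (scale_op c x) = c * \<mu> x"
      "\<And>x. x \<in> N \<Longrightarrow> cmod (\<mu> x) \<le> norm x"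
  shows "\<mu> (slice \<omega> T) = \<omega> id_blinfun * z"
proof -
  note N' = cstar_algebraD[OF N]
  have appr: "\<exists>S\<in>N. norm (slice \<omega> T - S) \<le> \<epsilon> * norm T \<and> cmod (\<mu> S - \<omega> id_blinfun * z) \<le> \<epsilon> * cmod z"
    if e: "0 < \<epsilon>" for \<epsilon>
  proof -
    obtain F c where F: "finite F" "F \<subseteq> \<Gamma>"
      and Fc: "\<And>x. x \<in> M \<Longrightarrow> cmod (\<omega> x - (\<Sum>\<gamma>\<in>F. c \<gamma> * \<gamma> x)) \<le> \<epsilon> * norm x"
      using dense[OF e] by blast
    define S where "S = (\<Sum>\<gamma>\<in>F. scale_op (c \<gamma>) (slice \<gamma> T))"
    have S: "S \<in> N \<and> \<mu> S = (\<Sum>\<gamma>\<in>F. c \<gamma> * z)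
        \<and> (\<forall>h h'. cinner (S h) h' = (\<Sum>\<gamma>\<in>F. c \<gamma> * \<gamma> (vec_slice h h' T)))"
      unfolding S_def using F
    proof (induction F rule: finite_induct)
      case empty
      have "\<mu> 0 = 0" using \<mu>(2)[OF N'(2), of 0] by simp
      then show ?case using N'(2) by (simp add: linear_0[OF linear_cinner_left])
    next
      case (insert \<gamma> F)
      have \<gamma>: "\<gamma> \<in> \<Gamma>" using insert by simp
      then have "scale_op (c \<gamma>) (slice \<gamma> T) \<in> N" using slice N'(5) by blast
      moreover have "\<mu> (scale_op (c \<gamma>) (slice \<gamma> T)) = c \<gamma> * z" using \<gamma> slice \<mu>(2) by simp
      ultimately show ?case
        using insert \<gamma> \<Gamma> by (simp add: N'(4) \<mu>(1) blinfun.add_left cinner_add_left scale_op_apply cinner_scaleC_left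
            cinner_slice[OF M(1)])
    qed
    have "norm (slice \<omega> T - S) \<le> \<epsilon> * norm T"
    proof (rule norm_le_of_cinner)
      fix h h'
      have "cmod (cinner ((slice \<omega> T - S) h) h') \<le> \<epsilon> * norm (vec_slice h h' T)"
        using Fc[OF M(1)] S by (simp add: blinfun.diff_left cinner_diff_left cinner_slice[OF M(1) \<omega>])
      also have "\<dots> \<le> \<epsilon> * (norm T * norm h * norm h')" using e by (intro mult_left_mono norm_vec_slice) auto
      finally show "cmod (cinner ((slice \<omega> T - S) h) h') \<le> \<epsilon> * norm T * norm h * norm h'" by (simp add: mult_ac)
    qed (use e in simp)
    \<comment> \<open>Members of \<Gamma> are 1 at the identity, so testing the approximation there
      makes the coefficients add up nearly to \<open>\<omega> id_blinfun\<close>.\<close>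
    moreover have "cmod (\<mu> S - \<omega> id_blinfun * z) \<le> \<epsilon> * cmod z"
    proof -
      have "(\<Sum>\<gamma>\<in>F. c \<gamma> * \<gamma> id_blinfun) = (\<Sum>\<gamma>\<in>F. c \<gamma>)" using F(2) \<Gamma> by (intro sum.cong) auto
      then have "cmod (\<omega> id_blinfun - (\<Sum>\<gamma>\<in>F. c \<gamma>)) \<le> \<epsilon> * norm (id_blinfun :: 'b oper)" using Fc[OF M(2)] by simp
      also have "\<dots> \<le> \<epsilon>" using mult_left_mono[OF norm_id_blinfun_le, of \<epsilon>] e by simp
      finally have "cmod (\<omega> id_blinfun - (\<Sum>\<gamma>\<in>F. c \<gamma>)) * cmod z \<le> \<epsilon> * cmod z" by (rule mult_right_mono) simp
      moreover have "\<mu> S - \<omega> id_blinfun * z = - ((\<omega> id_blinfun - (\<Sum>\<gamma>\<in>F. c \<gamma>)) * z)"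
        using S by (simp add: sum_distrib_right left_diff_distrib)
      ultimately show ?thesis by (simp add: norm_mult)
    qed
    ultimately show ?thesis using S by blast
  qed
  \<comment> \<open>The added 1 avoids dividing by zero when \<open>T = 0\<close>.\<close>
  have le: "\<epsilon> / (norm T + 1) * norm T \<le> \<epsilon>" if "0 < \<epsilon>" for \<epsilon>
    using that by (simp add: divide_le_eq add_pos_nonneg add_nonneg_pos mult_left_mono)
  have "slice \<omega> T \<in> closure N"
    unfolding closure_approachable
  proof (intro allI impI)
    fix e :: real assume e: "0 < e"
    then have "0 < e / 2 / (norm T + 1)" by (simp add: add_nonneg_pos)
    then obtain S where S: "S \<in> N" "norm (slice \<omega> T - S) \<le> e / 2 / (norm T + 1) * norm T" using appr by blast
    have "norm (slice \<omega> T - S) \<le> e / 2" by (rule order_trans[OF S(2) le]) (use e in simp)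
    then have "dist S (slice \<omega> T) < e" using e by (simp add: dist_norm norm_minus_commute)
    then show "\<exists>S\<in>N. dist S (slice \<omega> T) < e" using S(1) by blast
  qed
  then have sN: "slice \<omega> T \<in> N" using N'(3) by simp
  have "cmod (\<mu> (slice \<omega> T) - \<omega> id_blinfun * z) \<le> \<epsilon> * (norm T + cmod z)" if e: "0 < \<epsilon>" for \<epsilon>
  proof -
    obtain S where S: "S \<in> N" "norm (slice \<omega> T - S) \<le> \<epsilon> * norm T" "cmod (\<mu> S - \<omega> id_blinfun * z) \<le> \<epsilon> * cmod z"
      using appr[OF e] by blast
    have d: "slice \<omega> T - S \<in> N" by (rule N'(9)[OF sN S(1)])
    have "\<mu> (slice \<omega> T) - \<omega> id_blinfun * z = \<mu> (slice \<omega> T - S) + (\<mu> S - \<omega> id_blinfun * z)"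
      using \<mu>(1)[OF d S(1)] by simp
    also have "cmod \<dots> \<le> cmod (\<mu> (slice \<omega> T - S)) + cmod (\<mu> S - \<omega> id_blinfun * z)" by (rule norm_triangle_ineq)
    also have "\<dots> \<le> \<epsilon> * norm T + \<epsilon> * cmod z" using \<mu>(3)[OF d] S by linarith
    finally show ?thesis by (simp add: algebra_simps)
  qed
  then have "cmod (\<mu> (slice \<omega> T) - \<omega> id_blinfun * z) \<le> 0"
    using le_zero_of_small_multiples[of "cmod (\<mu> (slice \<omega> T) - \<omega> id_blinfun * z)" "norm T + cmod z"]
      add_nonneg_nonneg[OF norm_ge_zero norm_ge_zero] by blast
  then show ?thesis by simp
qed
  

end

end

section \<open>The GNS representation\<close>

text \<open>Uniform continuity extends \<open>f\<close> as a mere function; each algebraic law is a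
  closed condition and therefore follows from its validity on \<open>D\<close>.\<close>

lemma linear_dense_extension:
  fixes f :: "'a::chilbert \<Rightarrow> 'b::chilbert"
  assumes dense: "closure D = UNIV" and K: "0 \<le> K"
    and add: "\<And>x y. x \<in> D \<Longrightarrow> y \<in> D \<Longrightarrow> x + y \<in> D \<and> f (x + y) = f x + f y"
    and scale: "\<And>c x. x \<in> D \<Longrightarrow> c *\<^sub>C x \<in> D \<and> f (c *\<^sub>C x) = c *\<^sub>C f x"
    and bound: "\<And>x. x \<in> D \<Longrightarrow> norm (f x) \<le> K * norm x"
  shows "\<exists>T. (\<forall>c x. blinfun_apply T (c *\<^sub>C x) = c *\<^sub>C blinfun_apply T x) \<and> norm T \<le> K \<and> (\<forall>x\<in>D. blinfun_apply T x = f x)"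
proof -
  have lip: "norm (f x - f y) \<le> K * norm (x - y)" if "x \<in> D" "y \<in> D" for x y
  proof -
    have my: "-1 *\<^sub>C y = - y" for y :: 'a using scaleC_of_real[of "-1" y] by simp
    have mfy: "-1 *\<^sub>C y = - y" for y :: 'b using scaleC_of_real[of "-1" y] by simp
    have "- y \<in> D" "f (- y) = - f y" using scale[of y "-1"] that my mfy by auto
    then have "x - y \<in> D" "f (x - y) = f x - f y" using add[of x "- y"] that by auto
    then show ?thesis using bound by metis
  qed
  have "uniformly_continuous_on D f"
    unfolding uniformly_continuous_on_def
  proof (intro allI impI)
    fix e :: real assume e: "0 < e"
    have "dist (f x') (f x) < e" if "x \<in> D" "x' \<in> D" "dist x' x < e / (K + 1)" for x x'
    proof -
      have "norm (f x' - f x) \<le> K * norm (x' - x)" using lip that by blast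
      also have "\<dots> \<le> (K + 1) * norm (x' - x)" by (intro mult_right_mono) auto
      also have "\<dots> < e" using that(3) K by (simp add: dist_norm less_divide_eq mult.commute)
      finally show ?thesis by (simp add: dist_norm)
    qed
    then show "\<exists>d>0. \<forall>x\<in>D. \<forall>x'\<in>D. dist x' x < d \<longrightarrow> dist (f x') (f x) < e"
      using e K by (intro exI[of _ "e / (K + 1)"]) auto
  qed
  then obtain g where g: "uniformly_continuous_on (closure D) g" "\<And>x. x \<in> D \<Longrightarrow> f x = g x"
    by (rule uniformly_continuous_on_extension_on_closure) blast
  then have cont: "continuous_on UNIV g" using dense uniformly_continuous_imp_continuous by metis
  have cont': "continuous_on UNIV (\<lambda>x. g (h x))" if "continuous_on UNIV h" for h :: "'a \<Rightarrow> 'a"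
    using continuous_on_compose2[OF cont that] by simp
  have dense_induct: "P x" if "closed {x. P x}" "\<And>x. x \<in> D \<Longrightarrow> P x" for P and x :: 'a
    using closure_minimal[of D "{x. P x}"] that dense by auto
  have gD: "g (x + y) = g x + g y" "g (c *\<^sub>C x) = c *\<^sub>C g x" "norm (g x) \<le> K * norm x" if "x \<in> D" "y \<in> D" for x y c
    using add[OF that] scale[OF that(1), of c] bound[OF that(1)] g(2)[OF that(1)] g(2)[OF that(2)]
      g(2)[of "x + y"] g(2)[of "c *\<^sub>C x"] by simp_all
  have contC: "continuous_on UNIV (\<lambda>x. c *\<^sub>C h x)" if "continuous_on UNIV h" for c and h :: "'a \<Rightarrow> 'c::chilbert"
    by (rule bounded_linear.continuous_on[OF bounded_linear_scaleC that])
  have addg: "g (x + y) = g x + g y" for x y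
  proof -
    \<comment> \<open>Density is used in one variable at a time: the first stays in \<open>D\<close>
      while the second runs through the whole space.\<close>
    have 1: "g (x + y) = g x + g y" if x: "x \<in> D" for x y
    proof (rule dense_induct[where P="\<lambda>y. g (x + y) = g x + g y"])
      show "closed {y. g (x + y) = g x + g y}"
        by (rule closed_Collect_eq) (intro cont' continuous_on_add continuous_on_const continuous_on_id cont)+
    qed (rule gD[OF x])
    show ?thesis
    proof (rule dense_induct[where P="\<lambda>x. g (x + y) = g x + g y"])
      show "closed {x. g (x + y) = g x + g y}"
        by (rule closed_Collect_eq) (intro cont' continuous_on_add continuous_on_const continuous_on_id cont)+
    qed (rule 1)
  qed
  have scaleg: "g (c *\<^sub>C x) = c *\<^sub>C g x" for c x
  proof (rule dense_induct[where P="\<lambda>x. g (c *\<^sub>C x) = c *\<^sub>C g x"])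
    show "closed {x. g (c *\<^sub>C x) = c *\<^sub>C g x}"
      by (rule closed_Collect_eq) (intro cont' contC continuous_on_id cont)+
  qed (rule gD)
  have boundg: "norm (g x) \<le> K * norm x" for x
  proof (rule dense_induct[where P="\<lambda>x. norm (g x) \<le> K * norm x"])
    show "closed {x. norm (g x) \<le> K * norm x}"
      by (rule closed_Collect_le) (intro continuous_intros cont)+
  qed (rule gD)
  have bl: "bounded_linear g"
    by (rule bounded_linear_intro[where K=K]) (use boundg in \<open>auto simp: addg scaleg mult.commute simp flip: scaleC_of_real\<close>)
  show ?thesis
    by (intro exI[of _ "Blinfun g"])
       (auto simp: bounded_linear_Blinfun_apply[OF bl] scaleg g(2) boundg K intro!: norm_blinfun_bound)
qed

text \<open>Polarisation at \<open>x + y\<close> and \<open>x + \<i> *\<^sub>C y\<close>; it depends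
  on complex scalars and on complex linearity of \<open>T\<close>.\<close>

lemma zero_of_quadratic_form:
  fixes T :: "'a::chilbert oper"
  assumes T: "T \<in> bounded_ops" and q: "\<And>v. cinner (T v) v = 0"
  shows "T = 0"
proof (rule blinfun_cinner_eqI)
  fix x y
  have "cinner (T x) y + cinner (T y) x = 0"
    using q[of "x + y"] by (simp add: blinfun.add_right cinner_add_left cinner_add_right q add.commute)
  moreover have "cnj \<i> * cinner (T x) y + \<i> * cinner (T y) x = 0"
    using q[of "x + \<i> *\<^sub>C y"]
    by (simp add: blinfun.add_right cinner_add_left cinner_add_right cinner_scaleC_left cinner_scaleC_right bounded_opsD[OF T] q)
  ultimately have "cinner (T x) y = 0" by (simp add: complex_eq_iff)
  then show "cinner (T x) y = cinner ((0 :: 'a oper) x) y" by (simp add: linear_0[OF linear_cinner_left])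
qed

lemma positive_op_adj_compose:
  fixes x :: "'a::chilbert oper"
  assumes "x \<in> bounded_ops"
  shows "positive_op (adj x o\<^sub>L x)"
  using assms by (simp add: positive_op_def bounded_ops_closed adj_bounded cinner_adj_left cinner_self)

section \<open>The left ideal of a weight\<close>

locale gns_construction =
  fixes M :: "'h::chilbert oper set" and \<phi> :: "'h oper \<Rightarrow> ennreal" and \<Lambda> :: "'h oper \<Rightarrow> 'k::chilbert"
  assumes vn: "von_neumann_algebra M" and weight: "weight M \<phi>" and gns: "gns_space M \<phi> \<Lambda>"
begin

lemmas M_closed = cstar_algebraD[OF von_neumann_cstar(1)[OF vn]]

lemma M_bounded: "x \<in> M \<Longrightarrow> x \<in> bounded_ops"
  using M_closed(1) by blast

lemma weight_add: "x \<in> pos_part M \<Longrightarrow> y \<in> pos_part M \<Longrightarrow> \<phi> (x + y) = \<phi> x + \<phi> y"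
  and weight_scale: "0 \<le> r \<Longrightarrow> x \<in> pos_part M \<Longrightarrow> \<phi> (r *\<^sub>R x) = ennreal r * \<phi> x"
  using weight by (auto simp: weight_def)

lemma adj_compose_pos: "x \<in> M \<Longrightarrow> adj x o\<^sub>L x \<in> pos_part M"
  by (simp add: pos_part_def positive_op_adj_compose M_bounded M_closed)

lemma weight_mono:
  assumes "x \<in> pos_part M" "y \<in> pos_part M" "positive_op (y - x)"
  shows "\<phi> x \<le> \<phi> y"
proof -
  have "y - x \<in> pos_part M" using assms M_closed(9) by (auto simp: pos_part_def)
  then have "\<phi> y = \<phi> x + \<phi> (y - x)" using weight_add[OF assms(1)] by (metis add_diff_cancel_left' diff_add_cancel add.commute)
  then show ?thesis by simp
qed

text \<open>The operator inequality
  \<open>b* x* x b \<le> \<parallel>x\<parallel>\<^sup>2 b* b\<close>. It gives both the left ideal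
  property and the bound for the representation.\<close>

lemma weight_left_mult:
  assumes x: "x \<in> M" and b: "b \<in> M"
  shows "\<phi> (adj (x o\<^sub>L b) o\<^sub>L (x o\<^sub>L b)) \<le> ennreal ((norm x)\<^sup>2) * \<phi> (adj b o\<^sub>L b)"
proof -
  note bd = M_bounded[OF x] M_bounded[OF b]
  have "\<phi> (adj (x o\<^sub>L b) o\<^sub>L (x o\<^sub>L b)) \<le> \<phi> ((norm x)\<^sup>2 *\<^sub>R (adj b o\<^sub>L b))"
  proof (rule weight_mono)
    show "adj (x o\<^sub>L b) o\<^sub>L (x o\<^sub>L b) \<in> pos_part M" by (rule adj_compose_pos) (simp add: M_closed x b)
    show "(norm x)\<^sup>2 *\<^sub>R (adj b o\<^sub>L b) \<in> pos_part M"
      using adj_compose_pos[OF b] M_closed(8) bounded_ops_closed(5)[of "adj b o\<^sub>L b" "of_real ((norm x)\<^sup>2)"]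
      by (auto simp: pos_part_def positive_op_def blinfun.scaleR_left cinner_scaleR_left scale_op_scaleR
          simp del: of_real_power)
    show "positive_op ((norm x)\<^sup>2 *\<^sub>R (adj b o\<^sub>L b) - (adj (x o\<^sub>L b) o\<^sub>L (x o\<^sub>L b)))"
      unfolding positive_op_def
    proof (intro conjI allI)
      show "(norm x)\<^sup>2 *\<^sub>R (adj b o\<^sub>L b) - (adj (x o\<^sub>L b) o\<^sub>L (x o\<^sub>L b)) \<in> bounded_ops"
        unfolding scale_op_scaleR[symmetric] by (intro bounded_ops_closed adj_bounded bd)
      fix v
      have e: "cinner (((norm x)\<^sup>2 *\<^sub>R (adj b o\<^sub>L b) - (adj (x o\<^sub>L b) o\<^sub>L (x o\<^sub>L b))) v) v
          = of_real ((norm x)\<^sup>2 * (norm (b v))\<^sup>2 - (norm (x (b v)))\<^sup>2)"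
        by (simp add: blinfun.diff_left blinfun.scaleR_left cinner_diff_left cinner_scaleR_left cinner_adj_left bd
            bounded_ops_closed cinner_self)
      have "(norm (x (b v)))\<^sup>2 \<le> (norm x * norm (b v))\<^sup>2" by (intro power_mono norm_blinfun) simp
      then show "cinner (((norm x)\<^sup>2 *\<^sub>R (adj b o\<^sub>L b) - (adj (x o\<^sub>L b) o\<^sub>L (x o\<^sub>L b))) v) v \<in> \<real>"
        "0 \<le> Re (cinner (((norm x)\<^sup>2 *\<^sub>R (adj b o\<^sub>L b) - (adj (x o\<^sub>L b) o\<^sub>L (x o\<^sub>L b))) v) v)"
        unfolding e by (simp_all add: power_mult_distrib)
    qed
  qed
  then show ?thesis by (simp add: weight_scale adj_compose_pos b)
qed

lemma weight_ideal_M: "b \<in> weight_ideal M \<phi> \<Longrightarrow> b \<in> M"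
  by (simp add: weight_ideal_def)

lemma weight_ideal_left: "x \<in> M \<Longrightarrow> b \<in> weight_ideal M \<phi> \<Longrightarrow> x o\<^sub>L b \<in> weight_ideal M \<phi>"
  using weight_left_mult[of x b]
  by (auto simp: weight_ideal_def M_closed ennreal_mult_less_top intro: le_less_trans)

lemma weight_ideal_scale: "b \<in> weight_ideal M \<phi> \<Longrightarrow> scale_op c b \<in> weight_ideal M \<phi>"
  using weight_ideal_left[of "scale_op c id_blinfun" b] M_closed(5)[OF von_neumann_cstar(2)[OF vn]]
  by (simp add: scale_op_compose_left) (metis blinfun_apply_blinfun_compose blinfun_apply_id_blinfun blinfun_eqI id_apply)

lemma weight_ideal_add:
  assumes x: "x \<in> weight_ideal M \<phi>" and y: "y \<in> weight_ideal M \<phi>"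
  shows "x + y \<in> weight_ideal M \<phi>"
proof -
  note m = weight_ideal_M[OF x] weight_ideal_M[OF y]
  note b = M_bounded[OF m(1)] M_bounded[OF m(2)]
  have "\<phi> (adj (x + y) o\<^sub>L (x + y)) \<le> \<phi> (2 *\<^sub>R ((adj x o\<^sub>L x) + (adj y o\<^sub>L y)))"
  proof (rule weight_mono)
    show "adj (x + y) o\<^sub>L (x + y) \<in> pos_part M" by (intro adj_compose_pos M_closed m)
    \<comment> \<open>The parallelogram identity: the difference of the two sides in
      \<open>weight_mono\<close> is \<open>(x - y)* (x - y)\<close>.\<close>
    have e: "(2 *\<^sub>R ((adj x o\<^sub>L x) + (adj y o\<^sub>L y))) = (adj (x + y) o\<^sub>L (x + y)) + (adj (x - y) o\<^sub>L (x - y))"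
      by (rule blinfun_eqI)
         (simp add: adj_simps b blinfun.add_left blinfun.diff_left blinfun.add_right blinfun.diff_right
           blinfun.scaleR_left scaleR_2 algebra_simps)
    have "adj (x + y) o\<^sub>L (x + y) \<in> pos_part M" "adj (x - y) o\<^sub>L (x - y) \<in> pos_part M"
      by (intro adj_compose_pos M_closed m)+
    then show "2 *\<^sub>R ((adj x o\<^sub>L x) + (adj y o\<^sub>L y)) \<in> pos_part M"
      unfolding e
      by (auto simp: pos_part_def positive_op_def M_closed bounded_ops_closed blinfun.add_left cinner_add_left)
    show "positive_op (2 *\<^sub>R ((adj x o\<^sub>L x) + (adj y o\<^sub>L y)) - (adj (x + y) o\<^sub>L (x + y)))"
      unfolding e by (simp add: positive_op_adj_compose b bounded_ops_closed)
  qed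
  also have "\<dots> = 2 * (\<phi> (adj x o\<^sub>L x) + \<phi> (adj y o\<^sub>L y))"
  proof -
    have "(adj x o\<^sub>L x) + (adj y o\<^sub>L y) \<in> pos_part M"
      using adj_compose_pos[OF m(1)] adj_compose_pos[OF m(2)]
      by (auto simp: pos_part_def positive_op_def M_closed bounded_ops_closed blinfun.add_left cinner_add_left)
    then show ?thesis by (simp add: weight_scale weight_add adj_compose_pos m)
  qed
  also have "\<dots> < \<infinity>" using x y by (simp add: weight_ideal_def ennreal_mult_less_top)
  finally show ?thesis by (simp add: weight_ideal_def M_closed m)
qed

lemma zero_in_weight_cone: "0 \<in> weight_cone M \<phi>"
proof -
  have "(0 :: 'h oper) \<in> pos_part M"
    by (simp add: pos_part_def positive_op_def M_closed bounded_ops_closed linear_0[OF linear_cinner_left])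
  then show ?thesis using weight_scale[of 0 0] by (simp add: weight_cone_def)
qed

text \<open>Norms in the GNS space involve the extension only at elements \<open>x* x\<close>, so
  the description by \<open>THE\<close> is resolved on the finite cone. For positive
  \<open>z\<close> the part \<open>c - d\<close> has vanishing quadratic form, so
  \<open>c = d\<close>; then \<open>a = z + b\<close>, and finiteness of the weights allows
  subtraction.\<close>

lemma weight_ext_cone:
  assumes z: "z \<in> weight_cone M \<phi>"
  shows "weight_ext M \<phi> z = of_real (enn2real (\<phi> z))"
  unfolding weight_ext_def
proof (rule the_equality)
  have "z = z - 0 + scale_op \<i> (0 - 0)" 
    by (rule blinfun_eqI) (simp add: scale_op_apply linear_0[OF linear_scaleC] blinfun.add_left)
  moreover have "complex_of_real (enn2real (\<phi> z)) = Complex (enn2real (\<phi> z) - enn2real (\<phi> 0)) (enn2real (\<phi> 0) - enn2real (\<phi> 0))"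
  proof -
    have "(0 :: 'h oper) \<in> pos_part M" using zero_in_weight_cone by (simp add: weight_cone_def)
    then have "\<phi> 0 = 0" using weight_scale[of 0 0] by simp
    then show ?thesis by (simp add: complex_eq_iff)
  qed
  ultimately show "\<exists>a\<in>weight_cone M \<phi>. \<exists>b\<in>weight_cone M \<phi>. \<exists>c\<in>weight_cone M \<phi>. \<exists>d\<in>weight_cone M \<phi>.
      z = a - b + scale_op \<i> (c - d) \<and> complex_of_real (enn2real (\<phi> z))
        = Complex (enn2real (\<phi> a) - enn2real (\<phi> b)) (enn2real (\<phi> c) - enn2real (\<phi> d))"
    using z zero_in_weight_cone by blast
next
  fix v
  assume "\<exists>a\<in>weight_cone M \<phi>. \<exists>b\<in>weight_cone M \<phi>. \<exists>c\<in>weight_cone M \<phi>. \<exists>d\<in>weight_cone M \<phi>.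
      z = a - b + scale_op \<i> (c - d) \<and> v = Complex (enn2real (\<phi> a) - enn2real (\<phi> b)) (enn2real (\<phi> c) - enn2real (\<phi> d))"
  then obtain a b c d where abcd: "a \<in> weight_cone M \<phi>" "b \<in> weight_cone M \<phi>" "c \<in> weight_cone M \<phi>" "d \<in> weight_cone M \<phi>"
    and zz: "z = a - b + scale_op \<i> (c - d)"
    and v: "v = Complex (enn2real (\<phi> a) - enn2real (\<phi> b)) (enn2real (\<phi> c) - enn2real (\<phi> d))" by blast
  have pos: "x \<in> pos_part M" "positive_op x" "x \<in> bounded_ops" "\<phi> x < \<infinity>" if "x \<in> weight_cone M \<phi>" for x
    using that by (auto simp: weight_cone_def pos_part_def positive_op_def)
  have im: "Im (cinner (x w) w) = 0" if "x \<in> weight_cone M \<phi>" for x w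
    using pos(2)[OF that] by (auto simp: positive_op_def complex_is_Real_iff)
  have "c - d = 0"
  proof (rule zero_of_quadratic_form)
    show "c - d \<in> bounded_ops" by (intro bounded_ops_closed pos abcd)
    fix w
    have "cinner (z w) w = cinner (a w) w - cinner (b w) w + \<i> * (cinner (c w) w - cinner (d w) w)"
      unfolding zz by (simp add: blinfun.add_left blinfun.diff_left cinner_add_left cinner_diff_left scale_op_apply
          cinner_scaleC_left)
    then have "Re (cinner (c w) w) - Re (cinner (d w) w) = 0"
      using im[OF z, of w] im[OF abcd(1), of w] im[OF abcd(2), of w] by simp
    then show "cinner ((c - d) w) w = 0"
      using im[OF abcd(3), of w] im[OF abcd(4), of w] by (simp add: blinfun.diff_left cinner_diff_left complex_eq_iff)
  qed
  then have cd: "c = d" by simp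
  then have "a = z + b" using zz by (auto intro!: blinfun_eqI simp: scale_op_apply linear_0[OF linear_scaleC] blinfun.add_left blinfun.diff_left)
  then have "\<phi> a = \<phi> z + \<phi> b" using weight_add pos z abcd by simp
  then have "enn2real (\<phi> a) = enn2real (\<phi> z) + enn2real (\<phi> b)"
    using pos(4)[OF z] pos(4)[OF abcd(2)] by (simp add: enn2real_plus)
  then show "v = complex_of_real (enn2real (\<phi> z))" using v cd by (simp add: complex_eq_iff)
qed

section \<open>The representation on the completed ideal\<close>

lemma norm_gns:
  assumes x: "x \<in> weight_ideal M \<phi>"
  shows "(norm (\<Lambda> x))\<^sup>2 = enn2real (\<phi> (adj x o\<^sub>L x))"
proof -
  have "adj x o\<^sub>L x \<in> weight_cone M \<phi>"
    using x adj_compose_pos by (simp add: weight_ideal_def weight_cone_def)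
  then have "complex_of_real ((norm (\<Lambda> x))\<^sup>2) = of_real (enn2real (\<phi> (adj x o\<^sub>L x)))"
    using gns x weight_ext_cone unfolding gns_space_def cinner_self[symmetric] by metis
  then show ?thesis unfolding of_real_eq_iff .
qed

lemma norm_gns_left_mult:
  assumes x: "x \<in> M" and b: "b \<in> weight_ideal M \<phi>"
  shows "norm (\<Lambda> (x o\<^sub>L b)) \<le> norm x * norm (\<Lambda> b)"
proof (rule power2_le_imp_le)
  have "enn2real (\<phi> (adj (x o\<^sub>L b) o\<^sub>L (x o\<^sub>L b))) \<le> enn2real (ennreal ((norm x)\<^sup>2) * \<phi> (adj b o\<^sub>L b))"
    by (rule enn2real_mono[OF weight_left_mult[OF x weight_ideal_M[OF b]]])
       (use b in \<open>simp add: weight_ideal_def ennreal_mult_less_top\<close>)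
  then show "(norm (\<Lambda> (x o\<^sub>L b)))\<^sup>2 \<le> (norm x * norm (\<Lambda> b))\<^sup>2"
    by (simp add: norm_gns b weight_ideal_left[OF x b] power_mult_distrib enn2real_mult)
qed simp

lemma gns_add: "x \<in> weight_ideal M \<phi> \<Longrightarrow> y \<in> weight_ideal M \<phi> \<Longrightarrow> \<Lambda> (x + y) = \<Lambda> x + \<Lambda> y"
  and gns_scale: "x \<in> weight_ideal M \<phi> \<Longrightarrow> \<Lambda> (scale_op c x) = c *\<^sub>C \<Lambda> x"
  and gns_dense: "closure (\<Lambda> ` weight_ideal M \<phi>) = UNIV"
  using gns by (auto simp: gns_space_def)

lemma gns_operator_eqI:
  fixes S T :: "'k oper"
  assumes "\<And>b. b \<in> weight_ideal M \<phi> \<Longrightarrow> S (\<Lambda> b) = T (\<Lambda> b)"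
  shows "S = T"
proof (rule blinfun_eqI)
  fix v
  have "closure (\<Lambda> ` weight_ideal M \<phi>) \<subseteq> {v. S v = T v}"
    by (rule closure_minimal)
       (use assms in \<open>auto intro!: closed_Collect_eq linear_continuous_on blinfun.bounded_linear_right\<close>)
  then show "S v = T v" using gns_dense by auto
qed

text \<open>The operator is prescribed on the dense image of the ideal. The norm bound shows that it
  does not depend on the chosen representative: if \<Lambda> vanishes at a difference, it also
  vanishes at \<open>x\<close> times that difference.\<close>

lemma gns_rep_exists:
  assumes x: "x \<in> M"
  shows "\<exists>T\<in>bounded_ops. norm T \<le> norm x \<and> (\<forall>b\<in>weight_ideal M \<phi>. blinfun_apply T (\<Lambda> b) = \<Lambda> (x o\<^sub>L b))"
proof -
  let ?I = "weight_ideal M \<phi>"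
  define f where "f v = \<Lambda> (x o\<^sub>L (SOME b. b \<in> ?I \<and> \<Lambda> b = v))" for v
  have f: "f (\<Lambda> b) = \<Lambda> (x o\<^sub>L b)" if b: "b \<in> ?I" for b
  proof -
    define b' where "b' = (SOME b'. b' \<in> ?I \<and> \<Lambda> b' = \<Lambda> b)"
    have b': "b' \<in> ?I" "\<Lambda> b' = \<Lambda> b"
      using someI_ex[of "\<lambda>b'. b' \<in> ?I \<and> \<Lambda> b' = \<Lambda> b"] b unfolding b'_def by blast+
    have n: "scale_op (-1) b \<in> ?I" by (rule weight_ideal_scale[OF b])
    have m: "-1 *\<^sub>C v = - v" for v :: 'k using scaleC_of_real[of "-1" v] by simp
    have d: "b' + scale_op (-1) b \<in> ?I" by (rule weight_ideal_add[OF b'(1) n])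
    have "\<Lambda> (b' + scale_op (-1) b) = 0" by (simp only: gns_add[OF b'(1) n] gns_scale[OF b] b'(2) m) simp
    then have "\<Lambda> (x o\<^sub>L (b' + scale_op (-1) b)) = 0" using norm_gns_left_mult[OF x d] by simp
    moreover have "x o\<^sub>L (b' + scale_op (-1) b) = (x o\<^sub>L b') + scale_op (-1) (x o\<^sub>L b)"
      by (rule blinfun_eqI) (simp add: blinfun.diff_left blinfun.diff_right)
    ultimately have "\<Lambda> (x o\<^sub>L b') + - \<Lambda> (x o\<^sub>L b) = 0"
      using gns_add[OF weight_ideal_left[OF x b'(1)] weight_ideal_scale[OF weight_ideal_left[OF x b], of "-1"]]
        gns_scale[OF weight_ideal_left[OF x b], of "-1"] m by metis
    then show ?thesis by (simp add: f_def b'_def[symmetric])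
  qed
  have "\<exists>T. (\<forall>c v. blinfun_apply T (c *\<^sub>C v) = c *\<^sub>C blinfun_apply T v) \<and> norm T \<le> norm x
      \<and> (\<forall>v\<in>\<Lambda> ` ?I. blinfun_apply T v = f v)"
  proof (rule linear_dense_extension[OF gns_dense])
    fix u v c assume "u \<in> \<Lambda> ` ?I"
    then obtain a where a: "a \<in> ?I" "u = \<Lambda> a" by blast
    have xa: "x o\<^sub>L a \<in> ?I" by (rule weight_ideal_left[OF x a(1)])
    have "c *\<^sub>C u = \<Lambda> (scale_op c a)" by (simp add: gns_scale a)
    then show "c *\<^sub>C u \<in> \<Lambda> ` ?I \<and> f (c *\<^sub>C u) = c *\<^sub>C f u"
      using weight_ideal_scale[OF a(1), of c]
      by (simp add: f a scale_op_compose_right[OF M_bounded[OF x]] gns_scale[OF xa])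
    show "norm (f u) \<le> norm x * norm u" using norm_gns_left_mult[OF x a(1)] by (simp add: f a)
    assume "v \<in> \<Lambda> ` ?I"
    then obtain b where b: "b \<in> ?I" "v = \<Lambda> b" by blast
    have xb: "x o\<^sub>L b \<in> ?I" by (rule weight_ideal_left[OF x b(1)])
    have "u + v = \<Lambda> (a + b)" by (simp add: gns_add a b)
    moreover have "x o\<^sub>L (a + b) = (x o\<^sub>L a) + (x o\<^sub>L b)"
      by (rule bounded_bilinear.add_right[OF bounded_bilinear_blinfun_compose])
    ultimately show "u + v \<in> \<Lambda> ` ?I \<and> f (u + v) = f u + f v"
      using weight_ideal_add[OF a(1) b(1)] gns_add[OF xa xb] by (simp add: f a b)
  qed simp
  then show ?thesis using f by (auto simp: bounded_ops_def)
qed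

lemma
  assumes x: "x \<in> M"
  shows gns_rep_apply: "b \<in> weight_ideal M \<phi> \<Longrightarrow> gns_rep M \<phi> \<Lambda> x (\<Lambda> b) = \<Lambda> (x o\<^sub>L b)"
    and norm_gns_rep_le: "norm (gns_rep M \<phi> \<Lambda> x) \<le> norm x"
proof -
  obtain T :: "'k oper" where T: "T \<in> bounded_ops" "norm T \<le> norm x"
    "\<And>b. b \<in> weight_ideal M \<phi> \<Longrightarrow> T (\<Lambda> b) = \<Lambda> (x o\<^sub>L b)"
    using gns_rep_exists[OF x] by blast
  have "gns_rep M \<phi> \<Lambda> x = T"
    unfolding gns_rep_def by (rule the_equality) (use T in \<open>auto intro: gns_operator_eqI\<close>)
  then show "b \<in> weight_ideal M \<phi> \<Longrightarrow> gns_rep M \<phi> \<Lambda> x (\<Lambda> b) = \<Lambda> (x o\<^sub>L b)"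
    "norm (gns_rep M \<phi> \<Lambda> x) \<le> norm x" using T by auto
qed

lemma gns_rep_linear:
  "x \<in> M \<Longrightarrow> y \<in> M \<Longrightarrow> gns_rep M \<phi> \<Lambda> (x + y) = gns_rep M \<phi> \<Lambda> x + gns_rep M \<phi> \<Lambda> y"
  "x \<in> M \<Longrightarrow> gns_rep M \<phi> \<Lambda> (scale_op c x) = scale_op c (gns_rep M \<phi> \<Lambda> x)"
  "gns_rep M \<phi> \<Lambda> id_blinfun = id_blinfun"
proof -
  assume x: "x \<in> M"
  show "gns_rep M \<phi> \<Lambda> (scale_op c x) = scale_op c (gns_rep M \<phi> \<Lambda> x)"
    by (rule gns_operator_eqI)
       (simp add: gns_rep_apply M_closed x scale_op_apply scale_op_compose_left gns_scale weight_ideal_left)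
  assume y: "y \<in> M"
  show "gns_rep M \<phi> \<Lambda> (x + y) = gns_rep M \<phi> \<Lambda> x + gns_rep M \<phi> \<Lambda> y"
    by (rule gns_operator_eqI)
       (simp add: gns_rep_apply M_closed x y blinfun.add_left gns_add weight_ideal_left
         bounded_bilinear.add_left[OF bounded_bilinear_blinfun_compose])
next
  have "id_blinfun o\<^sub>L b = b" for b :: "'h oper" by (rule blinfun_eqI) simp
  then show "gns_rep M \<phi> \<Lambda> id_blinfun = id_blinfun"
    by (intro gns_operator_eqI) (simp add: gns_rep_apply von_neumann_cstar(2)[OF vn])
qed

end

text \<open>
  For positive \<open>x\<close> and \<open>Re c \<le> 0\<close> one has \<open>\<parallel>x + c\<parallel>\<^sup>2 \<le> \<parallel>x\<parallel>\<^sup>2 + \<bar>c\<bar>\<^sup>2\<close>, so \<open>f x + c\<close> obeys this bound; large imaginary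
  and large negative \<open>c\<close> exclude \<open>Im (f x) \<noteq> 0\<close> and \<open>Re (f x) < 0\<close>.
\<close>

lemma state_of_contraction:
  fixes M :: "'a::chilbert oper set"
  assumes M: "cstar_algebra M" "id_blinfun \<in> M"
    and add: "\<And>x y. x \<in> M \<Longrightarrow> y \<in> M \<Longrightarrow> f (x + y) = f x + f y"
    and scale: "\<And>c x. x \<in> M \<Longrightarrow> f (scale_op c x) = c * f x"
    and bound: "\<And>x. x \<in> M \<Longrightarrow> cmod (f x) \<le> norm x"
    and one: "f id_blinfun = 1"
  shows "state M f"
proof -
  note M' = cstar_algebraD[OF M(1)]
  have "f x \<in> \<real> \<and> 0 \<le> Re (f x)" if x: "x \<in> pos_part M" for x
  proof -
    have xM: "x \<in> M" and xp: "\<And>v. cinner (x v) v \<in> \<real>" "\<And>v. 0 \<le> Re (cinner (x v) v)"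
      using x by (auto simp: pos_part_def positive_op_def)
    have im: "Im (cinner (x v) v) = 0" for v using xp(1) by (simp add: complex_is_Real_iff)
    have key: "(cmod (f x + c))\<^sup>2 \<le> (norm x)\<^sup>2 + (cmod c)\<^sup>2" if "Re c \<le> 0" for c
    proof -
      have "norm (x + scale_op c id_blinfun) \<le> sqrt ((norm x)\<^sup>2 + (cmod c)\<^sup>2)"
      proof (rule norm_blinfun_bound)
        fix v
        have "cinner (x v + c *\<^sub>C v) (x v + c *\<^sub>C v)
            = of_real ((norm (x v))\<^sup>2 + (cmod c)\<^sup>2 * (norm v)\<^sup>2) + (cnj c * cinner (x v) v + c * cinner v (x v))"
          unfolding cinner_add_left cinner_add_right cinner_scaleC_left cinner_scaleC_right
          by (simp add: cinner_self algebra_simps) (simp flip: complex_norm_square)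
        moreover have "cinner v (x v) = cinner (x v) v"
          by (subst cinner_commute) (simp add: complex_eq_iff im)
        ultimately have "Re (cinner (x v + c *\<^sub>C v) (x v + c *\<^sub>C v))
            = (norm (x v))\<^sup>2 + (cmod c)\<^sup>2 * (norm v)\<^sup>2 + 2 * Re c * Re (cinner (x v) v)"
          by (simp add: im)
        moreover have "Re c * Re (cinner (x v) v) \<le> 0" by (rule mult_nonpos_nonneg[OF that xp(2)])
        ultimately have "(norm (x v + c *\<^sub>C v))\<^sup>2 \<le> (norm (x v))\<^sup>2 + (cmod c)\<^sup>2 * (norm v)\<^sup>2"
          by (simp add: cinner_self)
        also have "\<dots> \<le> (norm x * norm v)\<^sup>2 + (cmod c)\<^sup>2 * (norm v)\<^sup>2"
          by (intro add_right_mono power_mono norm_blinfun) simp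
        also have "\<dots> = (sqrt ((norm x)\<^sup>2 + (cmod c)\<^sup>2) * norm v)\<^sup>2"
          by (simp add: power_mult_distrib algebra_simps)
        finally have "norm (x v + c *\<^sub>C v) \<le> sqrt ((norm x)\<^sup>2 + (cmod c)\<^sup>2) * norm v"
          by (rule power2_le_imp_le) simp
        then show "norm ((x + scale_op c id_blinfun) v) \<le> sqrt ((norm x)\<^sup>2 + (cmod c)\<^sup>2) * norm v"
          by (simp add: blinfun.add_left scale_op_apply)
      qed simp
      moreover have "f (x + scale_op c id_blinfun) = f x + c"
        using add[OF xM M'(5)[OF M(2)]] scale[OF M(2)] one by simp
      ultimately have "cmod (f x + c) \<le> sqrt ((norm x)\<^sup>2 + (cmod c)\<^sup>2)"
        using bound[OF M'(4)[OF xM M'(5)[OF M(2)]], of c] by simp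
      then show ?thesis by (metis norm_ge_zero power_mono real_sqrt_pow2 add_nonneg_nonneg zero_le_power2)
    qed
    define B where "B = (norm x)\<^sup>2"
    have "Im (f x) = 0"
    proof (rule ccontr)
      assume nz: "Im (f x) \<noteq> 0"
      \<comment> \<open>Chosen so that \<open>2 * t * Im (f x)\<close> equals \<open>B + 1\<close>,
        just above what the estimate permits.\<close>
      define t where "t = (B + 1) / (2 * Im (f x))"
      have "(Re (f x))\<^sup>2 + (Im (f x) + t)\<^sup>2 \<le> B + t\<^sup>2"
        using key[of "\<i> * of_real t"] by (simp add: cmod_power2 B_def norm_mult)
      then have "(Re (f x))\<^sup>2 + (Im (f x))\<^sup>2 + 2 * t * Im (f x) \<le> B" by (simp add: power2_sum algebra_simps)
      then have "2 * t * Im (f x) \<le> B"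
        using zero_le_power2[of "Re (f x)"] zero_le_power2[of "Im (f x)"] by linarith
      moreover have "2 * t * Im (f x) = B + 1" using nz by (simp add: t_def)
      ultimately show False by simp
    qed
    moreover have "0 \<le> Re (f x)"
    proof (rule ccontr)
      assume neg: "\<not> 0 \<le> Re (f x)"
      \<comment> \<open>The same choice for the real part; \<open>s\<close> is negative because
        \<open>Re (f x)\<close> is, so the estimate applies to it.\<close>
      define s where "s = (B + 1) / (2 * Re (f x))"
      have s: "s \<le> 0" using neg by (simp add: s_def B_def divide_nonneg_neg)
      have "(Re (f x) + s)\<^sup>2 + (Im (f x))\<^sup>2 \<le> B + s\<^sup>2"
        using key[of "of_real s"] s by (simp add: cmod_power2 B_def)
      then have "(Re (f x))\<^sup>2 + (Im (f x))\<^sup>2 + 2 * Re (f x) * s \<le> B" by (simp add: power2_sum algebra_simps)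
      then have "2 * Re (f x) * s \<le> B"
        using zero_le_power2[of "Re (f x)"] zero_le_power2[of "Im (f x)"] by linarith
      moreover have "2 * Re (f x) * s = B + 1" using neg by (simp add: s_def)
      ultimately show False by simp
    qed
    ultimately show ?thesis by (simp add: complex_is_Real_iff)
  qed
  moreover have "\<exists>K. \<forall>x\<in>M. cmod (f x) \<le> K * norm x" using bound by (intro exI[of _ 1]) simp
  ultimately show ?thesis
    unfolding state_def positive_functional_def bounded_functional_def using add scale one by blast
qed

section \<open>Invariant means\<close>

lemma tensor_embedding_tens:
  "tensor_embedding (\<otimes>\<^sub>h)" "tensor_embedding (\<lambda>y x. x \<otimes>\<^sub>h y)"
  by (unfold_locales; simp add: cinner_tens tens_add_left tens_add_right tens_scaleC_left tens_scaleC_right)+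

lemma slice_eq:
  "slice_right = tensor_embedding.slice (\<otimes>\<^sub>h)" "slice_left = tensor_embedding.slice (\<lambda>y x. x \<otimes>\<^sub>h y)"
  by (simp_all add: fun_eq_iff slice_right_def slice_left_def tensor_embedding.slice_def[OF tensor_embedding_tens(1)]
      tensor_embedding.slice_def[OF tensor_embedding_tens(2)] vec_slice_left_def vec_slice_right_def
      tensor_embedding.vec_slice_def[OF tensor_embedding_tens(1)]
      tensor_embedding.vec_slice_def[OF tensor_embedding_tens(2)])

text \<open>A slice inherits commutation with the commutant of \<open>M\<close>, so it lies in the
  bicommutant, which is \<open>M\<close>.\<close>

lemma vec_slice_in_vn:
  fixes M :: "'a::chilbert oper set"
  assumes M: "von_neumann_algebra M" and T: "T \<in> M \<otimes>\<^sub>v M"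
  shows "tensor_embedding.vec_slice (\<otimes>\<^sub>h) h h' T \<in> M" "tensor_embedding.vec_slice (\<lambda>y x. x \<otimes>\<^sub>h y) h h' T \<in> M"
proof -
  have Mb: "M \<subseteq> bounded_ops" and Ma: "\<And>x. x \<in> M \<Longrightarrow> adj x \<in> M" and MM: "commutant (commutant M) = M"
    using M by (auto simp: von_neumann_algebra_def)
  have Tb: "T \<in> bounded_ops" using T vn_tensor_bounded[OF Mb Mb] by blast
  have comm: "T o\<^sub>L (x \<otimes>\<^sub>o y) = (x \<otimes>\<^sub>o y) o\<^sub>L T" if "x \<in> commutant M" "y \<in> commutant M" for x y
    by (rule vn_tensor_commute[OF Mb Mb Ma Ma that T])
  have y: "y \<in> bounded_ops" if "y \<in> commutant M" for y using that commutant_subset_bounded by blast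
  note i = bounded_ops_closed(2)
  interpret R: tensor_embedding "(\<otimes>\<^sub>h) :: 'a \<Rightarrow> 'a \<Rightarrow> _" by (rule tensor_embedding_tens)
  interpret L: tensor_embedding "\<lambda>y x. x \<otimes>\<^sub>h y :: ('a, 'a) htensor" by (rule tensor_embedding_tens)
  have "R.vec_slice h h' T \<in> commutant (commutant M)"
  proof (rule commutantI[OF R.vec_slice_bounded[OF Tb]])
    fix y assume yc: "y \<in> commutant M"
    show "y o\<^sub>L R.vec_slice h h' T = R.vec_slice h h' T o\<^sub>L y"
      by (rule R.vec_slice_commute[OF Tb y[OF yc], of "id_blinfun \<otimes>\<^sub>o y"])
         (simp_all add: op_tens_bounded op_tens_adj op_tens_apply adj_bounded y[OF yc] i comm[OF id_in_commutant yc])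
  qed
  then show "R.vec_slice h h' T \<in> M" by (simp add: MM)
  have "L.vec_slice h h' T \<in> commutant (commutant M)"
  proof (rule commutantI[OF L.vec_slice_bounded[OF Tb]])
    fix y assume yc: "y \<in> commutant M"
    show "y o\<^sub>L L.vec_slice h h' T = L.vec_slice h h' T o\<^sub>L y"
      by (rule L.vec_slice_commute[OF Tb y[OF yc], of "y \<otimes>\<^sub>o id_blinfun"])
         (simp_all add: op_tens_bounded op_tens_adj op_tens_apply adj_bounded y[OF yc] i comm[OF yc id_in_commutant])
  qed
  then show "L.vec_slice h h' T \<in> M" by (simp add: MM)
qed

text \<open>The mean is \<open>m\<close> composed with the GNS representation. As that
  representation is contractive and unital, the composition is again a contraction with value 1 at
  the identity, hence a state.\<close>

lemma (in gns_construction) invariant_mean_of_contraction: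
  fixes E :: "'h \<Rightarrow> 'h \<Rightarrow> ('h, 'h) htensor" and m :: "'k oper \<Rightarrow> complex"
  assumes E: "E \<in> {(\<otimes>\<^sub>h), \<lambda>y x. x \<otimes>\<^sub>h y}"
    and \<Delta>: "normal_star_hom M (M \<otimes>\<^sub>v M) \<Delta>"
    and \<Gamma>: "regular_family M \<Delta> \<phi> \<Lambda> \<Gamma>"
    and slice: "\<And>\<gamma> F. \<gamma> \<in> \<Gamma> \<Longrightarrow> F \<in> M \<Longrightarrow> tensor_embedding.slice E \<gamma> (\<Delta> F) \<in> M
        \<and> m (gns_rep M \<phi> \<Lambda> (tensor_embedding.slice E \<gamma> (\<Delta> F))) = m (gns_rep M \<phi> \<Lambda> F)"
    and m: "\<And>S T. m (S + T) = m S + m T" "\<And>c T. m (scale_op c T) = c * m T"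
      "\<And>T. cmod (m T) \<le> norm T" "m id_blinfun = 1"
  shows "\<exists>\<mu>. state M \<mu> \<and> (\<forall>F\<in>M. \<forall>\<omega>. normal_functional M \<omega> \<longrightarrow>
      \<mu> (tensor_embedding.slice E \<omega> (\<Delta> F)) = \<omega> id_blinfun * \<mu> F)"
proof -
  interpret tensor_embedding E using E tensor_embedding_tens by auto
  define \<mu> where "\<mu> x = m (gns_rep M \<phi> \<Lambda> x)" for x
  have \<mu>: "\<And>x y. x \<in> M \<Longrightarrow> y \<in> M \<Longrightarrow> \<mu> (x + y) = \<mu> x + \<mu> y"
    "\<And>c x. x \<in> M \<Longrightarrow> \<mu> (scale_op c x) = c * \<mu> x" "\<mu> id_blinfun = 1"
    by (simp_all add: \<mu>_def gns_rep_linear m)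
  have \<mu>b: "cmod (\<mu> x) \<le> norm x" if "x \<in> M" for x
    unfolding \<mu>_def using m(3) norm_gns_rep_le[OF that] by (rule order_trans)
  note vn' = von_neumann_cstar[OF vn]
  have "\<mu> (slice \<omega> (\<Delta> F)) = \<omega> id_blinfun * \<mu> F" if F: "F \<in> M" and \<omega>: "normal_functional M \<omega>" for F \<omega>
  proof (rule slice_invariant[where M=M and N=M and \<Gamma>=\<Gamma>, OF _ vn'(1) _ vn'(2) _ _ \<omega> _ \<mu>(1,2) \<mu>b])
    have T: "\<Delta> F \<in> M \<otimes>\<^sub>v M" using \<Delta> F by (auto simp: normal_star_hom_def star_hom_def)
    then show "\<Delta> F \<in> bounded_ops" using vn_tensor_bounded[OF M_closed(1) M_closed(1)] by blast
    show "vec_slice h h' (\<Delta> F) \<in> M" for h h' using E vec_slice_in_vn[OF vn T] by auto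
    show "normal_functional M \<gamma> \<and> \<gamma> id_blinfun = 1" if "\<gamma> \<in> \<Gamma>" for \<gamma>
      using \<Gamma> that by (simp add: regular_family_def state_def)
    show "\<exists>F c. finite F \<and> F \<subseteq> \<Gamma> \<and> (\<forall>x\<in>M. cmod (\<omega> x - (\<Sum>\<gamma>\<in>F. c \<gamma> * \<gamma> x)) \<le> \<epsilon> * norm x)" if "0 < \<epsilon>" for \<epsilon>
      using \<Gamma> \<omega> that by (simp add: regular_family_def)
    show "slice \<gamma> (\<Delta> F) \<in> M \<and> \<mu> (slice \<gamma> (\<Delta> F)) = \<mu> F" if "\<gamma> \<in> \<Gamma>" for \<gamma>
      using slice[OF that F] by (simp add: \<mu>_def)
  qed
  moreover have "state M \<mu>" by (rule state_of_contraction[OF vn' \<mu>(1,2) \<mu>b \<mu>(3)])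
  ultimately show ?thesis by blast
qed

text \<open>An empty family can only be dense if \<open>M = 0\<close>; then the GNS space is zero and carries no state.\<close>

lemma (in gns_construction) regular_family_nonempty:
  fixes \<tau> :: "'k oper \<Rightarrow> complex"
  assumes \<Gamma>: "regular_family M \<Delta> \<phi> \<Lambda> \<Gamma>" and \<tau>: "normal_tracial_state N \<tau>" "id_blinfun \<in> N"
  shows "\<Gamma> \<noteq> {}"
proof
  assume "\<Gamma> = {}"
  have "x = 0" if x: "x \<in> M" for x
  proof (rule blinfun_cinner_eqI)
    fix \<xi> \<eta>
    let ?\<omega> = "\<lambda>x :: 'h oper. cinner (x \<xi>) \<eta>"
    \<comment> \<open>A vector functional is a series whose only nonzero term has index 0.\<close>
    have "normal_functional M ?\<omega>"
      unfolding normal_functional_def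
    proof (intro exI conjI ballI)
      fix x :: "'h oper"
      have "(\<Sum>n. cinner (x (if n = (0::nat) then \<xi> else 0)) (if n = 0 then \<eta> else 0))
          = (\<Sum>n\<in>{0}. cinner (x (if n = (0::nat) then \<xi> else 0)) (if n = 0 then \<eta> else 0))"
        by (rule suminf_finite) (simp_all add: linear_0[OF linear_cinner_right])
      then show "cinner (x \<xi>) \<eta> = (\<Sum>n. cinner (x (if n = (0::nat) then \<xi> else 0)) (if n = 0 then \<eta> else 0))" by simp
    qed (rule summable_finite[of "{0}"]; simp)+
    \<comment> \<open>With an empty family every approximating sum is 0.\<close>
    then have "cmod (?\<omega> x) \<le> \<epsilon> * norm x" if "0 < \<epsilon>" for \<epsilon>
      using \<Gamma> \<open>\<Gamma> = {}\<close> that x unfolding regular_family_def by fastforce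
    then have "cmod (?\<omega> x) \<le> 0" using le_zero_of_small_multiples norm_ge_zero by blast
    then show "?\<omega> x = cinner ((0 :: 'h oper) \<xi>) \<eta>" by (simp add: linear_0[OF linear_cinner_left])
  qed
  then have "weight_ideal M \<phi> \<subseteq> {0}" using weight_ideal_M by blast
  then have "closure (\<Lambda> ` weight_ideal M \<phi>) \<subseteq> {\<Lambda> 0}" by (intro closure_minimal) auto
  then have K: "v = 0" for v :: 'k using gns_dense by (metis UNIV_I singletonD subsetD)
  have "id_blinfun = (0 :: 'k oper)" by (rule blinfun_eqI) (metis K)
  then have "\<tau> 0 = 1" using \<tau> by (simp add: normal_tracial_state_def state_def)
  moreover have "\<tau> (scale_op 0 id_blinfun) = 0 * \<tau> id_blinfun"
    using \<tau> unfolding normal_tracial_state_def state_def positive_functional_def bounded_functional_def by blast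
  ultimately show False by simp
qed

theorem theorem2:
  fixes M :: "'h::chilbert oper set"
    and \<Delta> :: "'h oper \<Rightarrow> ('h, 'h) htensor oper"
    and \<phi> \<psi> :: "'h oper \<Rightarrow> ennreal"
    and \<Lambda> :: "'h oper \<Rightarrow> 'k::chilbert"
    and \<Gamma> :: "('h oper \<Rightarrow> complex) set"
    and \<tau> :: "'k oper \<Rightarrow> complex"
  assumes "locally_compact_quantum_group M \<Delta> \<phi> \<psi>"
    and "gns_space M \<phi> \<Lambda>"
    and "regular_family M \<Delta> \<phi> \<Lambda> \<Gamma>"
    and "normal_tracial_state (group_vn M \<Delta> \<phi> \<Lambda>) \<tau>"
    and "approximately_amenable (reduced_cstar M \<Delta> \<phi> \<Lambda>)"
  shows "(left_covariant M \<Delta> \<phi> \<Lambda> \<Gamma> \<longrightarrow> (\<exists>\<mu>. right_invariant_mean M \<Delta> \<mu>))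
    \<and> (right_covariant M \<Delta> \<phi> \<Lambda> \<Gamma> \<longrightarrow> (\<exists>\<mu>. left_invariant_mean M \<Delta> \<mu>))"
proof -
  interpret gns_construction M \<phi> \<Lambda>
    using assms(1,2) by unfold_locales
      (auto simp: locally_compact_quantum_group_def hopf_von_neumann_algebra_def nsf_weight_def)
  have \<Delta>: "normal_star_hom M (M \<otimes>\<^sub>v M) \<Delta>"
    using assms(1) by (simp add: locally_compact_quantum_group_def hopf_von_neumann_algebra_def)
  let ?u = "left_regular M \<Delta> \<phi> \<Lambda>" and ?\<pi> = "gns_rep M \<phi> \<Lambda>"
  have u: "?u \<gamma> \<in> reduced_cstar M \<Delta> \<phi> \<Lambda>" "unitary_op (?u \<gamma>)" if "\<gamma> \<in> \<Gamma>" for \<gamma>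
    using assms(3) that by (auto simp: regular_family_def)
  \<comment> \<open>A member of the family is needed to exhibit a unitary in the reduced
    C*-algebra.\<close>
  obtain \<gamma>0 where "\<gamma>0 \<in> \<Gamma>"
    using regular_family_nonempty[OF assms(3,4)] id_in_vn_generated unfolding group_vn_def by blast
  then obtain m :: "'k oper \<Rightarrow> complex"
    where m: "\<And>S T. m (S + T) = m S + m T" "\<And>c T. m (scale_op c T) = c * m T" "\<And>T. cmod (m T) \<le> norm T" "m id_blinfun = 1"
      and inv: "\<And>u T. u \<in> reduced_cstar M \<Delta> \<phi> \<Lambda> \<Longrightarrow> unitary_op u \<Longrightarrow> m (u o\<^sub>L T o\<^sub>L adj u) = m T"
    using tracial_amenable_contraction[OF assms(4)[unfolded group_vn_def] assms(5)[unfolded reduced_cstar_def]] u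
    unfolding reduced_cstar_def by metis
  \<comment> \<open>Right covariance conjugates in the opposite direction; invariance under
    \<open>u\<close> is applied to \<open>u* T u\<close>.\<close>
  have inv': "m (adj u o\<^sub>L T o\<^sub>L u) = m T" if "u \<in> reduced_cstar M \<Delta> \<phi> \<Lambda>" "unitary_op u" for u T
  proof -
    have "u o\<^sub>L (adj u o\<^sub>L T o\<^sub>L u) o\<^sub>L adj u = (u o\<^sub>L adj u) o\<^sub>L T o\<^sub>L (u o\<^sub>L adj u)"
      by (simp only: blinfun_compose_assoc)
    also have "\<dots> = T" unfolding unitary_opD(3)[OF that(2)] by (rule blinfun_eqI) simp
    finally show ?thesis using inv[OF that, of "adj u o\<^sub>L T o\<^sub>L u"] by simp
  qed
  show ?thesis
  proof (intro conjI impI)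
    assume cov: "left_covariant M \<Delta> \<phi> \<Lambda> \<Gamma>"
    show "\<exists>\<mu>. right_invariant_mean M \<Delta> \<mu>"
      unfolding right_invariant_mean_def slice_eq
    proof (rule invariant_mean_of_contraction[OF _ \<Delta> assms(3) _ m])
      fix \<gamma> F assume g: "\<gamma> \<in> \<Gamma>" "F \<in> M"
      \<comment> \<open>The left action is a right slice of \<open>\<Delta> F\<close>; this is why
        left covariance leads to a right invariant mean.\<close>
      have "slice_right \<gamma> (\<Delta> F) \<in> M" "?\<pi> (slice_right \<gamma> (\<Delta> F)) = ?u \<gamma> o\<^sub>L ?\<pi> F o\<^sub>L adj (?u \<gamma>)"
        using cov g by (auto simp: left_covariant_def act_left_def normal_star_aut_def bij_betw_def)
      then show "tensor_embedding.slice (\<otimes>\<^sub>h) \<gamma> (\<Delta> F) \<in> M \<and> m (?\<pi> (tensor_embedding.slice (\<otimes>\<^sub>h) \<gamma> (\<Delta> F))) = m (?\<pi> F)"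
        using inv[OF u[OF g(1)]] by (simp add: slice_eq)
    qed simp
  next
    assume cov: "right_covariant M \<Delta> \<phi> \<Lambda> \<Gamma>"
    show "\<exists>\<mu>. left_invariant_mean M \<Delta> \<mu>"
      unfolding left_invariant_mean_def slice_eq
    proof (rule invariant_mean_of_contraction[OF _ \<Delta> assms(3) _ m])
      fix \<gamma> F assume g: "\<gamma> \<in> \<Gamma>" "F \<in> M"
      have "slice_left \<gamma> (\<Delta> F) \<in> M" "?\<pi> (slice_left \<gamma> (\<Delta> F)) = adj (?u \<gamma>) o\<^sub>L ?\<pi> F o\<^sub>L ?u \<gamma>"
        using cov g by (auto simp: right_covariant_def act_right_def normal_star_aut_def bij_betw_def)
      then show "tensor_embedding.slice (\<lambda>y x. x \<otimes>\<^sub>h y) \<gamma> (\<Delta> F) \<in> M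
          \<and> m (?\<pi> (tensor_embedding.slice (\<lambda>y x. x \<otimes>\<^sub>h y) \<gamma> (\<Delta> F))) = m (?\<pi> F)"
        using inv'[OF u[OF g(1)]] by (simp add: slice_eq)
    qed simp
  qed
qed

end
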